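(* Let $\mathcal{D}\subset B(0,1)\subset\mathbb{R}^d$ be a $0$-thick domain. For a starting point $(T_0,X_0)=(t,x)\in\mathbb{R}_+\times\mathcal{D}$ and $\varepsilon>0$, let $\mathcal{N}_\varepsilon=\inf\{n\ge0:\alpha(T_n,X_n)\le\varepsilon\}$ be the number of steps of the random walk on heat balls $(T_n,X_n)_{n\ge0}$ before stopping. Then $\mathcal{N}_\varepsilon$ is almost surely finite. Moreover there exist constants $C>0$ and $\varepsilon_0>0$, both independent of $(t,x)$, such that $$\mathbb{E}[\mathcal{N}_\varepsilon]\le C|\log\varepsilon|,\quad\text{for all }\varepsilon\le\varepsilon_0.$$
   Context: $\mathcal{D}\subset\mathbb{R}^d$ is a bounded finitely connected domain and $\delta(\cdot,\partial\mathcal{D})$ is the Euclidean distance to its boundary. $\mathcal{D}$ is $0$-thick if there is a constant $c>0$ such that $H^d(B(x,r)\setminus\mathcal{D})\ge c\,r^d$ for all $0<r<1$ and all $x\in\partial\mathcal{D}$, where $H^d(S)$ is the $d$-dimensional Hausdorff content of $S$. Random walk on heat balls: put $\alpha(u,v)=\min\big(u,\frac{e}{2d}\delta^2(v,\partial\mathcal{D})\big)$ and $\psi_d(s)=\sqrt{s\log(s^{-d/2})}$ for $s\in]0,1[$ (with $\psi_d(0)=\psi_d(1)=0$). Let $(U_n)_{n\ge1}$ be i.i.d. uniform random vectors on $[0,1]^{\lfloor d/2\rfloor+1}$, $\Pi_n^U$ the product of the coordinates of $U_n$, $(G_n)_{n\ge1}$ i.i.d. standard Gaussian real random variables, $(V_n)_{n\ge1}$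 i.i.d. uniform random vectors on the unit sphere of $\mathbb{R}^d$, the three sequences being independent. Set $R_n=(\Pi_n^U)^{2/d}\exp\{-(1-\frac2d\lfloor\frac d2\rfloor)G_n^2\}$. Starting from $(T_0,X_0)=(t,x)$, for $n\ge0$, $$T_{n+1}=T_n-\alpha(T_n,X_n)R_{n+1},\qquad X_{n+1}=X_n+2\sqrt{\alpha(T_n,X_n)}\,\psi_d(R_{n+1})V_{n+1}.$$ *)

theory Defs
  imports "HOL-Probability.Probability"
begin

text \<open>Throughout, \<open>\<real>\<^sup>d\<close> is \<^typ>\<open>real ^ 'n\<close> with \<open>d = CARD('n)\<close>.\<close>

section \<open>Domains and thickness\<close>

definition is_domain :: "(real ^ 'n) set \<Rightarrow> bool" where
  "is_domain D \<longleftrightarrow> open D \<and> connected D \<and> D \<noteq> {}"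

text \<open>Finite connectivity: the complement has finitely many connected components. For a bounded
  domain it does not matter whether the complement is taken in \<open>\<real>\<^sup>d\<close> or in its one-point
  compactification.\<close>

definition finitely_connected :: "(real ^ 'n) set \<Rightarrow> bool" where
  "finitely_connected D \<longleftrightarrow> finite (components (- D))"

text \<open>Finite covers need no separate treatment: for \<open>s > 0\<close> they can be continued
  by balls of arbitrarily small total cost.\<close>

definition hausdorff_content :: "real \<Rightarrow> 'a::metric_space set \<Rightarrow> ennreal" where
  "hausdorff_content s S =
     Inf {(\<Sum>i. ennreal (r i powr s)) | (x :: nat \<Rightarrow> 'a) (r :: nat \<Rightarrow> real).
            (\<forall>i. 0 < r i) \<and> S \<subseteq> (\<Union>i. ball (x i) (r i))}"

definition zero_thick :: "(real ^ 'n) set \<Rightarrow> bool" where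
  "zero_thick D \<longleftrightarrow>
     (\<exists>c>0. \<forall>x\<in>frontier D. \<forall>r. 0 < r \<and> r < 1 \<longrightarrow>
        hausdorff_content (real CARD('n)) (ball x r - D) \<ge> ennreal (c * r ^ CARD('n)))"

section \<open>The random inputs\<close>

definition cube_dim :: "'n itself \<Rightarrow> nat" where
  "cube_dim _ = CARD('n) div 2 + 1"

abbreviation coord_space :: "nat \<Rightarrow> (nat \<Rightarrow> real) measure" where
  "coord_space k \<equiv> Pi\<^sub>M {..<k} (\<lambda>_. lborel)"

definition uniform_cube :: "nat \<Rightarrow> (nat \<Rightarrow> real) measure" where
  "uniform_cube k = uniform_measure (coord_space k) (Pi\<^sub>E {..<k} (\<lambda>_. {0..1}))"

text \<open>Normalised surface measure on the unit sphere of \<open>\<real>\<^sup>d\<close>, as the radial projection of the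
  uniform distribution on the unit ball: the mass of \<open>A\<close> is the relative volume
  of the cone \<open>{r a | 0 < r \<le> 1, a \<in> A}\<close>. For \<open>d = 1\<close> this is the fair law on \<open>{-1, 1}\<close>.
  Note that \<open>sgn x = x / norm x\<close> for \<open>x \<noteq> 0\<close>.\<close>

definition uniform_sphere :: "(real ^ 'n) measure" where
  "uniform_sphere = distr (uniform_measure lborel (cball 0 1)) borel sgn"

text \<open>The \<open>\<sigma>\<close>-algebra generated by a whole sequence \<open>(Y n)\<close>, \<open>n \<ge> 1\<close>, of random elements of \<open>N\<close>.\<close>

definition seq_sigma :: "'w measure \<Rightarrow> 'b measure \<Rightarrow> (nat \<Rightarrow> 'w \<Rightarrow> 'b) \<Rightarrow> 'w set set" where
  "seq_sigma M N Y =
     sets (vimage_algebra (space M) (\<lambda>\<omega>. \<lambda>n\<in>{1..}. Y n \<omega>) (Pi\<^sub>M {1..} (\<lambda>_. N)))"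

text \<open>Mutual independence of the three sequences is independence of the three generated
  \<open>\<sigma>\<close>-algebras, since \<open>indep_vars\<close> requires a common value type.\<close>

locale rwhb_inputs = prob_space M for M :: "'w measure" +
  fixes U :: "nat \<Rightarrow> 'w \<Rightarrow> nat \<Rightarrow> real"
    and G :: "nat \<Rightarrow> 'w \<Rightarrow> real"
    and V :: "nat \<Rightarrow> 'w \<Rightarrow> real ^ 'n"
  assumes indep_U: "indep_vars (\<lambda>_. coord_space (cube_dim TYPE('n))) U {1..}"
    and law_U: "\<And>n. n \<ge> 1 \<Longrightarrow>
      distr M (coord_space (cube_dim TYPE('n))) (U n) = uniform_cube (cube_dim TYPE('n))"
    and indep_G: "indep_vars (\<lambda>_. borel) G {1..}"
    and law_G: "\<And>n. n \<ge> 1 \<Longrightarrow> distr M borel (G n) = density lborel std_normal_density"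
    and indep_V: "indep_vars (\<lambda>_. borel) V {1..}"
    and law_V: "\<And>n. n \<ge> 1 \<Longrightarrow> distr M borel (V n) = uniform_sphere"
    and indep_UGV: "indep_sets
      (\<lambda>j. [seq_sigma M (coord_space (cube_dim TYPE('n))) U,
             seq_sigma M borel G,
             seq_sigma M borel V] ! j) {..<3}"

section \<open>Random walk on heat balls\<close>

definition heat_alpha :: "(real ^ 'n) set \<Rightarrow> real \<Rightarrow> real ^ 'n \<Rightarrow> real" where
  "heat_alpha D u v = min u (exp 1 / (2 * real CARD('n)) * (infdist v (frontier D))\<^sup>2)"

definition heat_psi :: "nat \<Rightarrow> real \<Rightarrow> real" where
  "heat_psi d s = (if 0 < s \<and> s < 1 then sqrt (s * ln (s powr (- real d / 2))) else 0)"

definition heat_R :: "'n::finite itself \<Rightarrow> (nat \<Rightarrow> 'w \<Rightarrow> nat \<Rightarrow> real) \<Rightarrow> (nat \<Rightarrow> 'w \<Rightarrow> real) \<Rightarrow>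
    nat \<Rightarrow> 'w \<Rightarrow> real" where
  "heat_R _ U G n \<omega> =
     (\<Prod>i<cube_dim TYPE('n). U n \<omega> i) powr (2 / real CARD('n)) *
     exp (- (1 - 2 / real CARD('n) * real (CARD('n) div 2)) * (G n \<omega>)\<^sup>2)"

fun heat_walk :: "(real ^ 'n) set \<Rightarrow> (nat \<Rightarrow> 'w \<Rightarrow> nat \<Rightarrow> real) \<Rightarrow> (nat \<Rightarrow> 'w \<Rightarrow> real) \<Rightarrow>
    (nat \<Rightarrow> 'w \<Rightarrow> real ^ 'n) \<Rightarrow> real \<Rightarrow> real ^ 'n \<Rightarrow> nat \<Rightarrow> 'w \<Rightarrow> real \<times> (real ^ 'n)" where
  "heat_walk D U G V t x 0 \<omega> = (t, x)"
| "heat_walk D U G V t x (Suc n) \<omega> =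
     (let (T, X) = heat_walk D U G V t x n \<omega>;
          a = heat_alpha D T X;
          R = heat_R TYPE('n) U G (Suc n) \<omega>
      in (T - a * R, X + (2 * sqrt a * heat_psi CARD('n) R) *\<^sub>R V (Suc n) \<omega>))"

text \<open>The infimum is taken in \<^typ>\<open>enat\<close>, so it is \<open>\<infinity>\<close> when the walk never stops.\<close>

definition heat_steps :: "(real ^ 'n) set \<Rightarrow> (nat \<Rightarrow> 'w \<Rightarrow> nat \<Rightarrow> real) \<Rightarrow> (nat \<Rightarrow> 'w \<Rightarrow> real) \<Rightarrow>
    (nat \<Rightarrow> 'w \<Rightarrow> real ^ 'n) \<Rightarrow> real \<Rightarrow> real ^ 'n \<Rightarrow> real \<Rightarrow> 'w \<Rightarrow> enat" where
  "heat_steps D U G V t x \<epsilon> \<omega> =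
     Inf {enat n | n. case heat_walk D U G V t x n \<omega> of (T, X) \<Rightarrow> heat_alpha D T X \<le> \<epsilon>}"

end

theory Submission
  imports Defs
begin

text \<open>Integrating \<open>|x - y|\<^sup>-\<^sup>d\<close> over \<open>y\<close> in the complement of \<open>D\<close> gives a potential that grows only
  like \<open>log (1 / \<delta>(x))\<close>, is subharmonic, and, since the complement has volume at least \<open>c r\<^sup>d\<close> near the
  boundary, has Laplacian at least \<open>c / \<delta>(x)\<^sup>2\<close>. A step of the walk is either limited by the space
  variable, and then the potential increases by a fixed amount on average, or by the time variable,
  and then the time left shrinks by the factor \<open>1 - R\<close>. For small \<open>\<gamma>\<close> both effects make
  \<open>exp (- \<gamma> potential(X)) min(T, const)\<close> decay geometrically in mean. As this function is at
  least a power of \<open>\<epsilon>\<close> while \<open>\<alpha> > \<epsilon>\<close>, the probability that the walk is still running after \<open>n\<close> steps is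
  at most \<open>C \<epsilon>\<^sup>-\<^sup>b q\<^sup>n\<close>, and summing over \<open>n\<close> gives the logarithmic bound.\<close>

section \<open>Uniform distribution on the sphere\<close>

text \<open>The exponent \<open>d\<close> serves both ends. The Laplacian of \<open>|z|^(-q)\<close>
  is \<open>q (q + 2 - d) |z|^(-q - 2)\<close>, so \<open>q = d\<close> is strictly subharmonic
  where the harmonic exponent \<open>d - 2\<close> would yield no gain; and \<open>q = d\<close> is
  the critical exponent at which the integral over the complement diverges only logarithmically at
  the boundary, so that \<open>exp (- \<gamma> * potential x)\<close> stays above a power of the
  distance. The obstacle is that the largest jump equals the distance to the boundary: the walk may
  land arbitrarily close to the complement, the increment of the potential is unbounded, and its
  exponential has no uniform second-order expansion. Since only a lower bound for the increment is
  needed, the kernel is replaced by a minorant with bounded increment whose spherical mean still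
  exceeds the value at the centre. The expansion then gains order \<open>\<gamma>\<close> and loses
  order \<open>\<gamma>^2\<close>. Capping the time keeps the Lyapunov function bounded for
  arbitrarily large \<open>t\<close>, which is why the constants do not depend on the starting
  point.\<close>

lemma orthogonal_transformation_borel:
  fixes f :: "'a::euclidean_space \<Rightarrow> 'a"
  assumes "orthogonal_transformation f"
  shows "f \<in> borel \<rightarrow>\<^sub>M borel"
  using assms by (intro borel_measurable_continuous_onI linear_continuous_on)
    (simp add: orthogonal_transformation_linear linear_conv_bounded_linear[symmetric])

text \<open>Lebesgue measure is the only translation invariant measure up to a factor: integrate
  \<open>1\<^sub>S(f y) 1\<^sub>B(f y - x)\<close> over \<open>x\<close> and \<open>y\<close> in both orders, with \<open>B\<close> the unit ball.\<close>

lemma distr_lborel_orthogonal: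
  fixes f :: "'a::euclidean_space \<Rightarrow> 'a"
  assumes f: "orthogonal_transformation f"
  shows "distr lborel borel f = lborel"
proof (rule measure_eqI)
  have [measurable]: "f \<in> borel \<rightarrow>\<^sub>M borel" by (rule orthogonal_transformation_borel[OF f])
  \<comment> \<open>\<open>g\<close> is a right inverse of \<open>f\<close>: translating
    \<open>y\<close> by \<open>g x\<close> translates \<open>f y\<close> by
    \<open>x\<close>.\<close>
  obtain g where g: "\<And>x. f (g x) = x"
    using orthogonal_transformation_surj[OF f] by (metis surjD)
  have f_add: "f (x + y) = f x + f y" for x y
    using orthogonal_transformation_linear[OF f] by (rule linear_add)
  let ?B = "cball 0 1 :: 'a set"
  have translate: "(\<integral>\<^sup>+y. h (c + y) \<partial>lborel) = (\<integral>\<^sup>+y. h y \<partial>lborel)"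
    if [measurable]: "h \<in> borel_measurable borel" for h :: "'a \<Rightarrow> ennreal" and c
    using nn_integral_distr[of "(+) c" lborel borel h] by (simp add: lborel_distr_plus)
  fix S assume "S \<in> sets (distr lborel borel f)"
  then have [measurable]: "S \<in> sets borel" by simp
  have [measurable]: "?B \<in> sets borel" by simp
  let ?v = "emeasure lborel ?B"
  have v: "?v \<noteq> 0" "?v \<noteq> \<top>"
    by (auto simp: emeasure_cball unit_ball_vol_pos less_imp_neq[symmetric] ennreal_eq_0_iff not_le)
  have "emeasure (distr lborel borel f) S * ?v = (\<integral>\<^sup>+y. indicator S (f y) * ?v \<partial>lborel)"
    using nn_integral_distr[of f lborel borel "indicator S"] by (simp add: nn_integral_multc)
  also have "\<dots> = (\<integral>\<^sup>+y. (\<integral>\<^sup>+x. indicator S (f y) * indicator ?B (f y - x) \<partial>lborel) \<partial>lborel)"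
  proof (rule nn_integral_cong)
    fix y
    have "?v = emeasure lborel (cball (f y) 1)" by (simp add: emeasure_cball)
    also have "\<dots> = (\<integral>\<^sup>+x. indicator (cball (f y) 1) x \<partial>lborel)" by simp
    also have "\<dots> = (\<integral>\<^sup>+x. indicator ?B (f y - x) \<partial>lborel)"
      by (intro nn_integral_cong) (auto simp: indicator_def dist_norm norm_minus_commute)
    finally have v_eq: "?v = (\<integral>\<^sup>+x. indicator ?B (f y - x) \<partial>lborel)" .
    have [measurable]: "(\<lambda>x. indicator ?B (f y - x) :: ennreal) \<in> borel_measurable borel"
      by (rule measurable_compose[where f="\<lambda>x. f y - x" and N=borel]) (auto intro!: borel_measurable_indicator)
    show "indicator S (f y) * ?v = (\<integral>\<^sup>+x. indicator S (f y) * indicator ?B (f y - x) \<partial>lborel)"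
      unfolding v_eq by (rule nn_integral_cmult[symmetric]) simp
  qed
  also have "\<dots> = (\<integral>\<^sup>+x. (\<integral>\<^sup>+y. indicator S (f y) * indicator ?B (f y - x) \<partial>lborel) \<partial>lborel)"
    by (rule lborel_pair.Fubini') measurable
  also have "\<dots> = (\<integral>\<^sup>+x. (\<integral>\<^sup>+y. indicator S (f y + x) * indicator ?B (f y) \<partial>lborel) \<partial>lborel)"
  proof (rule nn_integral_cong)
    fix x
    show "(\<integral>\<^sup>+y. indicator S (f y) * indicator ?B (f y - x) \<partial>lborel) =
        (\<integral>\<^sup>+y. indicator S (f y + x) * indicator ?B (f y) \<partial>lborel)"
      using translate[of "\<lambda>y. indicator S (f y) * indicator ?B (f y - x)" "g x"]
      by (simp add: f_add g add.commute)
  qed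
  also have "\<dots> = (\<integral>\<^sup>+y. (\<integral>\<^sup>+x. indicator S (f y + x) * indicator ?B (f y) \<partial>lborel) \<partial>lborel)"
    by (rule lborel_pair.Fubini') measurable
  also have "\<dots> = (\<integral>\<^sup>+y. emeasure lborel S * indicator ?B y \<partial>lborel)"
  proof (rule nn_integral_cong)
    fix y
    show "(\<integral>\<^sup>+x. indicator S (f y + x) * indicator ?B (f y) \<partial>lborel) = emeasure lborel S * indicator ?B y"
    proof -
      have "(\<integral>\<^sup>+x. indicator S (f y + x) \<partial>lborel) = emeasure lborel S"
        using translate[of "indicator S" "f y"] by simp
      moreover have "(indicator ?B (f y) :: ennreal) = indicator ?B y"
        by (simp add: indicator_def orthogonal_transformation_norm[OF f])
      ultimately show ?thesis by (subst nn_integral_multc) auto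
    qed
  qed
  also have "\<dots> = emeasure lborel S * ?v" by (simp add: nn_integral_cmult)
  finally show "emeasure (distr lborel borel f) S = emeasure lborel S"
    using v unfolding mult.commute[of _ ?v] ennreal_mult_cancel_left by simp
qed simp

text \<open>The origin, the only point that \<open>sgn\<close> does not send to the sphere, is a
  null set.\<close>

lemma uniform_sphere_norm: "AE v in (uniform_sphere :: (real ^ 'n) measure). norm v = 1"
proof -
  have "AE x in (lborel :: (real ^ 'n) measure). x \<noteq> 0"
    by (rule AE_lborel_singleton)
  then have "AE x in uniform_measure lborel (cball 0 1 :: (real ^ 'n) set). norm (sgn x) = 1"
    by (intro AE_uniform_measureI) (auto simp: norm_sgn)
  then show ?thesis
    unfolding uniform_sphere_def by (subst AE_distr_iff) auto
qed

lemma prob_space_uniform_sphere: "prob_space (uniform_sphere :: (real ^ 'n) measure)"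
proof -
  have "prob_space (uniform_measure lborel (cball 0 1 :: (real ^ 'n) set))"
    by (rule prob_space_uniform_measure) (auto simp: emeasure_cball unit_ball_vol_def Gamma_eq_zero_iff)
  then show ?thesis
    unfolding uniform_sphere_def by (rule prob_space.prob_space_distr) simp
qed

lemma sets_uniform_sphere [measurable_cong, simp]: "sets uniform_sphere = sets borel"
  by (simp add: uniform_sphere_def)

lemma space_uniform_sphere [simp]: "space uniform_sphere = UNIV"
  by (simp add: uniform_sphere_def)

text \<open>A linear isometry commutes with \<open>sgn\<close> and preserves both the ball and
  Lebesgue measure.\<close>

lemma distr_uniform_sphere_orthogonal:
  fixes f :: "real ^ 'n \<Rightarrow> real ^ 'n"
  assumes f: "orthogonal_transformation f"
  shows "distr uniform_sphere borel f = uniform_sphere"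
proof -
  have [measurable]: "f \<in> borel \<rightarrow>\<^sub>M borel" by (rule orthogonal_transformation_borel[OF f])
  let ?B = "cball 0 1 :: (real ^ 'n) set"
  have fs: "f (sgn x) = sgn (f x)" for x
    by (simp add: sgn_div_norm orthogonal_transformation_scaleR[OF f] orthogonal_transformation_norm[OF f])
  have "distr uniform_sphere borel f = distr (uniform_measure lborel ?B) borel (\<lambda>x. sgn (f x))"
    unfolding uniform_sphere_def by (subst distr_distr) (auto simp: comp_def fs)
  also have "\<dots> = distr (distr (uniform_measure lborel ?B) borel f) borel sgn"
    by (subst distr_distr) (auto simp: comp_def)
  also have "distr (uniform_measure lborel ?B) borel f = uniform_measure lborel ?B"
  proof (rule measure_eqI)
    fix S assume "S \<in> sets (distr (uniform_measure lborel ?B) borel f)"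
    then have [measurable]: "S \<in> sets borel" by simp
    have [measurable]: "f -` S \<in> sets borel" by (rule measurable_sets_borel[where M=borel]) auto
    have "emeasure lborel (?B \<inter> f -` S) = emeasure lborel (f -` (?B \<inter> S))"
      by (intro arg_cong[where f="emeasure lborel"]) (auto simp: orthogonal_transformation_norm[OF f])
    also have "\<dots> = emeasure (distr lborel borel f) (?B \<inter> S)"
      by (subst emeasure_distr) auto
    finally have "emeasure lborel (?B \<inter> f -` S) = emeasure lborel (?B \<inter> S)"
      by (simp add: distr_lborel_orthogonal[OF f])
    then show "emeasure (distr (uniform_measure lborel ?B) borel f) S = emeasure (uniform_measure lborel ?B) S"
      by (simp add: emeasure_distr)
  qed simp
  finally show ?thesis unfolding uniform_sphere_def .
qed

lemma integral_uniform_sphere_orthogonal: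
  fixes f :: "real ^ 'n \<Rightarrow> real ^ 'n" and h :: "real ^ 'n \<Rightarrow> real"
  assumes f: "orthogonal_transformation f" and [measurable]: "h \<in> borel_measurable borel"
  shows "(\<integral>v. h (f v) \<partial>uniform_sphere) = (\<integral>v. h v \<partial>uniform_sphere)"
proof -
  have [measurable]: "f \<in> borel \<rightarrow>\<^sub>M borel" by (rule orthogonal_transformation_borel[OF f])
  have "(\<integral>v. h v \<partial>distr uniform_sphere borel f) = (\<integral>v. h (f v) \<partial>uniform_sphere)"
    by (rule integral_distr) auto
  then show ?thesis by (simp add: distr_uniform_sphere_orthogonal[OF f])
qed

section \<open>Differentiation under the integral and integration by parts on the sphere\<close>

text \<open>By the mean value inequality the difference quotients are bounded by \<open>B\<close>, a
  constant that a finite measure integrates, so dominated convergence applies along every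
  sequence.\<close>

lemma has_real_derivative_integral:
  fixes f f' :: "real \<Rightarrow> 'a \<Rightarrow> real"
  assumes "finite_measure M"
    and meas: "\<And>s. f s \<in> borel_measurable M" and meas': "f' s0 \<in> borel_measurable M"
    and s0: "s0 \<in> {a<..<b}"
    and der: "AE x in M. \<forall>s\<in>{a<..<b}. ((\<lambda>s. f s x) has_real_derivative f' s x) (at s) \<and> \<bar>f' s x\<bar> \<le> B"
    and int: "\<And>s. s \<in> {a<..<b} \<Longrightarrow> integrable M (f s)"
  shows "((\<lambda>s. \<integral>x. f s x \<partial>M) has_real_derivative (\<integral>x. f' s0 x \<partial>M)) (at s0)"
proof -
  interpret finite_measure M by fact
  note meas[measurable] meas'[measurable]
  define e where "e = min (s0 - a) (b - s0)"
  have e: "e > 0" "\<And>h. \<bar>h\<bar> < e \<Longrightarrow> s0 + h \<in> {a<..<b}" using s0 by (auto simp: e_def)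
  show ?thesis unfolding has_field_derivative_def[symmetric] DERIV_def
  proof (subst tendsto_at_iff_sequentially, intro allI impI, unfold comp_def)
    fix X :: "nat \<Rightarrow> real" assume X: "\<forall>i. X i \<in> UNIV - {0}" "X \<longlonglongrightarrow> 0"
    have ev: "\<forall>\<^sub>F i in sequentially. \<bar>X i\<bar> < e"
      using X(2) e(1) by (auto simp: tendsto_iff dist_real_def)
    \<comment> \<open>Where \<open>s0 + X i\<close> may leave the interval the quotient is replaced
      by 0, so that the bound holds for every \<open>i\<close> and not just eventually.\<close>
    define g where "g i x = (if \<bar>X i\<bar> < e then (f (s0 + X i) x - f s0 x) / X i else 0)" for i x
    have [measurable]: "g i \<in> borel_measurable M" for i unfolding g_def by measurable
    have "(\<lambda>i. \<integral>x. g i x \<partial>M) \<longlonglongrightarrow> (\<integral>x. f' s0 x \<partial>M)"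
    proof (rule integral_dominated_convergence[where w="\<lambda>_. \<bar>B\<bar>"])
      show "AE x in M. (\<lambda>i. g i x) \<longlonglongrightarrow> f' s0 x"
        using der
      proof eventually_elim
        case (elim x)
        then have "((\<lambda>h. (f (s0 + h) x - f s0 x) / h) \<longlongrightarrow> f' s0 x) (at 0)"
          using s0 by (auto simp: DERIV_def)
        then have "(\<lambda>i. (f (s0 + X i) x - f s0 x) / X i) \<longlonglongrightarrow> f' s0 x"
          using X by (auto simp: tendsto_at_iff_sequentially comp_def)
        then show ?case
          by (rule Lim_transform_eventually) (use ev in eventually_elim, auto simp: g_def)
      qed
      show "AE x in M. norm (g i x) \<le> \<bar>B\<bar>" for i
        using der
      proof eventually_elim
        case (elim x)
        show ?case
        proof (cases "\<bar>X i\<bar> < e")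
          case True
          have "norm (f (s0 + X i) x - f s0 x) \<le> \<bar>B\<bar> * norm (s0 + X i - s0)"
          proof (rule field_differentiable_bound[where S="{a<..<b}" and f'="\<lambda>s. f' s x"])
            fix s assume s: "s \<in> {a<..<b}"
            show "((\<lambda>s. f s x) has_field_derivative f' s x) (at s within {a<..<b})"
              using elim s by (auto intro: has_field_derivative_at_within)
            show "norm (f' s x) \<le> \<bar>B\<bar>" using elim s by force
          qed (use s0 e(2)[OF True] in auto)
          then show ?thesis using X(1) True by (auto simp: g_def abs_divide divide_simps)
        qed (simp add: g_def)
      qed
    qed auto
    moreover have "\<forall>\<^sub>F i in sequentially. (\<integral>x. g i x \<partial>M) = ((\<integral>x. f (s0 + X i) x \<partial>M) - (\<integral>x. f s0 x \<partial>M)) / X i"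
      using ev
    proof eventually_elim
      case (elim i)
      then show ?case using int[OF e(2)[OF elim]] int[OF s0] by (simp add: g_def)
    qed
    ultimately show "(\<lambda>i. ((\<integral>x. f (s0 + X i) x \<partial>M) - (\<integral>x. f s0 x \<partial>M)) / X i) \<longlonglongrightarrow> (\<integral>x. f' s0 x \<partial>M)"
      by (rule Lim_transform_eventually)
  qed
qed

lemma integrable_uniform_sphere:
  fixes h :: "real ^ 'n \<Rightarrow> real"
  assumes [measurable]: "h \<in> borel_measurable borel" and B: "\<And>v. norm v = 1 \<Longrightarrow> \<bar>h v\<bar> \<le> B"
  shows "integrable uniform_sphere h"
proof -
  interpret prob_space "uniform_sphere :: (real ^ 'n) measure" by (rule prob_space_uniform_sphere)
  show ?thesis
    by (rule integrable_const_bound[where B=B])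
      (use uniform_sphere_norm in eventually_elim, use B in auto)
qed

definition plane_rotation :: "'n \<Rightarrow> 'n \<Rightarrow> real \<Rightarrow> real ^ 'n \<Rightarrow> real ^ 'n" where
  "plane_rotation k j \<theta> v = (\<chi> i. if i = k then v $ k * cos \<theta> + v $ j * sin \<theta>
     else if i = j then v $ j * cos \<theta> - v $ k * sin \<theta> else v $ i)"

lemma orthogonal_plane_rotation:
  fixes k j :: "'n::finite"
  assumes "k \<noteq> j"
  shows "orthogonal_transformation (plane_rotation k j \<theta>)"
  unfolding orthogonal_transformation
proof
  show "linear (plane_rotation k j \<theta>)"
    by (rule linearI) (auto simp: plane_rotation_def vec_eq_iff algebra_simps)
  show "\<forall>v. norm (plane_rotation k j \<theta> v) = norm v"
  proof
    fix v :: "real ^ 'n"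
    have split: "(\<Sum>i\<in>UNIV. h i) = h k + h j + (\<Sum>i\<in>UNIV - {k} - {j}. h i)" for h :: "'n \<Rightarrow> real"
      using assms by (simp add: sum.remove[of UNIV k] sum.remove[of "UNIV - {k}" j])
    have *: "(v $ k * cos \<theta> + v $ j * sin \<theta>)\<^sup>2 + (v $ j * cos \<theta> - v $ k * sin \<theta>)\<^sup>2 =
        ((v $ k)\<^sup>2 + (v $ j)\<^sup>2) * ((sin \<theta>)\<^sup>2 + (cos \<theta>)\<^sup>2)"
      by (simp only: power2_eq_square) algebra
    have "(\<Sum>i\<in>UNIV. (plane_rotation k j \<theta> v $ i)\<^sup>2) = (\<Sum>i\<in>UNIV. (v $ i)\<^sup>2)"
      unfolding split[of "\<lambda>i. (plane_rotation k j \<theta> v $ i)\<^sup>2"] split[of "\<lambda>i. (v $ i)\<^sup>2"]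
      using assms * by (simp add: plane_rotation_def)
    then show "norm (plane_rotation k j \<theta> v) = norm v"
      by (simp add: norm_vec_def L2_set_def)
  qed
qed

lemma uniform_sphere_coordinate_mean:
  fixes k :: "'n::finite"
  shows "(\<integral>v. v $ k \<partial>(uniform_sphere :: (real ^ 'n) measure)) = 0"
proof -
  have "orthogonal_transformation (uminus :: real ^ 'n \<Rightarrow> real ^ 'n)"
    by (simp add: orthogonal_transformation_def linear_uminus)
  from integral_uniform_sphere_orthogonal[OF this, of "\<lambda>v. v $ k"] show ?thesis
    by simp
qed

text \<open>Integration by parts on the sphere: differentiate the integral of \<open>v\<^sub>j g(v\<^sub>k)\<close>, which is
  invariant under the rotations of the \<open>(k, j)\<close>-plane, and sum over \<open>j\<close>.\<close>

lemma uniform_sphere_stein: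
  fixes k :: "'n::finite" and g g' :: "real \<Rightarrow> real"
  assumes [measurable]: "g \<in> borel_measurable borel" "g' \<in> borel_measurable borel"
    and der: "\<And>x. \<bar>x\<bar> \<le> 1 \<Longrightarrow> (g has_real_derivative g' x) (at x)"
    and bnd: "\<And>x. \<bar>x\<bar> \<le> 1 \<Longrightarrow> \<bar>g x\<bar> \<le> B" "\<And>x. \<bar>x\<bar> \<le> 1 \<Longrightarrow> \<bar>g' x\<bar> \<le> B"
  shows "(real CARD('n) - 1) * (\<integral>v. v $ k * g (v $ k) \<partial>(uniform_sphere :: (real ^ 'n) measure)) =
    (\<integral>v. (1 - (v $ k)\<^sup>2) * g' (v $ k) \<partial>(uniform_sphere :: (real ^ 'n) measure))"
proof -
  let ?\<mu> = "uniform_sphere :: (real ^ 'n) measure"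
  interpret prob_space ?\<mu> by (rule prob_space_uniform_sphere)
  have le1: "\<bar>v $ i\<bar> \<le> 1" if "norm v = 1" for v :: "real ^ 'n" and i
    using component_le_norm_cart[of v i] that by simp
  have B: "B \<ge> 0" using bnd(1)[of 0] by simp
  have mB: "\<bar>a * b\<bar> \<le> B" if "\<bar>a\<bar> \<le> 1" "\<bar>b\<bar> \<le> B" for a b :: real
    using mult_mono[OF that] by (simp add: abs_mult)
  have sq1: "\<bar>a\<^sup>2\<bar> \<le> 1" if "\<bar>a\<bar> \<le> 1" for a :: real
    using that by (simp add: abs_square_le_1)
  have int1: "integrable ?\<mu> (\<lambda>v. v $ k * g (v $ k))"
    by (rule integrable_uniform_sphere[where B=B]) (auto intro!: mB le1 bnd)
  have int2: "integrable ?\<mu> (\<lambda>v. (v $ j)\<^sup>2 * g' (v $ k))" for j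
    by (rule integrable_uniform_sphere[where B=B]) (auto intro!: mB sq1 le1 bnd)
  have key: "(\<integral>v. (v $ j)\<^sup>2 * g' (v $ k) \<partial>?\<mu>) = (\<integral>v. v $ k * g (v $ k) \<partial>?\<mu>)" if jk: "j \<noteq> k" for j
  proof -
    define h where "h v = v $ j * g (v $ k)" for v :: "real ^ 'n"
    define f' where "f' \<theta> v = (- (v $ j) * sin \<theta> - v $ k * cos \<theta>) * g (v $ k * cos \<theta> + v $ j * sin \<theta>)
      + (v $ j * cos \<theta> - v $ k * sin \<theta>)\<^sup>2 * g' (v $ k * cos \<theta> + v $ j * sin \<theta>)" for \<theta> and v :: "real ^ 'n"
    have [measurable]: "h \<in> borel_measurable borel" unfolding h_def by measurable
    have ot: "orthogonal_transformation (plane_rotation k j \<theta> :: real ^ 'n \<Rightarrow> real ^ 'n)" for \<theta>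
      using jk by (intro orthogonal_plane_rotation) auto
    have [measurable]: "plane_rotation k j \<theta> \<in> (borel :: (real ^ 'n) measure) \<rightarrow>\<^sub>M borel" for \<theta>
      by (rule orthogonal_transformation_borel[OF ot])
    have h_rot: "h (plane_rotation k j \<theta> v) = (v $ j * cos \<theta> - v $ k * sin \<theta>) * g (v $ k * cos \<theta> + v $ j * sin \<theta>)" for \<theta> v
      using jk by (simp add: h_def plane_rotation_def)
    have hB: "\<bar>h v\<bar> \<le> B" if "norm v = 1" for v
      unfolding h_def using that by (intro mB le1 bnd)
    have "((\<lambda>\<theta>. \<integral>v. h (plane_rotation k j \<theta> v) \<partial>?\<mu>) has_real_derivative (\<integral>v. f' 0 v \<partial>?\<mu>)) (at 0)"
    proof (rule has_real_derivative_integral[where a="-1" and b=1 and B="2 * B + 4 * B"])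
      show "finite_measure ?\<mu>" by unfold_locales
      show "f' 0 \<in> borel_measurable ?\<mu>" unfolding f'_def by measurable
      show "integrable ?\<mu> (\<lambda>v. h (plane_rotation k j s v))" for s
        by (rule integrable_uniform_sphere[where B=B])
          (auto intro!: hB simp: orthogonal_transformation_norm[OF ot])
      show "AE v in ?\<mu>. \<forall>\<theta>\<in>{-1<..<1}. ((\<lambda>\<theta>. h (plane_rotation k j \<theta> v)) has_real_derivative f' \<theta> v) (at \<theta>) \<and> \<bar>f' \<theta> v\<bar> \<le> 2 * B + 4 * B"
        using uniform_sphere_norm
      proof eventually_elim
        case (elim v)
        have a1: "\<bar>v $ k * cos \<theta> + v $ j * sin \<theta>\<bar> \<le> 1" for \<theta>
          using le1[of "plane_rotation k j \<theta> v" k] elim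
          by (simp add: orthogonal_transformation_norm[OF ot]) (simp add: plane_rotation_def)
        have m1: "\<bar>v $ i * sin \<theta>\<bar> \<le> 1" "\<bar>v $ i * cos \<theta>\<bar> \<le> 1" for i \<theta>
          using le1[OF elim, of i] by (auto simp: abs_mult intro!: mult_le_one)
        have a2: "\<bar>- (v $ j) * sin \<theta> - v $ k * cos \<theta>\<bar> \<le> 2" "\<bar>v $ j * cos \<theta> - v $ k * sin \<theta>\<bar> \<le> 2" for \<theta>
          using m1[of j \<theta>] m1[of k \<theta>] by linarith+
        have a3: "\<bar>(v $ j * cos \<theta> - v $ k * sin \<theta>)\<^sup>2\<bar> \<le> 4" for \<theta>
          using power_mono[OF a2(2)[of \<theta>], of 2] by simp
        show ?case
        proof (intro ballI conjI)
          fix \<theta> :: real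
          show "((\<lambda>\<theta>. h (plane_rotation k j \<theta> v)) has_real_derivative f' \<theta> v) (at \<theta>)"
            unfolding h_rot f'_def
            by (rule DERIV_cong[OF DERIV_mult[OF _ DERIV_chain2[where f=g
                and g="\<lambda>\<theta>. v $ k * cos \<theta> + v $ j * sin \<theta>", OF der[OF a1[of \<theta>]]]]])
              (auto intro!: derivative_eq_intros simp: power2_eq_square algebra_simps)
          have "\<bar>f' \<theta> v\<bar> \<le> \<bar>- (v $ j) * sin \<theta> - v $ k * cos \<theta>\<bar> * \<bar>g (v $ k * cos \<theta> + v $ j * sin \<theta>)\<bar>
              + \<bar>(v $ j * cos \<theta> - v $ k * sin \<theta>)\<^sup>2\<bar> * \<bar>g' (v $ k * cos \<theta> + v $ j * sin \<theta>)\<bar>"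
            unfolding f'_def by (rule order.trans[OF abs_triangle_ineq]) (simp only: abs_mult order.refl)
          also have "\<dots> \<le> 2 * B + 4 * B"
            by (intro add_mono mult_mono a2 a3 bnd a1) (use B in auto)
          finally show "\<bar>f' \<theta> v\<bar> \<le> 2 * B + 4 * B" .
        qed
      qed
    qed (auto simp: measurable_compose)
    moreover have "(\<integral>v. h (plane_rotation k j \<theta> v) \<partial>?\<mu>) = (\<integral>v. h v \<partial>?\<mu>)" for \<theta>
      by (rule integral_uniform_sphere_orthogonal[OF ot]) measurable
    ultimately have "(\<integral>v. f' 0 v \<partial>?\<mu>) = 0"
      using DERIV_unique[OF _ DERIV_const] by simp
    moreover have "f' 0 = (\<lambda>v. (v $ j)\<^sup>2 * g' (v $ k) - v $ k * g (v $ k))"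
      by (simp add: f'_def fun_eq_iff)
    ultimately show ?thesis
      by (simp only: Bochner_Integration.integral_diff[OF int2[of j] int1])
  qed
  \<comment> \<open>On the sphere \<open>1 - (v $ k)^2\<close> is the sum of the other squared
    coordinates, and \<open>key\<close> gives each of them the same integral.\<close>
  have "(\<integral>v. (1 - (v $ k)\<^sup>2) * g' (v $ k) \<partial>?\<mu>) = (\<integral>v. (\<Sum>j\<in>UNIV - {k}. (v $ j)\<^sup>2 * g' (v $ k)) \<partial>?\<mu>)"
  proof (rule integral_cong_AE)
    show "AE v in ?\<mu>. (1 - (v $ k)\<^sup>2) * g' (v $ k) = (\<Sum>j\<in>UNIV - {k}. (v $ j)\<^sup>2 * g' (v $ k))"
      using uniform_sphere_norm
    proof eventually_elim
      case (elim v)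
      then have "(\<Sum>i\<in>UNIV. (v $ i)\<^sup>2) = 1"
        by (simp add: norm_vec_def L2_set_def)
      then show ?case
        by (simp add: sum.remove[of UNIV k] sum_distrib_right[symmetric])
    qed
  qed measurable
  also have "\<dots> = (\<Sum>j\<in>UNIV - {k}. \<integral>v. (v $ j)\<^sup>2 * g' (v $ k) \<partial>?\<mu>)"
    by (rule Bochner_Integration.integral_sum) (rule int2)
  also have "\<dots> = (\<Sum>j\<in>UNIV - {k}. \<integral>v. v $ k * g (v $ k) \<partial>?\<mu>)"
    by (intro sum.cong refl key) auto
  also have "\<dots> = (real CARD('n) - 1) * (\<integral>v. v $ k * g (v $ k) \<partial>?\<mu>)"
    by (simp add: card_Diff_singleton of_nat_diff Suc_le_eq)
  finally show ?thesis ..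
qed

section \<open>Spherical means of the kernel \<open>|e + s v|^(-d)\<close>\<close>

text \<open>For unit vectors \<open>e\<close>, \<open>v\<close> with inner product \<open>x\<close>
  the right-hand side is \<open>|e + s v|^2\<close>; the bound is the reverse triangle
  inequality.\<close>

lemma kernel_base_lower:
  fixes s x :: real
  assumes "\<bar>x\<bar> \<le> 1"
  shows "(1 - \<bar>s\<bar>)\<^sup>2 \<le> 1 + s\<^sup>2 + 2 * s * x"
proof -
  have "\<bar>s * x\<bar> \<le> \<bar>s\<bar>" using assms by (simp add: abs_mult mult_left_le)
  then show ?thesis by (simp add: power2_eq_square algebra_simps)
qed

lemma kernel_base_pos:
  fixes s x :: real
  assumes "\<bar>x\<bar> \<le> 1" "\<bar>s\<bar> < 1"
  shows "0 < 1 + s\<^sup>2 + 2 * s * x"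
proof -
  have "0 < (1 - \<bar>s\<bar>)\<^sup>2" using assms by simp
  with kernel_base_lower[OF assms(1), of s] show ?thesis by linarith
qed

lemma kernel_base_upper:
  fixes s x :: real
  assumes "\<bar>x\<bar> \<le> 1" "\<bar>s\<bar> \<le> 1"
  shows "1 + s\<^sup>2 + 2 * s * x \<le> 4"
proof -
  have "\<bar>s * x\<bar> \<le> 1" "s\<^sup>2 \<le> 1" using assms by (auto simp: abs_mult mult_le_one abs_square_le_1)
  then show ?thesis by linarith
qed

lemma kernel_powr_le:
  fixes s x r q :: real
  assumes "\<bar>x\<bar> \<le> 1" "\<bar>s\<bar> \<le> r" "r < 1" "q \<ge> 0"
  shows "(1 + s\<^sup>2 + 2 * s * x) powr (- q) \<le> ((1 - r)\<^sup>2) powr (- q)"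
proof (rule powr_mono2')
  have "(1 - r)\<^sup>2 \<le> (1 - \<bar>s\<bar>)\<^sup>2" using assms by (intro power_mono) auto
  with kernel_base_lower[OF assms(1), of s] show "(1 - r)\<^sup>2 \<le> 1 + s\<^sup>2 + 2 * s * x" by simp
qed (use assms in auto)

text \<open>With \<open>m(s) = E[u\<^sup>-\<^sup>p]\<close>, \<open>u = |e + s V|\<^sup>2\<close> and \<open>p = d / 2\<close>, integration by parts on the sphere
  turns \<open>s m'' + (d - 1) m'\<close> into \<open>2 d s E[u\<^sup>-\<^sup>p\<^sup>-\<^sup>1]\<close>: this is the Darboux equation for the
  strictly subharmonic function \<open>|z|\<^sup>-\<^sup>d\<close>.\<close>

lemma uniform_sphere_kernel_mean_coordinate:
  fixes k :: "'n::finite" and s :: real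
  assumes s: "0 \<le> s" "s < 1"
  defines "p \<equiv> real CARD('n) / 2"
  shows "1 + 4 powr (- p - 1) * s\<^sup>2 \<le>
    (\<integral>v. (1 + s\<^sup>2 + 2 * s * v $ k) powr (- p) \<partial>(uniform_sphere :: (real ^ 'n) measure))"
proof -
  let ?\<mu> = "uniform_sphere :: (real ^ 'n) measure"
  interpret prob_space ?\<mu> by (rule prob_space_uniform_sphere)
  have fin: "finite_measure ?\<mu>" by unfold_locales
  have p: "p > 0" unfolding p_def by simp
  have le1: "\<bar>v $ i\<bar> \<le> 1" if "norm v = 1" for v :: "real ^ 'n" and i
    using component_le_norm_cart[of v i] that by simp
  define u where "u s x = 1 + s\<^sup>2 + 2 * s * x" for s x :: real
  have [measurable]: "(\<lambda>v. u s (v $ k)) \<in> borel_measurable borel" for s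
    unfolding u_def by measurable
  have u_pos: "0 < u s x" if "\<bar>x\<bar> \<le> 1" "\<bar>s\<bar> < 1" for s x
    unfolding u_def by (rule kernel_base_pos[OF that])
  have u_le: "u s x powr (- q) \<le> ((1 - r)\<^sup>2) powr (- q)" if "\<bar>x\<bar> \<le> 1" "\<bar>s\<bar> \<le> r" "r < 1" "q \<ge> 0" for s x r q
    unfolding u_def by (rule kernel_powr_le[OF that])
  have lin: "\<bar>2 * s + 2 * x\<bar> \<le> 4" if "\<bar>x\<bar> \<le> 1" "\<bar>s\<bar> \<le> 1" for s x :: real
    using that by linarith
  have lin2: "(2 * s + 2 * x)\<^sup>2 \<le> 16" if "\<bar>x\<bar> \<le> 1" "\<bar>s\<bar> \<le> 1" for s x :: real
    using power_mono[OF lin[OF that], of 2] by simp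
  \<comment> \<open>\<open>f0\<close>, \<open>f1\<close>, \<open>f2\<close> are the kernel and its
    first two derivatives in \<open>s\<close>.\<close>
  define f0 where "f0 s x = u s x powr (- p)" for s x
  define f1 where "f1 s x = - p * (2 * s + 2 * x) * u s x powr (- (p + 1))" for s x
  define f2 where "f2 s x = - 2 * p * u s x powr (- (p + 1)) + p * (p + 1) * (2 * s + 2 * x)\<^sup>2 * u s x powr (- (p + 2))" for s x
  define m0 m1 m2 where "m0 s = (\<integral>v. f0 s (v $ k) \<partial>?\<mu>)" and "m1 s = (\<integral>v. f1 s (v $ k) \<partial>?\<mu>)"
    and "m2 s = (\<integral>v. f2 s (v $ k) \<partial>?\<mu>)" for s
  have meas [measurable]: "(\<lambda>v. f0 s (v $ k)) \<in> borel_measurable borel" "(\<lambda>v. f1 s (v $ k)) \<in> borel_measurable borel"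
    "(\<lambda>v. f2 s (v $ k)) \<in> borel_measurable borel" for s
    unfolding f0_def f1_def f2_def by measurable
  define B where "B r q = ((1 - r)\<^sup>2) powr (- q)" for r q :: real
  have b0: "\<bar>f0 s x\<bar> \<le> B r p" if "\<bar>x\<bar> \<le> 1" "\<bar>s\<bar> \<le> r" "r < 1" for s x r
    unfolding f0_def B_def using u_le[OF that] p by simp
  have b1: "\<bar>f1 s x\<bar> \<le> p * 4 * B r (p + 1)" if "\<bar>x\<bar> \<le> 1" "\<bar>s\<bar> \<le> r" "r < 1" for s x r
  proof -
    have "\<bar>f1 s x\<bar> = p * \<bar>2 * s + 2 * x\<bar> * u s x powr (- (p + 1))"
      using p by (simp add: f1_def abs_mult)
    also have "\<dots> \<le> p * 4 * B r (p + 1)" unfolding B_def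
      by (intro mult_mono u_le that lin) (use p that in auto)
    finally show ?thesis .
  qed
  have b2: "\<bar>f2 s x\<bar> \<le> 2 * p * B r (p + 1) + p * (p + 1) * 16 * B r (p + 2)" if "\<bar>x\<bar> \<le> 1" "\<bar>s\<bar> \<le> r" "r < 1" for s x r
  proof -
    have "\<bar>f2 s x\<bar> \<le> \<bar>- 2 * p * u s x powr (- (p + 1))\<bar> + \<bar>p * (p + 1) * (2 * s + 2 * x)\<^sup>2 * u s x powr (- (p + 2))\<bar>"
      unfolding f2_def by (rule abs_triangle_ineq)
    also have "\<dots> = 2 * p * u s x powr (- (p + 1)) + p * (p + 1) * (2 * s + 2 * x)\<^sup>2 * u s x powr (- (p + 2))"
      using p by (simp add: abs_mult)
    also have "\<dots> \<le> 2 * p * B r (p + 1) + p * (p + 1) * 16 * B r (p + 2)" unfolding B_def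
      by (intro add_mono mult_mono u_le that lin2) (use p that in auto)
    finally show ?thesis .
  qed
  have i0: "integrable ?\<mu> (\<lambda>v. f0 s (v $ k))" and i1: "integrable ?\<mu> (\<lambda>v. f1 s (v $ k))"
    and i2: "integrable ?\<mu> (\<lambda>v. f2 s (v $ k))" if "\<bar>s\<bar> < 1" for s
  proof -
    show "integrable ?\<mu> (\<lambda>v. f0 s (v $ k))"
      by (rule integrable_uniform_sphere[OF meas(1)]) (rule b0[OF le1 order.refl that])
    show "integrable ?\<mu> (\<lambda>v. f1 s (v $ k))"
      by (rule integrable_uniform_sphere[OF meas(2)]) (rule b1[OF le1 order.refl that])
    show "integrable ?\<mu> (\<lambda>v. f2 s (v $ k))"
      by (rule integrable_uniform_sphere[OF meas(3)]) (rule b2[OF le1 order.refl that])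
  qed
  have d0: "((\<lambda>s. f0 s x) has_real_derivative f1 s x) (at s)" if "\<bar>x\<bar> \<le> 1" "\<bar>s\<bar> < 1" for s x
  proof -
    have eq: "u s x powr (- p - 1) = u s x powr (- (p + 1))" by (rule arg_cong[where f="\<lambda>q. u s x powr q"]) simp
    have "((\<lambda>s. u s x powr (- p)) has_real_derivative (- p) * u s x powr (- (p + 1)) * (2 * s + 2 * x)) (at s)"
      unfolding eq[symmetric] using u_pos[OF that] unfolding u_def
      by (auto intro!: derivative_eq_intros)
    then show ?thesis unfolding f0_def f1_def by (simp add: mult_ac)
  qed
  have d1: "((\<lambda>s. f1 s x) has_real_derivative f2 s x) (at s)" if "\<bar>x\<bar> \<le> 1" "\<bar>s\<bar> < 1" for s x
  proof -
    have eq: "u s x powr (- (p + 1) - 1) = u s x powr (- (p + 2))" by (rule arg_cong[where f="\<lambda>q. u s x powr q"]) simp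
    have D2: "((\<lambda>s. - p * (2 * s + 2 * x)) has_real_derivative - p * 2) (at s)"
      by (auto intro!: derivative_eq_intros)
    have D1: "((\<lambda>s. u s x powr (- (p + 1))) has_real_derivative (- (p + 1)) * u s x powr (- (p + 2)) * (2 * s + 2 * x)) (at s)"
      unfolding eq[symmetric] using u_pos[OF that] unfolding u_def
      by (auto intro!: derivative_eq_intros)
    have alg: "- p * 2 * W + - (p + 1) * Z * L * (- p * L) = - 2 * p * W + p * (p + 1) * L\<^sup>2 * Z" for W Z L
      unfolding power2_eq_square by algebra
    show ?thesis unfolding f1_def f2_def
      by (rule DERIV_cong[OF DERIV_mult[OF D2 D1] alg])
  qed
  have dm0: "(m0 has_real_derivative m1 s) (at s)" and dm1: "(m1 has_real_derivative m2 s) (at s)" if s: "\<bar>s\<bar> < 1" for s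
  proof -
    \<comment> \<open>Up to the midpoint between \<open>|s|\<close> and 1 the kernels stay away from
      the pole, which gives the uniform bounds for differentiating under the integral.\<close>
    define r where "r = (1 + \<bar>s\<bar>) / 2"
    have r: "s \<in> {-r<..<r}" "r < 1" using s unfolding r_def by (auto simp: abs_if field_simps split: if_splits)
    show "(m0 has_real_derivative m1 s) (at s)" unfolding m0_def m1_def
    proof (rule has_real_derivative_integral[OF fin _ _ r(1), where B="p * 4 * B r (p + 1)"])
      show "AE v in ?\<mu>. \<forall>s\<in>{- r<..<r}. ((\<lambda>s. f0 s (v $ k)) has_real_derivative f1 s (v $ k)) (at s) \<and> \<bar>f1 s (v $ k)\<bar> \<le> p * 4 * B r (p + 1)"
        using uniform_sphere_norm by eventually_elim (use r in \<open>auto intro!: d0 b1 le1\<close>)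
    qed (use r in \<open>auto intro!: i0\<close>)
    show "(m1 has_real_derivative m2 s) (at s)" unfolding m1_def m2_def
    proof (rule has_real_derivative_integral[OF fin _ _ r(1), where B="2 * p * B r (p + 1) + p * (p + 1) * 16 * B r (p + 2)"])
      show "AE v in ?\<mu>. \<forall>s\<in>{- r<..<r}. ((\<lambda>s. f1 s (v $ k)) has_real_derivative f2 s (v $ k)) (at s) \<and> \<bar>f2 s (v $ k)\<bar> \<le> 2 * p * B r (p + 1) + p * (p + 1) * 16 * B r (p + 2)"
        using uniform_sphere_norm by eventually_elim (use r in \<open>auto intro!: d1 b2 le1\<close>)
    qed (use r in \<open>auto intro!: i1\<close>)
  qed
  \<comment> \<open>On the sphere \<open>u \<le> 4\<close>, hence
    \<open>w \<ge> 4 powr (- p - 1)\<close>; the factor 2 matches the right-hand side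
    \<open>2 d s E[w]\<close> of the Darboux equation.\<close>
  define c where "c = 2 * 4 powr (- p - 1)"
  define w where "w s x = u s x powr (- (p + 1))" for s x
  define w' where "w' s x = - (p + 1) * (2 * s) * u s x powr (- (p + 2))" for s x
  have bw: "\<bar>w s x\<bar> \<le> B r (p + 1)" if "\<bar>x\<bar> \<le> 1" "\<bar>s\<bar> \<le> r" "r < 1" for s x r
    unfolding w_def B_def using u_le[OF that, of "p + 1"] p by simp
  have bw': "\<bar>w' s x\<bar> \<le> (p + 1) * 2 * B r (p + 2)" if "\<bar>x\<bar> \<le> 1" "\<bar>s\<bar> \<le> r" "r < 1" for s x r
  proof -
    have "\<bar>w' s x\<bar> = (p + 1) * (2 * \<bar>s\<bar>) * u s x powr (- (p + 2))"
      using p by (simp add: w'_def abs_mult)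
    also have "\<dots> \<le> (p + 1) * 2 * B r (p + 2)" unfolding B_def
      by (intro mult_mono u_le that) (use p that in auto)
    finally show ?thesis .
  qed
  have darboux: "s * m2 s + (real CARD('n) - 1) * m1 s \<ge> real CARD('n) * c * s" if s: "0 \<le> s" "s < 1" for s
  proof -
    have s': "\<bar>s\<bar> < 1" using s by simp
    have [measurable]: "w s \<in> borel_measurable borel" "w' s \<in> borel_measurable borel"
      unfolding w_def w'_def u_def by measurable
    have stein: "(real CARD('n) - 1) * (\<integral>v. v $ k * w s (v $ k) \<partial>?\<mu>) = (\<integral>v. (1 - (v $ k)\<^sup>2) * w' s (v $ k) \<partial>?\<mu>)"
    proof (rule uniform_sphere_stein[where B="max (B s (p + 1)) ((p + 1) * 2 * B s (p + 2))"])
      fix x :: real assume x: "\<bar>x\<bar> \<le> 1"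
      have eq: "u s x powr (- (p + 1) - 1) = u s x powr (- (p + 2))" by (rule arg_cong[where f="\<lambda>q. u s x powr q"]) simp
      show "(w s has_real_derivative w' s x) (at x)"
        unfolding w_def w'_def eq[symmetric] using u_pos[OF x s'] unfolding u_def
        by (auto intro!: derivative_eq_intros)
      show "\<bar>w s x\<bar> \<le> max (B s (p + 1)) ((p + 1) * 2 * B s (p + 2))"
        using bw[OF x, of s s] s by simp
      show "\<bar>w' s x\<bar> \<le> max (B s (p + 1)) ((p + 1) * 2 * B s (p + 2))"
        using bw'[OF x, of s s] s by simp
    qed measurable
    have iw: "integrable ?\<mu> (\<lambda>v. w s (v $ k))"
      by (rule integrable_uniform_sphere[where B="B s (p + 1)"]) (use s in \<open>auto intro!: bw le1\<close>)
    have mB: "\<bar>a * b\<bar> \<le> B'" if "\<bar>a\<bar> \<le> 1" "\<bar>b\<bar> \<le> B'" for a b B' :: real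
      using mult_mono[OF that] by (simp add: abs_mult)
    have ixw: "integrable ?\<mu> (\<lambda>v. v $ k * w s (v $ k))"
      by (rule integrable_uniform_sphere[where B="B s (p + 1)"]) (use s in \<open>auto intro!: mB bw le1\<close>)
    have iw': "integrable ?\<mu> (\<lambda>v. (1 - (v $ k)\<^sup>2) * w' s (v $ k))"
    proof (rule integrable_uniform_sphere[where B="(p + 1) * 2 * B s (p + 2)"])
      fix v :: "real ^ 'n" assume v: "norm v = 1"
      have "(v $ k)\<^sup>2 \<le> 1" using le1[OF v] by (simp add: abs_square_le_1)
      then show "\<bar>(1 - (v $ k)\<^sup>2) * w' s (v $ k)\<bar> \<le> (p + 1) * 2 * B s (p + 2)"
        using s v by (intro mB bw' le1) auto
    qed measurable
    have "m1 s = (\<integral>v. (- 2 * p * s) * w s (v $ k) + (- 2 * p) * (v $ k * w s (v $ k)) \<partial>?\<mu>)"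
      unfolding m1_def by (intro Bochner_Integration.integral_cong) (auto simp: f1_def w_def algebra_simps)
    also have "\<dots> = (- 2 * p * s) * (\<integral>v. w s (v $ k) \<partial>?\<mu>) + (- 2 * p) * (\<integral>v. v $ k * w s (v $ k) \<partial>?\<mu>)"
      using iw ixw by simp
    finally have m1_eq: "m1 s = (- 2 * p * s) * (\<integral>v. w s (v $ k) \<partial>?\<mu>) + (- 2 * p) * (\<integral>v. v $ k * w s (v $ k) \<partial>?\<mu>)" .
    have "(real CARD('n) - 1) * m1 s =
        (real CARD('n) - 1) * (- 2 * p * s) * (\<integral>v. w s (v $ k) \<partial>?\<mu>) +
        (- 2 * p) * (\<integral>v. (1 - (v $ k)\<^sup>2) * w' s (v $ k) \<partial>?\<mu>)"
      unfolding m1_eq stein[symmetric] by algebra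
    then have "s * m2 s + (real CARD('n) - 1) * m1 s = (\<integral>v. s * f2 s (v $ k) + ((real CARD('n) - 1) * (- 2 * p * s) * w s (v $ k)
        + (- 2 * p) * ((1 - (v $ k)\<^sup>2) * w' s (v $ k))) \<partial>?\<mu>)"
      unfolding m2_def using i2[OF s'] iw iw' by simp
    also have "\<dots> = (\<integral>v. 2 * real CARD('n) * s * w s (v $ k) \<partial>?\<mu>)"
    proof (rule integral_cong_AE)
      show "AE v in ?\<mu>. s * f2 s (v $ k) + ((real CARD('n) - 1) * (- 2 * p * s) * w s (v $ k)
          + (- 2 * p) * ((1 - (v $ k)\<^sup>2) * w' s (v $ k))) = 2 * real CARD('n) * s * w s (v $ k)"
        using uniform_sphere_norm
      proof eventually_elim
        case (elim v)
        define x where "x = v $ k"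
        \<comment> \<open>Both kernels become polynomial multiples of \<open>t\<close>, which leaves
          a polynomial identity.\<close>
        define t where "t = u s x powr (- (p + 2))"
        have up: "0 < u s x" using u_pos[OF le1[OF elim] s'] by (simp add: x_def)
        have wt: "u s x powr (- (p + 1)) = u s x * t"
        proof -
          have "u s x * t = u s x powr 1 * u s x powr (- (p + 2))" using up by (simp add: t_def)
          also have "\<dots> = u s x powr (- (p + 1))" unfolding powr_add[symmetric] by (rule arg_cong[where f="\<lambda>q. u s x powr q"]) simp
          finally show ?thesis ..
        qed
        have d: "real CARD('n) = 2 * p" by (simp add: p_def)
        show ?case unfolding x_def[symmetric] f2_def w_def w'_def wt t_def[symmetric] d
          unfolding u_def power2_eq_square by algebra
      qed
    qed measurable
    also have "\<dots> \<ge> (\<integral>v. real CARD('n) * c * s \<partial>?\<mu>)"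
    proof (rule integral_mono_AE)
      show "AE v in ?\<mu>. real CARD('n) * c * s \<le> 2 * real CARD('n) * s * w s (v $ k)"
        using uniform_sphere_norm
      proof eventually_elim
        case (elim v)
        have "4 powr (- (p + 1)) \<le> w s (v $ k)"
          unfolding w_def
        proof (rule powr_mono2')
          show "u s (v $ k) \<le> 4" unfolding u_def by (rule kernel_base_upper) (use le1[OF elim] s' in auto)
        qed (use u_pos[OF le1[OF elim] s'] p in auto)
        then have "(2 * real CARD('n) * s) * 4 powr (- p - 1) \<le> (2 * real CARD('n) * s) * w s (v $ k)"
          using s by (intro mult_left_mono) auto
        then show ?case by (simp add: c_def mult_ac)
      qed
    qed (use iw in auto)
    finally show ?thesis using prob_space by simp
  qed
  have m1_0: "m1 0 = 0"
    using uniform_sphere_coordinate_mean[of k] by (simp add: m1_def f1_def u_def)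
  have m1_ge: "m1 s \<ge> c * s" if s: "0 \<le> s" "s < 1" for s
  proof (cases "s = 0")
    case False
    with s have s0: "s > 0" by simp
    let ?d = "CARD('n)"
    \<comment> \<open>\<open>s ^ (d - 1)\<close> is the integrating factor for
      \<open>s * m2 + (d - 1) * m1\<close>, so \<open>darboux\<close> makes \<open>F\<close>
      nondecreasing.\<close>
    define F where "F s = s ^ (?d - 1) * m1 s - c * s ^ ?d" for s
    have dpos: "?d > 0" by simp
    have "F 0 \<le> F s"
    proof (rule DERIV_nonneg_imp_increasing_open[where f=F])
      fix x assume x: "0 < x" "x < s"
      define F' where "F' = real (?d - 1) * x ^ (?d - 1 - 1) * m1 x + x ^ (?d - 1) * m2 x - c * (real ?d * x ^ (?d - 1))"
      have "(F has_real_derivative F') (at x)"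
        unfolding F_def F'_def using x s by (auto intro!: derivative_eq_intros dm1)
      \<comment> \<open>The factor \<open>x\<close> avoids the exponent \<open>d - 2\<close>, which
        truncated subtraction distorts for \<open>d = 1\<close>.\<close>
      moreover have "x * F' = x ^ (?d - 1) * (x * m2 x + (real ?d - 1) * m1 x - real ?d * c * x)"
      proof -
        have "real (?d - 1) * x ^ (?d - 1 - 1) * x = (real ?d - 1) * x ^ (?d - 1)"
        proof (cases "?d - 1")
          case 0
          with dpos have "?d = 1" by linarith
          with 0 show ?thesis by simp
        next
          case (Suc m)
          then have "real ?d - 1 = real (Suc m)" by linarith
          with Suc show ?thesis by simp
        qed
        moreover have "x * F' = (real (?d - 1) * x ^ (?d - 1 - 1) * x) * m1 x + x ^ (?d - 1) * x * m2 x - c * (real ?d * x ^ (?d - 1)) * x"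
          unfolding F'_def by (simp add: algebra_simps)
        ultimately have "x * F' = ((real ?d - 1) * x ^ (?d - 1)) * m1 x + x ^ (?d - 1) * x * m2 x - c * (real ?d * x ^ (?d - 1)) * x"
          by (simp only:)
        then show ?thesis by (simp add: algebra_simps)
      qed
      moreover have "\<dots> \<ge> 0" using darboux[of x] x s by simp
      ultimately show "\<exists>y. (F has_real_derivative y) (at x) \<and> 0 \<le> y"
        using x by (metis zero_le_mult_iff less_le_not_le)
    next
      show "continuous_on {0..s} F"
        unfolding F_def using s
        by (intro continuous_intros DERIV_continuous_on[where D=m2] has_field_derivative_at_within[OF dm1]) auto
    qed (use s in auto)
    moreover have "F 0 = 0" by (simp add: F_def m1_0)
    moreover have "F s = s ^ (?d - 1) * (m1 s - c * s)"
      using dpos power_Suc[of s "?d - 1"] by (simp add: F_def algebra_simps)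
    moreover have "0 < s ^ (?d - 1)" using s0 by simp
    ultimately have "0 \<le> m1 s - c * s" by (simp only: zero_le_mult_iff) linarith
    then show ?thesis by simp
  qed (use m1_0 in simp)
  \<comment> \<open>Integrating \<open>m1 \<ge> c * s\<close> from 0, where the mean is 1, gives the
    claim, as \<open>c / 2 = 4 powr (- p - 1)\<close>.\<close>
  have "m0 0 - c / 2 * 0\<^sup>2 \<le> m0 s - c / 2 * s\<^sup>2"
  proof (rule DERIV_nonneg_imp_nondecreasing[where f="\<lambda>s. m0 s - c / 2 * s\<^sup>2"])
    fix x assume "0 \<le> x" "x \<le> s"
    then show "\<exists>y. ((\<lambda>s. m0 s - c / 2 * s\<^sup>2) has_real_derivative y) (at x) \<and> 0 \<le> y"
      using m1_ge[of x] s by (intro exI[of _ "m1 x - c * x"]) (auto intro!: derivative_eq_intros dm0)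
  qed (use s in auto)
  moreover have "m0 0 = 1" by (simp add: m0_def f0_def u_def prob_space[simplified])
  ultimately show ?thesis by (simp add: m0_def f0_def u_def c_def)
qed

text \<open>An orthogonal map that carries \<open>axis k 1\<close> to \<open>e\<close> reduces this
  to the coordinate case.\<close>

lemma uniform_sphere_kernel_mean:
  fixes e :: "real ^ 'n" and s :: real
  assumes e: "norm e = 1" and s: "0 \<le> s" "s < 1"
  defines "p \<equiv> real CARD('n) / 2"
  shows "1 + 4 powr (- p - 1) * s\<^sup>2 \<le> (\<integral>v. (1 + s\<^sup>2 + 2 * s * (e \<bullet> v)) powr (- p) \<partial>uniform_sphere)"
proof -
  fix k :: 'n
  have "norm (axis k 1 :: real ^ 'n) = norm e" using e by simp
  from orthogonal_transformation_exists[OF this]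
  obtain f :: "real ^ 'n \<Rightarrow> real ^ 'n" where f: "orthogonal_transformation f" "f (axis k 1) = e" .
  have "e \<bullet> f v = v $ k" for v
  proof -
    have "e \<bullet> f v = axis k 1 \<bullet> v"
      using f by (auto simp: orthogonal_transformation_def)
    then show ?thesis by (simp add: inner_axis')
  qed
  then have "(\<integral>v. (1 + s\<^sup>2 + 2 * s * (v $ k)) powr (- p) \<partial>uniform_sphere) =
      (\<integral>v. (1 + s\<^sup>2 + 2 * s * (e \<bullet> v)) powr (- p) \<partial>uniform_sphere)"
    using integral_uniform_sphere_orthogonal[OF f(1), of "\<lambda>v. (1 + s\<^sup>2 + 2 * s * (e \<bullet> v)) powr (- p)"] by simp
  with uniform_sphere_kernel_mean_coordinate[OF s, of k] show ?thesis by (simp add: p_def)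
qed

section \<open>A minorant of the kernel without pole\<close>

text \<open>At \<open>\<sigma> = 1\<close> the left side is \<open>2 * s0 * (1 + \<xi>)\<close>,
  which falls short of the right side by the square \<open>(1 - s0)^2\<close>. Raised to the power
  \<open>- p\<close>, the bound says that \<open>s0 powr p\<close> times the kernel of radius
  \<open>s0\<close> lies below the kernel of every larger radius up to 1.\<close>

lemma kernel_base_truncate:
  fixes s0 \<sigma> \<xi> :: real
  assumes "0 < s0" "s0 \<le> \<sigma>" "\<sigma> \<le> 1" "\<bar>\<xi>\<bar> \<le> 1"
  shows "s0 * (1 + \<sigma>\<^sup>2 + 2 * \<sigma> * \<xi>) \<le> 1 + s0\<^sup>2 + 2 * s0 * \<xi>"
proof -
  define w where "w = 1 + s0\<^sup>2 + 2 * s0 * \<xi>"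
  have "(\<sigma> - s0) * (\<sigma> + s0 + 2 * \<xi>) \<le> (\<sigma> - s0) * (2 * (1 + \<xi>))"
    using assms by (intro mult_left_mono) auto
  also have "\<dots> \<le> (1 - s0) * (2 * (1 + \<xi>))"
    using assms by (intro mult_right_mono) auto
  finally have "s0 * ((\<sigma> - s0) * (\<sigma> + s0 + 2 * \<xi>)) \<le> s0 * ((1 - s0) * (2 * (1 + \<xi>)))"
    using assms by (intro mult_left_mono) auto
  also have "\<dots> = (1 - s0) * (2 * s0 * (1 + \<xi>))" by simp
  also have "\<dots> \<le> (1 - s0) * w"
  proof (rule mult_left_mono)
    have "0 \<le> (1 - s0)\<^sup>2" by simp
    then show "2 * s0 * (1 + \<xi>) \<le> w" unfolding w_def by (simp add: power2_eq_square algebra_simps)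
  qed (use assms in simp)
  finally have "s0 * w + s0 * ((\<sigma> - s0) * (\<sigma> + s0 + 2 * \<xi>)) \<le> w"
    by (simp add: left_diff_distrib)
  moreover have "s0 * (1 + \<sigma>\<^sup>2 + 2 * \<sigma> * \<xi>) = s0 * w + s0 * ((\<sigma> - s0) * (\<sigma> + s0 + 2 * \<xi>))"
    unfolding w_def power2_eq_square by algebra
  ultimately show ?thesis unfolding w_def by simp
qed

text \<open>At \<open>\<sigma> = 1\<close> the kernel \<open>|e + \<sigma> v|\<^sup>-\<^sup>d\<close> has a pole on the sphere; near that radius a multiple of the
  kernel for a fixed smaller radius \<open>s0\<close> serves as bounded minorant.\<close>

lemma sphere_kernel_minorant:
  defines "p \<equiv> real CARD('n::finite) / 2"
  obtains g :: "real \<Rightarrow> real \<Rightarrow> real" and c C :: real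
  where "c > 0" "C > 0" "(\<lambda>(\<sigma>, \<xi>). g \<sigma> \<xi>) \<in> borel_measurable (borel \<Otimes>\<^sub>M borel)"
    and "\<And>\<sigma> \<xi>. 0 \<le> \<sigma> \<Longrightarrow> \<sigma> \<le> 1 \<Longrightarrow> \<bar>\<xi>\<bar> \<le> 1 \<Longrightarrow> 0 < 1 + \<sigma>\<^sup>2 + 2 * \<sigma> * \<xi> \<Longrightarrow> g \<sigma> \<xi> \<le> (1 + \<sigma>\<^sup>2 + 2 * \<sigma> * \<xi>) powr (- p)"
    and "\<And>\<sigma> \<xi>. 0 \<le> \<sigma> \<Longrightarrow> \<sigma> \<le> 1 \<Longrightarrow> \<bar>\<xi>\<bar> \<le> 1 \<Longrightarrow> \<bar>g \<sigma> \<xi> - 1\<bar> \<le> C * \<sigma>"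
    and "\<And>\<sigma> (e :: real ^ 'n). 0 \<le> \<sigma> \<Longrightarrow> \<sigma> \<le> 1 \<Longrightarrow> norm e = 1 \<Longrightarrow> 1 + c * \<sigma>\<^sup>2 \<le> (\<integral>v. g \<sigma> (e \<bullet> v) \<partial>uniform_sphere)"
proof -
  have p: "p > 0" by (simp add: p_def)
  define c where "c = 4 powr (- p - 1)"
  have c: "c > 0" by (simp add: c_def)
  \<comment> \<open>As \<open>s\<close> tends to 1 the product tends to \<open>1 + c\<close>, so for
    some \<open>s0 < 1\<close> the factor \<open>s0 powr p\<close> costs at most half of the gain
    \<open>c\<close>.\<close>
  have "((\<lambda>s. s powr p * (1 + c * s\<^sup>2)) \<longlongrightarrow> 1 powr p * (1 + c * 1\<^sup>2)) (at_left 1)"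
    by (intro tendsto_intros) auto
  then have "\<forall>\<^sub>F s in at_left 1. 1 + c / 2 < s powr p * (1 + c * s\<^sup>2)"
    by (rule order_tendstoD(1)) (use c in simp)
  moreover have "\<forall>\<^sub>F s in at_left 1. s \<in> {0<..<1::real}"
    by (rule eventually_at_left_real) simp
  ultimately have "\<forall>\<^sub>F s in at_left 1. 0 < s \<and> s < 1 \<and> 1 + c / 2 < s powr p * (1 + c * s\<^sup>2)"
    by eventually_elim simp
  then obtain s0 where s0: "0 < s0" "s0 < 1" "1 + c / 2 < s0 powr p * (1 + c * s0\<^sup>2)"
    using eventually_happens'[OF trivial_limit_at_left_real] by blast
  define f where "f \<sigma> \<xi> = (1 + \<sigma>\<^sup>2 + 2 * \<sigma> * \<xi>) powr (- p)" for \<sigma> \<xi> :: real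
  define g where "g \<sigma> \<xi> = (if \<sigma> \<le> s0 then f \<sigma> \<xi> else s0 powr p * f s0 \<xi>)" for \<sigma> \<xi> :: real
  define B where "B = ((1 - s0)\<^sup>2) powr (- p)"
  define B1 where "B1 = ((1 - s0)\<^sup>2) powr (- p - 1)"
  have f_le: "f \<sigma> \<xi> \<le> B" if "0 \<le> \<sigma>" "\<sigma> \<le> s0" "\<bar>\<xi>\<bar> \<le> 1" for \<sigma> \<xi>
    unfolding f_def B_def by (rule kernel_powr_le) (use that s0 p in auto)
  have f_nn: "0 \<le> f \<sigma> \<xi>" for \<sigma> \<xi> by (simp add: f_def)
  have BB: "0 \<le> B" "0 \<le> B1" by (simp_all add: B_def B1_def)
  have [measurable]: "(\<lambda>v. f \<sigma> (e \<bullet> v)) \<in> borel_measurable borel" for \<sigma> and e :: "real ^ 'n"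
    unfolding f_def by measurable
  \<comment> \<open>First entry, for \<open>\<sigma> \<le> s0\<close>: a Lipschitz bound for the
    power together with \<open>|w - 1| \<le> 3 * \<sigma>\<close>. Second entry: a plain bound,
    turned into a multiple of \<open>\<sigma>\<close> by \<open>\<sigma> > s0\<close>.\<close>
  define C where "C = max (3 * p * B1) (max 1 B / s0)"
  show thesis
  proof (rule that[of "c / 2" C g])
    show "(\<lambda>(\<sigma>, \<xi>). g \<sigma> \<xi>) \<in> borel_measurable (borel \<Otimes>\<^sub>M borel)"
      unfolding g_def f_def case_prod_beta by measurable
    show "c / 2 > 0" using c by simp
    have "0 < max 1 B / s0" using s0 by simp
    then show "C > 0" unfolding C_def by linarith
  next
    fix \<sigma> \<xi> :: real
    assume *: "0 \<le> \<sigma>" "\<sigma> \<le> 1" "\<bar>\<xi>\<bar> \<le> 1" "0 < 1 + \<sigma>\<^sup>2 + 2 * \<sigma> * \<xi>"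
    show "g \<sigma> \<xi> \<le> (1 + \<sigma>\<^sup>2 + 2 * \<sigma> * \<xi>) powr (- p)"
    proof (cases "\<sigma> \<le> s0")
      case False
      have "(1 + s0\<^sup>2 + 2 * s0 * \<xi>) powr (- p) \<le> (s0 * (1 + \<sigma>\<^sup>2 + 2 * \<sigma> * \<xi>)) powr (- p)"
        by (rule powr_mono2') (use kernel_base_truncate[of s0 \<sigma> \<xi>] * False s0 p in auto)
      also have "\<dots> = s0 powr (- p) * (1 + \<sigma>\<^sup>2 + 2 * \<sigma> * \<xi>) powr (- p)"
        using * s0 by (simp add: powr_mult)
      finally have "s0 powr p * f s0 \<xi> \<le> s0 powr p * (s0 powr (- p) * (1 + \<sigma>\<^sup>2 + 2 * \<sigma> * \<xi>) powr (- p))"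
        unfolding f_def by (intro mult_left_mono) auto
      also have "\<dots> = (1 + \<sigma>\<^sup>2 + 2 * \<sigma> * \<xi>) powr (- p)"
        unfolding mult.assoc[symmetric] powr_add[symmetric] using s0 by simp
      finally show ?thesis using False by (simp add: g_def)
    qed (simp add: g_def f_def)
  next
    fix \<sigma> \<xi> :: real
    assume *: "0 \<le> \<sigma>" "\<sigma> \<le> 1" "\<bar>\<xi>\<bar> \<le> 1"
    show "\<bar>g \<sigma> \<xi> - 1\<bar> \<le> C * \<sigma>"
    proof (cases "\<sigma> \<le> s0")
      case True
      define w where "w = 1 + \<sigma>\<^sup>2 + 2 * \<sigma> * \<xi>"
      define l where "l = (1 - s0)\<^sup>2"
      have l: "0 < l" "l \<le> 1" using s0 by (auto simp: l_def power_le_one)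
      have "(1 - s0)\<^sup>2 \<le> (1 - \<bar>\<sigma>\<bar>)\<^sup>2" using True s0 * by (intro power_mono) auto
      then have "l \<le> w" using kernel_base_lower[OF *(3), of \<sigma>] by (simp add: l_def w_def)
      have "norm (w powr (- p) - 1 powr (- p)) \<le> (p * B1) * norm (w - 1)"
      proof (rule field_differentiable_bound[where S="{l..}" and f="\<lambda>x. x powr (- p)" and f'="\<lambda>x. - p * x powr (- p - 1)"])
        fix x assume x: "x \<in> {l..}"
        show "((\<lambda>x. x powr (- p)) has_field_derivative - p * x powr (- p - 1)) (at x within {l..})"
          using x l by (auto intro!: derivative_eq_intros)
        have "x powr (- p - 1) \<le> l powr (- p - 1)"
          using x l p by (intro powr_mono2') auto
        then show "norm (- p * x powr (- p - 1)) \<le> p * B1"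
          using p by (simp add: abs_mult B1_def l_def)
      qed (use \<open>l \<le> w\<close> l in auto)
      also have "\<dots> \<le> (p * B1) * (3 * \<sigma>)"
      proof (rule mult_left_mono)
        have "\<sigma>\<^sup>2 \<le> \<sigma>" using * by (simp add: power2_eq_square mult_left_le)
        moreover have "\<bar>\<sigma> * \<xi>\<bar> \<le> \<sigma>" using * by (simp add: abs_mult mult_left_le)
        moreover have "0 \<le> \<sigma>\<^sup>2" by simp
        moreover have "w - 1 = \<sigma>\<^sup>2 + 2 * (\<sigma> * \<xi>)" by (simp add: w_def)
        ultimately show "norm (w - 1) \<le> 3 * \<sigma>" unfolding real_norm_def by linarith
      qed (use p BB in simp)
      finally have "\<bar>g \<sigma> \<xi> - 1\<bar> \<le> (3 * p * B1) * \<sigma>"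
        using True by (simp add: g_def f_def w_def mult_ac)
      also have "\<dots> \<le> C * \<sigma>" using * by (intro mult_right_mono) (auto simp: C_def)
      finally show ?thesis .
    next
      case False
      have "s0 powr p \<le> 1" using s0 p by (simp add: powr_le1)
      then have "s0 powr p * f s0 \<xi> \<le> 1 * B"
        using * s0 by (intro mult_mono f_le) (auto simp: f_nn)
      moreover have "0 \<le> s0 powr p * f s0 \<xi>" by (simp add: f_nn)
      ultimately have "\<bar>g \<sigma> \<xi> - 1\<bar> \<le> max 1 B" using False by (auto simp: g_def abs_le_iff)
      also have "\<dots> \<le> max 1 B / s0 * \<sigma>"
        using False s0 by (simp add: divide_simps mult_left_mono)
      also have "\<dots> \<le> C * \<sigma>" using * by (intro mult_right_mono) (auto simp: C_def)
      finally show ?thesis .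
    qed
  next
    fix \<sigma> :: real and e :: "real ^ 'n"
    assume *: "0 \<le> \<sigma>" "\<sigma> \<le> 1" "norm e = 1"
    have mean: "1 + c * s\<^sup>2 \<le> (\<integral>v. f s (e \<bullet> v) \<partial>uniform_sphere)" if "0 \<le> s" "s < 1" for s
      using uniform_sphere_kernel_mean[OF *(3) that] by (simp add: f_def c_def p_def)
    show "1 + c / 2 * \<sigma>\<^sup>2 \<le> (\<integral>v. g \<sigma> (e \<bullet> v) \<partial>uniform_sphere)"
    proof (cases "\<sigma> \<le> s0")
      case True
      have "1 + c / 2 * \<sigma>\<^sup>2 \<le> 1 + c * \<sigma>\<^sup>2" using c by (simp add: mult_right_mono)
      also have "\<dots> \<le> (\<integral>v. f \<sigma> (e \<bullet> v) \<partial>uniform_sphere)" using True * s0 by (intro mean) auto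
      finally show ?thesis using True by (simp add: g_def)
    next
      case False
      have "c * \<sigma>\<^sup>2 \<le> c * 1" using * c by (intro mult_left_mono) (auto simp: power_le_one)
      then have "1 + c / 2 * \<sigma>\<^sup>2 \<le> 1 + c / 2" by simp
      also have "\<dots> \<le> s0 powr p * (1 + c * s0\<^sup>2)" using s0 by simp
      also have "\<dots> \<le> s0 powr p * (\<integral>v. f s0 (e \<bullet> v) \<partial>uniform_sphere)"
        using s0 by (intro mult_left_mono mean) auto
      finally show ?thesis using False by (simp add: g_def)
    qed
  qed
qed

section \<open>Volume of the complement and dyadic shells\<close>

text \<open>Cover \<open>S\<close> by nonoverlapping dyadic cubes of total volume at most that of
  \<open>S\<close> plus \<open>e\<close>. A cube of side \<open>l\<close> lies in a ball of radius
  \<open>2 * d * l\<close> about a corner, whose cost is \<open>(2 * d) ^ d\<close> times the volume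
  of the cube.\<close>

lemma hausdorff_content_le_emeasure:
  fixes S :: "(real ^ 'n) set"
  assumes S: "S \<in> sets borel" "bounded S"
  shows "hausdorff_content (real CARD('n)) S \<le> ennreal ((2 * real CARD('n)) ^ CARD('n)) * emeasure lborel S"
proof -
  let ?d = "CARD('n)"
  have d: "0 < ?d" by simp
  obtain m where m: "m > 0" "\<And>x. x \<in> S \<Longrightarrow> norm x \<le> m"
    using S(2) by (auto simp: bounded_pos)
  define a b :: "real ^ 'n" where "a = (\<chi> i. - m)" and "b = (\<chi> i. m)"
  have Sab: "S \<subseteq> cbox a b"
  proof
    fix x assume "x \<in> S"
    then have "\<bar>x $ i\<bar> \<le> m" for i using m(2) component_le_norm_cart[of x i] by fastforce
    then have "- m \<le> x $ i" "x $ i \<le> m" for i by (auto simp: abs_le_iff minus_le_iff)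
    then show "x \<in> cbox a b" by (simp add: a_def b_def mem_box_cart)
  qed
  have Slm: "S \<in> lmeasurable"
    using S by (intro bounded_set_imp_lmeasurable) auto
  define K where "K = (2 * real ?d) ^ ?d"
  have K: "K > 0" by (simp add: K_def)
  have main: "hausdorff_content (real ?d) S \<le> ennreal K * (emeasure lborel S + ennreal e) + ennreal e" if e: "e > 0" for e :: real
  proof -
    obtain \<D> where \<D>: "countable \<D>"
        "\<And>K. K \<in> \<D> \<Longrightarrow> K \<subseteq> cbox a b \<and> K \<noteq> {} \<and> (\<exists>c d. K = cbox c d)"
        "pairwise (\<lambda>A B. interior A \<inter> interior B = {}) \<D>"
        "\<And>u v. cbox u v \<in> \<D> \<Longrightarrow> \<exists>n. \<forall>i \<in> Basis. v \<bullet> i - u \<bullet> i = (b \<bullet> i - a \<bullet> i)/2^n"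
        "S \<subseteq> \<Union>\<D>" "\<Union>\<D> \<in> lmeasurable" "measure lebesgue (\<Union>\<D>) \<le> measure lebesgue S + e"
      using measurable_outer_intervals_bounded[OF Slm Sab e] by metis
    define B where "B i = (if i \<in> to_nat_on \<D> ` \<D> then from_nat_into \<D> i else {})" for i
    have B_in: "B i \<in> \<D>" if "i \<in> to_nat_on \<D> ` \<D>" for i
      using that \<D>(1) by (auto simp: B_def)
    have B_out: "B i = {}" if "i \<notin> to_nat_on \<D> ` \<D>" for i using that by (simp add: B_def)
    have UB: "\<Union>\<D> = (\<Union>i. B i)"
    proof
      show "\<Union>\<D> \<subseteq> (\<Union>i. B i)"
      proof (rule Union_least)
        fix X assume X: "X \<in> \<D>"
        then have "B (to_nat_on \<D> X) = X" using \<D>(1) by (simp add: B_def)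
        then show "X \<subseteq> (\<Union>i. B i)" by blast
      qed
      show "(\<Union>i. B i) \<subseteq> \<Union>\<D>" using B_in B_out by blast
    qed
    have disj: "disjoint_family (\<lambda>i. interior (B i))"
      unfolding disjoint_family_on_def
    proof (intro ballI impI)
      fix i j :: nat assume ij: "i \<noteq> j"
      show "interior (B i) \<inter> interior (B j) = {}"
      proof (cases "i \<in> to_nat_on \<D> ` \<D> \<and> j \<in> to_nat_on \<D> ` \<D>")
        case True
        then have "B i \<noteq> B j" using ij \<D>(1) by (auto simp: B_def)
        then show ?thesis using \<D>(3) True B_in by (auto simp: pairwise_def)
      next
        case False
        then show ?thesis using B_out by auto
      qed
    qed
    have ex: "\<exists>x r. r > 0 \<and> B i \<subseteq> ball x r \<and> r powr real ?d = K * measure lebesgue (interior (B i)) + e / 2 ^ Suc i" for i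
    proof -
      \<comment> \<open>The extra \<open>e / 2 ^ Suc i\<close> makes the radius positive even for an
        empty \<open>B i\<close>; all of them together cost \<open>e\<close>.\<close>
      define V where "V = K * measure lebesgue (interior (B i)) + e / 2 ^ Suc i"
      have "0 < e / 2 ^ Suc i" using e by simp
      then have V: "V > 0" "K * measure lebesgue (interior (B i)) < V" 
        using K by (auto simp: V_def intro!: add_nonneg_pos)
      define r where "r = V powr (1 / real ?d)"
      have r: "r > 0" "r powr real ?d = V" using V d by (auto simp: r_def powr_powr)
      show ?thesis
      proof (cases "i \<in> to_nat_on \<D> ` \<D>")
        case False
        then show ?thesis using r B_out[OF False] by (intro exI[of _ 0] exI[of _ r]) (auto simp: V_def)
      next
        case True
        then obtain u v where uv: "B i = cbox u v" "cbox u v \<noteq> {}" using \<D>(2) B_in by metis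
        then obtain n where n: "\<And>i. i \<in> Basis \<Longrightarrow> v \<bullet> i - u \<bullet> i = (b \<bullet> i - a \<bullet> i)/2^n"
          using \<D>(4) B_in[OF True] by metis
        define l where "l = 2 * m / 2 ^ n"
        have l: "l > 0" using m by (simp add: l_def)
        have side: "v $ j - u $ j = l" for j
          using n[of "axis j 1"] by (simp add: inner_axis a_def b_def l_def)
        have "measure lebesgue (interior (B i)) = (\<Prod>b\<in>Basis. (v - u) \<bullet> b)"
        proof -
          have le: "u \<bullet> b \<le> v \<bullet> b" if "b \<in> Basis" for b
          proof -
            from that obtain j where "b = axis j 1" by (auto simp: Basis_vec_def)
            with side[of j] l show ?thesis by (simp add: inner_axis)
          qed
          have "measure lebesgue (interior (B i)) = measure lborel (box u v)"
            by (simp add: uv interior_cbox)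
          then show ?thesis using le by (simp add: measure_lborel_box_eq)
        qed
        also have "\<dots> = (\<Prod>b\<in>(Basis :: (real ^ 'n) set). l)"
          using side by (intro prod.cong) (auto simp: Basis_vec_def inner_axis)
        finally have "measure lebesgue (interior (B i)) = l ^ ?d" by simp
        then have "(2 * real ?d * l) ^ ?d \<le> V" using V by (simp add: K_def power_mult_distrib)
        then have "((2 * real ?d * l) ^ ?d) powr (1 / real ?d) \<le> r"
          unfolding r_def using l by (intro powr_mono2) auto
        then have rl: "2 * real ?d * l \<le> r" using l d by (simp add: powr_realpow[symmetric] powr_powr)
        have "cbox u v \<subseteq> ball u r"
        proof
          fix z assume z: "z \<in> cbox u v"
          have "norm (z - u) \<le> (\<Sum>j\<in>UNIV. \<bar>(z - u) $ j\<bar>)" by (rule norm_le_l1_cart)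
          also have "\<dots> \<le> (\<Sum>j\<in>(UNIV :: 'n set). l)"
          proof (rule sum_mono)
            fix j
            have "u $ j \<le> z $ j" "z $ j \<le> v $ j" using z by (auto simp: mem_box_cart)
            then show "\<bar>(z - u) $ j\<bar> \<le> l" using side[of j] by simp
          qed
          also have "\<dots> = real ?d * l" by simp
          also have "\<dots> < 2 * real ?d * l" using l d by simp
          also have "\<dots> \<le> r" by (rule rl)
          finally show "z \<in> ball u r" by (simp add: dist_norm norm_minus_commute)
        qed
        then show ?thesis using r uv by (intro exI[of _ u] exI[of _ r]) (auto simp: V_def)
      qed
    qed
    then obtain x r where xr: "\<And>i. r i > 0" "\<And>i. B i \<subseteq> ball (x i) (r i)"
      "\<And>i. r i powr real ?d = K * measure lebesgue (interior (B i)) + e / 2 ^ Suc i" by metis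
    have "S \<subseteq> (\<Union>i. ball (x i) (r i))" using \<D>(5) UB xr(2) by blast
    then have "hausdorff_content (real ?d) S \<le> (\<Sum>i. ennreal (r i powr real ?d))"
      unfolding hausdorff_content_def using xr(1) by (intro Inf_lower) blast
    also have "\<dots> = (\<Sum>i. ennreal K * emeasure lebesgue (interior (B i)) + ennreal (e * (1 / 2) ^ Suc i))"
    proof (intro suminf_cong)
      fix i
      have "bounded (B i)"
      proof (cases "i \<in> to_nat_on \<D> ` \<D>")
        case True
        then show ?thesis using \<D>(2) B_in bounded_cbox by metis
      qed (simp add: B_out)
      then have "interior (B i) \<in> lmeasurable"
        by (intro lmeasurable_open) (auto intro: bounded_interior)
      then have "emeasure lebesgue (interior (B i)) = ennreal (measure lebesgue (interior (B i)))"
        by (rule emeasure_eq_measure2)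
      then show "ennreal (r i powr real ?d) = ennreal K * emeasure lebesgue (interior (B i)) + ennreal (e * (1 / 2) ^ Suc i)"
        using K e by (simp add: xr(3) ennreal_plus ennreal_mult power_divide del: power_Suc)
    qed
    also have "\<dots> = ennreal K * (\<Sum>i. emeasure lebesgue (interior (B i))) + (\<Sum>i. ennreal (e * (1 / 2) ^ Suc i))"
      by (subst suminf_add[symmetric]) auto
    also have "(\<Sum>i. ennreal (e * (1 / 2) ^ Suc i)) = ennreal e"
    proof (rule suminf_ennreal_eq)
      show "(\<lambda>i. e * (1 / 2) ^ Suc i) sums e"
        using sums_mult[OF power_half_series, of e] by simp
    qed (use e in auto)
    also have "(\<Sum>i. emeasure lebesgue (interior (B i))) = emeasure lebesgue (\<Union>i. interior (B i))"
      by (rule suminf_emeasure[OF _ disj]) auto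
    also have "\<dots> \<le> emeasure lebesgue (\<Union>\<D>)"
    proof (rule emeasure_mono)
      show "(\<Union>i. interior (B i)) \<subseteq> \<Union>\<D>" unfolding UB using interior_subset by blast
      show "\<Union>\<D> \<in> sets lebesgue" using \<D>(6) by (rule fmeasurableD)
    qed
    also have "\<dots> = ennreal (measure lebesgue (\<Union>\<D>))" using \<D>(6) by (rule emeasure_eq_measure2)
    also have "\<dots> \<le> ennreal (measure lebesgue S + e)" using \<D>(7) by (rule ennreal_leI)
    also have "\<dots> = emeasure lebesgue S + ennreal e"
      using e by (simp add: ennreal_plus emeasure_eq_measure2[OF Slm])
    also have "emeasure lebesgue S = emeasure lborel S" using S(1) by simp
    finally show ?thesis by (simp add: add_mono mult_left_mono)
  qed
  show ?thesis unfolding K_def[symmetric]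
  proof (rule ennreal_le_epsilon)
    fix e :: real assume e: "0 < e"
    define e' where "e' = e / (K + 1)"
    have e': "e' > 0" using e K by (simp add: e'_def)
    have "ennreal K * (emeasure lborel S + ennreal e') + ennreal e' = ennreal K * emeasure lborel S + (ennreal K * ennreal e' + ennreal e')"
      by (simp add: distrib_left add.assoc)
    also have "ennreal K * ennreal e' + ennreal e' = ennreal (K * e' + e')"
      using e' K by (simp add: ennreal_plus ennreal_mult)
    also have "K * e' + e' = (K + 1) * e'" by (simp add: algebra_simps)
    also have "\<dots> = e" using K by (simp add: e'_def)
    finally show "hausdorff_content (real ?d) S \<le> ennreal K * emeasure lborel S + ennreal e"
      using main[OF e'] by simp
  qed
qed

text \<open>Replaces thickness in terms of content by a volume bound, the form in which it can be
  integrated against the kernel.\<close>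

lemma zero_thick_emeasure:
  fixes D :: "(real ^ 'n) set"
  assumes "zero_thick D" "open D"
  obtains c :: real where "c > 0" "\<And>x (r :: real). x \<in> frontier D \<Longrightarrow> 0 < r \<Longrightarrow> r < 1 \<Longrightarrow> ennreal (c * r ^ CARD('n)) \<le> emeasure lborel (ball x r - D)"
proof -
  let ?K = "(2 * real CARD('n)) ^ CARD('n)"
  have K: "?K > 0" by simp
  from assms(1) obtain c where c: "c > 0" "\<And>x r. x \<in> frontier D \<Longrightarrow> 0 < r \<Longrightarrow> r < 1 \<Longrightarrow>
      ennreal (c * r ^ CARD('n)) \<le> hausdorff_content (real CARD('n)) (ball x r - D)"
    unfolding zero_thick_def by blast
  show thesis
  proof (rule that[of "c / ?K"])
    fix x and r :: real assume xr: "x \<in> frontier D" "0 < r" "r < 1"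
    have "ennreal (c * r ^ CARD('n)) \<le> ennreal ?K * emeasure lborel (ball x r - D)"
      using c(2)[OF xr] hausdorff_content_le_emeasure[of "ball x r - D"] assms(2)
      by (meson borel_open bounded_ball bounded_diff order_trans open_ball sets.Diff)
    then have "ennreal (1 / ?K) * ennreal (c * r ^ CARD('n)) \<le> ennreal (1 / ?K) * (ennreal ?K * emeasure lborel (ball x r - D))"
      by (rule mult_left_mono) simp
    also have "\<dots> = ennreal (1 / ?K * ?K) * emeasure lborel (ball x r - D)"
      by (subst ennreal_mult) (auto simp: mult.assoc)
    also have "1 / ?K * ?K = 1" using K by simp
    also have "ennreal (1 / ?K) * ennreal (c * r ^ CARD('n)) = ennreal (c / ?K * r ^ CARD('n))"
      using c xr by (subst ennreal_mult[symmetric]) auto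
    finally show "ennreal (c / ?K * r ^ CARD('n)) \<le> emeasure lborel (ball x r - D)" by simp
  qed (use c in simp)
qed

lemma dyadic_scale:
  fixes \<delta> r :: real
  assumes "0 < \<delta>" "\<delta> \<le> r"
  obtains k :: nat where "2 ^ k * \<delta> \<le> r" "r < 2 ^ Suc k * \<delta>"
proof -
  have "\<exists>n. r < 2 ^ n * \<delta>"
    using real_arch_pow[of 2 "r / \<delta>"] assms by (auto simp: field_simps)
  then obtain n where n: "r < 2 ^ n * \<delta>" "\<And>j. j < n \<Longrightarrow> \<not> r < 2 ^ j * \<delta>"
    using exists_least_iff[of "\<lambda>n. r < 2 ^ n * \<delta>"] by blast
  then show thesis using assms that[of "n - 1"] by (cases n) (auto simp: not_less)
qed

text \<open>On the shell \<open>2 ^ k * \<delta> \<le> norm (x - y) < 2 ^ Suc k * \<delta>\<close>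
  the integrand is at most its value at the inner radius, and the shell lies in the ball of the
  outer radius. \<open>N\<close> holds the scales that \<open>A\<close> can reach: all of them when
  the series converges, finitely many at the critical exponent.\<close>

lemma nn_integral_dyadic_shells:
  fixes x :: "real ^ 'n" and q :: nat
  assumes \<delta>: "0 < \<delta>" and A: "A \<in> sets borel" "\<And>y. y \<in> A \<Longrightarrow> \<delta> \<le> norm (x - y)"
    and N: "\<And>y k. y \<in> A \<Longrightarrow> 2 ^ k * \<delta> \<le> norm (x - y) \<Longrightarrow> k \<in> N"
  shows "(\<integral>\<^sup>+y. indicator A y * ennreal (1 / norm (x - y) ^ q) \<partial>lborel) \<le>
    (\<Sum>k. indicator N k * ennreal (unit_ball_vol (real CARD('n)) * (2 ^ Suc k * \<delta>) ^ CARD('n) / (2 ^ k * \<delta>) ^ q))"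
proof -
  have [measurable]: "cball x r \<in> sets borel" for r by simp
  have "(\<integral>\<^sup>+y. indicator A y * ennreal (1 / norm (x - y) ^ q) \<partial>lborel) \<le>
      (\<integral>\<^sup>+y. (\<Sum>k. indicator N k * (ennreal (1 / (2 ^ k * \<delta>) ^ q) * indicator (cball x (2 ^ Suc k * \<delta>)) y)) \<partial>lborel)"
  proof (rule nn_integral_mono)
    fix y
    show "indicator A y * ennreal (1 / norm (x - y) ^ q) \<le>
      (\<Sum>k. indicator N k * (ennreal (1 / (2 ^ k * \<delta>) ^ q) * indicator (cball x (2 ^ Suc k * \<delta>)) y))"
    proof (cases "y \<in> A")
      case True
      obtain k where k: "2 ^ k * \<delta> \<le> norm (x - y)" "norm (x - y) < 2 ^ Suc k * \<delta>"
        using dyadic_scale[OF \<delta> A(2)[OF True]] by blast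
      define f where "f k = indicator N k * (ennreal (1 / (2 ^ k * \<delta>) ^ q) * indicator (cball x (2 ^ Suc k * \<delta>)) y)" for k
      have pos: "0 < 2 ^ k * \<delta>" using \<delta> by simp
      then have "1 / norm (x - y) ^ q \<le> 1 / (2 ^ k * \<delta>) ^ q"
        by (intro frac_le power_mono zero_less_power k(1)) auto
      then have "indicator A y * ennreal (1 / norm (x - y) ^ q) \<le> f k"
        using True N[OF True k(1)] k(2) by (auto simp: f_def indicator_def dist_norm intro!: ennreal_leI)
      also have "\<dots> = sum f {k}" by simp
      also have "\<dots> \<le> (\<Sum>k. f k)" by (rule sum_le_suminf) auto
      finally show ?thesis unfolding f_def .
    qed simp
  qed
  also have "\<dots> = (\<Sum>k. \<integral>\<^sup>+y. indicator N k * (ennreal (1 / (2 ^ k * \<delta>) ^ q) * indicator (cball x (2 ^ Suc k * \<delta>)) y) \<partial>lborel)"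
    by (rule nn_integral_suminf) measurable
  also have "\<dots> = (\<Sum>k. indicator N k * ennreal (unit_ball_vol (real CARD('n)) * (2 ^ Suc k * \<delta>) ^ CARD('n) / (2 ^ k * \<delta>) ^ q))"
  proof (rule suminf_cong)
    fix k
    have "(\<integral>\<^sup>+y. indicator N k * (ennreal (1 / (2 ^ k * \<delta>) ^ q) * indicator (cball x (2 ^ Suc k * \<delta>)) y) \<partial>lborel)
       = indicator N k * (ennreal (1 / (2 ^ k * \<delta>) ^ q) * emeasure lborel (cball x (2 ^ Suc k * \<delta>)))"
      by (simp add: nn_integral_cmult nn_integral_cmult_indicator)
    also have "emeasure lborel (cball x (2 ^ Suc k * \<delta>)) = ennreal (unit_ball_vol (real CARD('n)) * (2 ^ Suc k * \<delta>) ^ CARD('n))"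
      using \<delta> by (simp add: emeasure_cball)
    also have "ennreal (1 / (2 ^ k * \<delta>) ^ q) * \<dots> = ennreal (unit_ball_vol (real CARD('n)) * (2 ^ Suc k * \<delta>) ^ CARD('n) / (2 ^ k * \<delta>) ^ q)"
      using \<delta> by (subst ennreal_mult[symmetric]) auto
    finally show "(\<integral>\<^sup>+y. indicator N k * (ennreal (1 / (2 ^ k * \<delta>) ^ q) * indicator (cball x (2 ^ Suc k * \<delta>)) y) \<partial>lborel)
      = indicator N k * ennreal (unit_ball_vol (real CARD('n)) * (2 ^ Suc k * \<delta>) ^ CARD('n) / (2 ^ k * \<delta>) ^ q)" .
  qed
  finally show ?thesis .
qed

text \<open>One power above the critical exponent the shells form a geometric series of ratio 1/2.
  The total of order \<open>1 / \<delta>\<close> is later compensated by a jump length of at most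
  \<open>\<delta>\<close>.\<close>

lemma nn_integral_inverse_power_Suc:
  fixes x :: "real ^ 'n"
  assumes \<delta>: "0 < \<delta>" and A: "A \<in> sets borel" "\<And>y. y \<in> A \<Longrightarrow> \<delta> \<le> norm (x - y)"
  shows "(\<integral>\<^sup>+y. indicator A y * ennreal (1 / norm (x - y) ^ Suc CARD('n)) \<partial>lborel) \<le>
    ennreal (2 * unit_ball_vol (real CARD('n)) * 2 ^ CARD('n) / \<delta>)"
proof -
  let ?\<omega> = "unit_ball_vol (real CARD('n))"
  have "(\<integral>\<^sup>+y. indicator A y * ennreal (1 / norm (x - y) ^ Suc CARD('n)) \<partial>lborel) \<le>
    (\<Sum>k. indicator UNIV k * ennreal (?\<omega> * (2 ^ Suc k * \<delta>) ^ CARD('n) / (2 ^ k * \<delta>) ^ Suc CARD('n)))"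
    by (rule nn_integral_dyadic_shells[OF \<delta> A]) auto
  also have "\<dots> = (\<Sum>k. ennreal (?\<omega> * 2 ^ CARD('n) / \<delta> * (1 / 2) ^ k))"
  proof (rule suminf_cong)
    fix k
    have "?\<omega> * (2 ^ Suc k * \<delta>) ^ CARD('n) / (2 ^ k * \<delta>) ^ Suc CARD('n) = ?\<omega> * 2 ^ CARD('n) / \<delta> * (1 / 2) ^ k"
      using \<delta> by (simp add: power_mult_distrib divide_simps)
    then show "indicator UNIV k * ennreal (?\<omega> * (2 ^ Suc k * \<delta>) ^ CARD('n) / (2 ^ k * \<delta>) ^ Suc CARD('n)) = ennreal (?\<omega> * 2 ^ CARD('n) / \<delta> * (1 / 2) ^ k)"
      by (simp del: power_Suc)
  qed
  also have "\<dots> = ennreal (2 * ?\<omega> * 2 ^ CARD('n) / \<delta>)"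
  proof (rule suminf_ennreal_eq)
    have "(\<lambda>k. ?\<omega> * 2 ^ CARD('n) / \<delta> * (1 / 2) ^ k) sums (?\<omega> * 2 ^ CARD('n) / \<delta> * (1 / (1 - 1 / 2)))"
      by (intro sums_mult geometric_sums) simp
    then show "(\<lambda>k. ?\<omega> * 2 ^ CARD('n) / \<delta> * (1 / 2) ^ k) sums (2 * ?\<omega> * 2 ^ CARD('n) / \<delta>)" by (simp add: mult_ac)
  qed (use \<delta> in auto)
  finally show ?thesis .
qed

text \<open>At the critical exponent every shell has the same bound, so only the number
  \<open>n\<close> of shells counts. This is the source of the logarithm.\<close>

lemma nn_integral_inverse_power_bounded:
  fixes x :: "real ^ 'n"
  assumes \<delta>: "0 < \<delta>" and A: "A \<in> sets borel" "\<And>y. y \<in> A \<Longrightarrow> \<delta> \<le> norm (x - y)"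
    and n: "\<And>y. y \<in> A \<Longrightarrow> norm (x - y) < 2 ^ n * \<delta>"
  shows "(\<integral>\<^sup>+y. indicator A y * ennreal (1 / norm (x - y) ^ CARD('n)) \<partial>lborel) \<le>
    ennreal (real n * unit_ball_vol (real CARD('n)) * 2 ^ CARD('n))"
proof -
  let ?\<omega> = "unit_ball_vol (real CARD('n))"
  have "(\<integral>\<^sup>+y. indicator A y * ennreal (1 / norm (x - y) ^ CARD('n)) \<partial>lborel) \<le>
    (\<Sum>k. indicator {..<n} k * ennreal (?\<omega> * (2 ^ Suc k * \<delta>) ^ CARD('n) / (2 ^ k * \<delta>) ^ CARD('n)))"
  proof (rule nn_integral_dyadic_shells[OF \<delta> A])
    fix y k assume "y \<in> A" "2 ^ k * \<delta> \<le> norm (x - y)"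
    with n[of y] have "2 ^ k * \<delta> < 2 ^ n * \<delta>" by simp
    with \<delta> show "k \<in> {..<n}" by simp
  qed
  also have "\<dots> = (\<Sum>k<n. indicator {..<n} k * ennreal (?\<omega> * (2 ^ Suc k * \<delta>) ^ CARD('n) / (2 ^ k * \<delta>) ^ CARD('n)))"
    by (rule suminf_finite) auto
  also have "\<dots> = (\<Sum>k<n. ennreal (?\<omega> * 2 ^ CARD('n)))"
  proof (rule sum.cong[OF refl])
    fix k assume "k \<in> {..<n}"
    moreover have "?\<omega> * (2 ^ Suc k * \<delta>) ^ CARD('n) / (2 ^ k * \<delta>) ^ CARD('n) = ?\<omega> * 2 ^ CARD('n)"
      using \<delta> by (simp add: power_mult_distrib)
    ultimately show "indicator {..<n} k * ennreal (?\<omega> * (2 ^ Suc k * \<delta>) ^ CARD('n) / (2 ^ k * \<delta>) ^ CARD('n)) = ennreal (?\<omega> * 2 ^ CARD('n))"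
      by (simp del: power_Suc)
  qed
  also have "\<dots> = ennreal (real n * ?\<omega> * 2 ^ CARD('n))"
    by (simp add: ennreal_of_nat_eq_real_of_nat ennreal_mult[symmetric] mult.assoc)
  finally show ?thesis .
qed

section \<open>Drift of the logarithmic potential\<close>

text \<open>Clipping \<open>\<xi>\<close> to \<open>[-1, 1]\<close> extends the bound on
  \<open>|g \<sigma> \<xi> - 1|\<close> to all real \<open>\<xi>\<close>, hence to directions
  \<open>v\<close> off the sphere, while the spherical mean is unchanged. Later integrability claims
  then hold for every \<open>v\<close> and not just almost surely.\<close>

lemma sphere_kernel_bounded_minorant:
  defines "p \<equiv> real CARD('n::finite) / 2"
  obtains g :: "real \<Rightarrow> real \<Rightarrow> real" and c C :: real
  where "c > 0" "C > 0" "(\<lambda>(\<sigma>, \<xi>). g \<sigma> \<xi>) \<in> borel_measurable (borel \<Otimes>\<^sub>M borel)"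
    and "\<And>\<sigma> \<xi>. 0 \<le> \<sigma> \<Longrightarrow> \<sigma> \<le> 1 \<Longrightarrow> \<bar>\<xi>\<bar> \<le> 1 \<Longrightarrow> 0 < 1 + \<sigma>\<^sup>2 + 2 * \<sigma> * \<xi> \<Longrightarrow> g \<sigma> \<xi> \<le> (1 + \<sigma>\<^sup>2 + 2 * \<sigma> * \<xi>) powr (- p)"
    and "\<And>\<sigma> \<xi>. 0 \<le> \<sigma> \<Longrightarrow> \<sigma> \<le> 1 \<Longrightarrow> \<bar>g \<sigma> \<xi> - 1\<bar> \<le> C * \<sigma>"
    and "\<And>\<sigma> (e :: real ^ 'n). 0 \<le> \<sigma> \<Longrightarrow> \<sigma> \<le> 1 \<Longrightarrow> norm e = 1 \<Longrightarrow> 1 + c * \<sigma>\<^sup>2 \<le> (\<integral>v. g \<sigma> (e \<bullet> v) \<partial>uniform_sphere)"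
proof -
  show thesis
  proof (rule sphere_kernel_minorant[where 'n='n, folded p_def])
    fix g :: "real \<Rightarrow> real \<Rightarrow> real" and c C :: real
    assume g: "c > 0" "C > 0" "(\<lambda>(\<sigma>, \<xi>). g \<sigma> \<xi>) \<in> borel_measurable (borel \<Otimes>\<^sub>M borel)"
      "\<And>\<sigma> \<xi>. 0 \<le> \<sigma> \<Longrightarrow> \<sigma> \<le> 1 \<Longrightarrow> \<bar>\<xi>\<bar> \<le> 1 \<Longrightarrow> 0 < 1 + \<sigma>\<^sup>2 + 2 * \<sigma> * \<xi> \<Longrightarrow> g \<sigma> \<xi> \<le> (1 + \<sigma>\<^sup>2 + 2 * \<sigma> * \<xi>) powr (- p)"
      "\<And>\<sigma> \<xi>. 0 \<le> \<sigma> \<Longrightarrow> \<sigma> \<le> 1 \<Longrightarrow> \<bar>\<xi>\<bar> \<le> 1 \<Longrightarrow> \<bar>g \<sigma> \<xi> - 1\<bar> \<le> C * \<sigma>"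
      "\<And>\<sigma> (e :: real ^ 'n). 0 \<le> \<sigma> \<Longrightarrow> \<sigma> \<le> 1 \<Longrightarrow> norm e = 1 \<Longrightarrow> 1 + c * \<sigma>\<^sup>2 \<le> (\<integral>v. g \<sigma> (e \<bullet> v) \<partial>uniform_sphere)"
    have gm [measurable]: "(\<lambda>x. g (f1 x) (f2 x)) \<in> borel_measurable N"
      if [measurable]: "f1 \<in> borel_measurable N" "f2 \<in> borel_measurable N" for f1 f2 and N :: "'z measure"
      using measurable_compose[OF measurable_Pair[OF that] g(3)] by simp
    define clip where "clip \<xi> = max (-1) (min 1 \<xi>)" for \<xi> :: real
    have clip: "\<bar>clip \<xi>\<bar> \<le> 1" "\<bar>\<xi>\<bar> \<le> 1 \<Longrightarrow> clip \<xi> = \<xi>" for \<xi> by (auto simp: clip_def)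
    have [measurable]: "clip \<in> borel_measurable borel" unfolding clip_def by measurable
    have g_clip: "(\<integral>v. g \<sigma> (clip (e \<bullet> v)) \<partial>uniform_sphere) = (\<integral>v. g \<sigma> (e \<bullet> v) \<partial>uniform_sphere)"
      if "norm e = 1" for \<sigma> and e :: "real ^ 'n"
    proof (rule integral_cong_AE)
      show "AE v in uniform_sphere. g \<sigma> (clip (e \<bullet> v)) = g \<sigma> (e \<bullet> v)"
        using uniform_sphere_norm
      proof eventually_elim
        case (elim v)
        then have "\<bar>e \<bullet> v\<bar> \<le> 1" using Cauchy_Schwarz_ineq2[of e v] that by simp
        then show ?case by (simp add: clip)
      qed
    qed measurable
    show thesis
    proof (rule that[of c C "\<lambda>\<sigma> \<xi>. g \<sigma> (clip \<xi>)"])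
      show "(\<lambda>(\<sigma>, \<xi>). g \<sigma> (clip \<xi>)) \<in> borel_measurable (borel \<Otimes>\<^sub>M borel)"
        unfolding case_prod_beta by measurable
    qed (use g clip g_clip in auto)
  qed
qed

text \<open>For \<open>x = - y < 0\<close> it follows from
  \<open>1 + y + y^2 / 2 \<le> exp y\<close>, because the product of this polynomial with
  \<open>1 - y + y^2\<close> is at least 1.\<close>

lemma exp_le_quadratic:
  fixes x :: real
  assumes "x \<le> 1"
  shows "exp x \<le> 1 + x + x\<^sup>2"
proof (cases "0 \<le> x")
  case True
  then show ?thesis using assms by (rule exp_bound)
next
  case False
  define y where "y = - x"
  have y: "y \<ge> 0" using False by (simp add: y_def)
  have e: "1 + y + y\<^sup>2 / 2 \<le> exp y" using y by (rule exp_lower_Taylor_quadratic)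
  have pos: "0 \<le> 1 - y + y\<^sup>2"
  proof -
    have "0 \<le> (y - 1 / 2)\<^sup>2" by simp
    then show ?thesis by (simp add: power2_eq_square algebra_simps)
  qed
  have "1 \<le> 1 + y\<^sup>2 / 2 + y ^ 3 / 2 + y ^ 4 / 2" using y by simp
  also have "\<dots> = (1 - y + y\<^sup>2) * (1 + y + y\<^sup>2 / 2)" 
    by (simp add: field_simps power2_eq_square power3_eq_cube power4_eq_xxxx)
  also have "\<dots> \<le> (1 - y + y\<^sup>2) * exp y" using e pos by (rule mult_left_mono)
  finally have "exp (- y) \<le> 1 - y + y\<^sup>2" by (simp add: exp_minus field_simps)
  then show ?thesis by (simp add: y_def)
qed

text \<open>Scaling by \<open>norm a\<close> reduces a jump seen from a pole at distance
  \<open>norm a\<close> to the kernel at a unit vector, with relative radius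
  \<open>\<sigma>\<close>.\<close>

lemma inverse_norm_power_shift:
  fixes a v :: "real ^ 'n"
  assumes "a \<noteq> 0" "a + s *\<^sub>R v \<noteq> 0" "norm v = 1"
  defines "\<sigma> \<equiv> s / norm a" and "\<xi> \<equiv> (a /\<^sub>R norm a) \<bullet> v"
  shows "0 < 1 + \<sigma>\<^sup>2 + 2 * \<sigma> * \<xi>"
    and "1 / norm (a + s *\<^sub>R v) ^ CARD('n) = 1 / norm a ^ CARD('n) * (1 + \<sigma>\<^sup>2 + 2 * \<sigma> * \<xi>) powr (- (real CARD('n) / 2))"
proof -
  define u where "u = 1 + \<sigma>\<^sup>2 + 2 * \<sigma> * \<xi>"
  have "(norm (a + s *\<^sub>R v))\<^sup>2 = (norm a)\<^sup>2 + s\<^sup>2 + 2 * s * (a \<bullet> v)"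
  proof -
    have "v \<bullet> v = 1" using assms(3) by (simp add: norm_eq_1)
    then show ?thesis unfolding power2_norm_eq_inner
      by (simp add: inner_add_left inner_add_right inner_commute power2_eq_square algebra_simps)
  qed
  also have "\<dots> = (norm a)\<^sup>2 * u"
    using assms(1) unfolding u_def \<sigma>_def \<xi>_def by (simp add: power2_eq_square field_simps)
  finally have sq: "(norm (a + s *\<^sub>R v))\<^sup>2 = (norm a)\<^sup>2 * u" .
  have "0 < (norm (a + s *\<^sub>R v))\<^sup>2" using assms(2) by simp
  then show u_pos: "0 < 1 + \<sigma>\<^sup>2 + 2 * \<sigma> * \<xi>"
    unfolding sq u_def[symmetric] by (simp add: zero_less_mult_iff)
  then have u_pos': "0 < u" by (simp add: u_def)
  have "norm (a + s *\<^sub>R v) = norm a * sqrt u"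
    using sq by (metis abs_norm_cancel real_sqrt_abs real_sqrt_mult)
  then have "norm (a + s *\<^sub>R v) ^ CARD('n) = norm a ^ CARD('n) * u powr (real CARD('n) / 2)"
    using u_pos' by (simp add: power_mult_distrib powr_half_sqrt[symmetric] powr_realpow[symmetric] powr_powr)
  then show "1 / norm (a + s *\<^sub>R v) ^ CARD('n) = 1 / norm a ^ CARD('n) * (1 + \<sigma>\<^sup>2 + 2 * \<sigma> * \<xi>) powr (- (real CARD('n) / 2))"
    unfolding u_def[symmetric] by (simp add: powr_minus field_simps)
qed

section \<open>The potential of the complement of a thick domain\<close>

locale thick_domain =
  fixes D :: "(real ^ 'n) set" and c0 :: real
  assumes open_D: "open D" and nonempty_D: "D \<noteq> {}" and D_ball: "D \<subseteq> ball 0 1"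
    and c0_pos: "c0 > 0"
    and thick: "\<And>x r. x \<in> frontier D \<Longrightarrow> 0 < r \<Longrightarrow> r < 1 \<Longrightarrow> ennreal (c0 * r ^ CARD('n)) \<le> emeasure lborel (ball x r - D)"
begin

abbreviation bdist :: "real ^ 'n \<Rightarrow> real" where "bdist x \<equiv> infdist x (frontier D)"

text \<open>Radius 2 keeps the volume finite and leaves room for the balls of radius less than 1
  around the points of \<open>frontier D\<close>, which have norm at most 1.\<close>

definition outside :: "(real ^ 'n) set" where "outside = cball 0 2 - D"

definition potential :: "real ^ 'n \<Rightarrow> real" where
  "potential x = (\<integral>y. indicator outside y * (1 / norm (x - y) ^ CARD('n)) \<partial>lborel)"

text \<open>A step may land on the boundary. There the kernel need not be integrable, and the
  default value 0 of the integral would give weight 1 instead of 0; hence the indicator.\<close>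

definition weight :: "real \<Rightarrow> real ^ 'n \<Rightarrow> real" where
  "weight \<gamma> x = indicator D x * exp (- \<gamma> * potential x)"

lemma frontier_nonempty: "frontier D \<noteq> {}"
proof -
  have "D \<noteq> UNIV" using D_ball bounded_subset[OF bounded_ball] not_bounded_UNIV by metis
  then show ?thesis using nonempty_D by (simp add: frontier_eq_empty)
qed

lemma closure_D: "closure D \<subseteq> cball 0 1"
  using closure_mono[OF D_ball] by simp

lemma bdist_attained:
  obtains z where "z \<in> frontier D" "dist x z = bdist x"
  using infdist_attains_inf[OF frontier_closed frontier_nonempty] by metis

lemma bdist_pos: "x \<in> D \<Longrightarrow> 0 < bdist x"
  using infdist_pos_not_in_closed[OF frontier_closed frontier_nonempty, of x] open_D
  by (auto simp: frontier_def interior_open)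

lemma bdist_less_2: "x \<in> D \<Longrightarrow> bdist x < 2"
proof -
  assume x: "x \<in> D"
  obtain z where z: "z \<in> frontier D" "dist x z = bdist x" by (rule bdist_attained)
  have "norm z \<le> 1" using z(1) closure_D by (auto simp: frontier_def)
  moreover have "norm x < 1" using x D_ball by auto
  ultimately show ?thesis using z(2) norm_triangle_ineq4[of x z] by (simp add: dist_norm)
qed

lemma bdist_le:
  assumes "x \<in> D" "y \<notin> D"
  shows "bdist x \<le> norm (x - y)"
proof -
  have "closed_segment x y \<inter> frontier D \<noteq> {}"
    using assms by (intro connected_Int_frontier) auto
  then obtain z where z: "z \<in> closed_segment x y" "z \<in> frontier D" by blast
  have "bdist x \<le> dist x z" using z(2) by (rule infdist_le)
  also have "\<dots> \<le> dist x y" using dist_in_closed_segment[OF z(1)] by (simp add: dist_commute)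
  finally show ?thesis by (simp add: dist_norm)
qed

lemma sets_D [measurable]: "D \<in> sets borel"
  using open_D by auto

lemma sets_outside [measurable]: "outside \<in> sets borel"
  unfolding outside_def using open_D by auto

lemma emeasure_outside: "emeasure lborel outside < \<infinity>"
proof -
  have "emeasure lborel outside \<le> emeasure lborel (cball 0 2 :: (real ^ 'n) set)"
    by (rule emeasure_mono) (auto simp: outside_def)
  also have "\<dots> < \<infinity>" using emeasure_compact_finite compact_cball by blast
  finally show ?thesis .
qed

lemma outside_le: "x \<in> D \<Longrightarrow> y \<in> outside \<Longrightarrow> bdist x \<le> norm (x - y)"
  by (rule bdist_le) (auto simp: outside_def)

lemma outside_norm_pos: "x \<in> D \<Longrightarrow> y \<in> outside \<Longrightarrow> 0 < norm (x - y)"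
  using outside_le bdist_pos by (metis less_le_trans)

lemma potential_integrable:
  assumes "x \<in> D"
  shows "integrable lborel (\<lambda>y. indicator outside y * (1 / norm (x - y) ^ q))"
proof (rule integrableI_bounded_set[where A=outside and B="1 / bdist x ^ q"])
  show "AE y in lborel. y \<in> outside \<longrightarrow> norm (indicator outside y * (1 / norm (x - y) ^ q)) \<le> 1 / bdist x ^ q"
    using bdist_pos[OF assms] outside_le[OF assms]
    by (intro AE_I2) (auto intro!: frac_le power_mono)
qed (use emeasure_outside in auto)

lemma potential_nonneg: "0 \<le> potential x"
  unfolding potential_def by (intro Bochner_Integration.integral_nonneg) auto

lemma potential_measurable [measurable]: "potential \<in> borel_measurable borel"
  unfolding potential_def by measurable

lemma weight_measurable [measurable]: "weight \<gamma> \<in> borel_measurable borel"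
  unfolding weight_def by measurable

lemma potential_le:
  assumes x: "x \<in> D"
  shows "potential x \<le> unit_ball_vol (real CARD('n)) * 2 ^ CARD('n) * (log 2 (4 / bdist x) + 1)"
proof -
  let ?\<delta> = "bdist x" and ?\<omega> = "unit_ball_vol (real CARD('n)) * 2 ^ CARD('n)"
  have \<delta>: "0 < ?\<delta>" "?\<delta> < 2" using bdist_pos[OF x] bdist_less_2[OF x] by auto
  \<comment> \<open>Points of \<open>outside\<close> have distance less than 3 from
    \<open>x\<close>, so the shells up to radius \<open>2 ^ n * ?\<delta> \<ge> 4\<close> reach all
    of them.\<close>
  define n where "n = nat \<lceil>log 2 (4 / ?\<delta>)\<rceil>"
  have log_pos: "0 < log 2 (4 / ?\<delta>)" using \<delta> by (simp add: field_simps)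
  have n1: "log 2 (4 / ?\<delta>) \<le> real n" and n2: "real n \<le> log 2 (4 / ?\<delta>) + 1"
    using log_pos unfolding n_def by linarith+
  have "4 / ?\<delta> \<le> 2 ^ n"
    using n1 \<delta> by (simp add: log_le_iff powr_realpow)
  then have n3: "4 \<le> 2 ^ n * ?\<delta>" using \<delta> by (simp add: field_simps)
  have "potential x \<le> real n * unit_ball_vol (real CARD('n)) * 2 ^ CARD('n)"
    unfolding potential_def
  proof (rule integral_real_bounded)
    have "(\<integral>\<^sup>+y. ennreal (indicator outside y * (1 / norm (x - y) ^ CARD('n))) \<partial>lborel)
      = (\<integral>\<^sup>+y. indicator outside y * ennreal (1 / norm (x - y) ^ CARD('n)) \<partial>lborel)"
      by (intro nn_integral_cong) (auto simp: indicator_def)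
    also have "\<dots> \<le> ennreal (real n * unit_ball_vol (real CARD('n)) * 2 ^ CARD('n))"
    proof (rule nn_integral_inverse_power_bounded[OF \<delta>(1) sets_outside])
      fix y assume y: "y \<in> outside"
      show "?\<delta> \<le> norm (x - y)" by (rule outside_le[OF x y])
      have "norm x < 1" "norm y \<le> 2" using x y D_ball by (auto simp: outside_def)
      then show "norm (x - y) < 2 ^ n * ?\<delta>" using n3 norm_triangle_ineq4[of x y] by linarith
    qed
    finally show "(\<integral>\<^sup>+y. ennreal (indicator outside y * (1 / norm (x - y) ^ CARD('n))) \<partial>lborel)
      \<le> ennreal (real n * unit_ball_vol (real CARD('n)) * 2 ^ CARD('n))" .
  qed simp
  also have "\<dots> = ?\<omega> * real n" by simp
  also have "\<dots> \<le> ?\<omega> * (log 2 (4 / ?\<delta>) + 1)" using n2 by (intro mult_left_mono) auto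
  finally show ?thesis .
qed

text \<open>The potential is strictly subharmonic, so a jump to the sphere of radius \<open>s\<close> increases it on
  average; the increment is bounded below by a bounded function \<open>Q\<close> of the direction, so that
  \<open>e\<^sup>-\<^sup>\<gamma>\<^sup>Q\<close> can be expanded to second order.\<close>

lemma weight_drift:
  obtains c C :: real where "c > 0" "C > 0"
    and "\<And>x s \<gamma>. x \<in> D \<Longrightarrow> 0 \<le> s \<Longrightarrow> s \<le> bdist x \<Longrightarrow> 0 < \<gamma> \<Longrightarrow> \<gamma> * C \<le> 1 \<Longrightarrow>
      (\<integral>\<^sup>+v. ennreal (weight \<gamma> (x + s *\<^sub>R v)) \<partial>uniform_sphere) \<le>
        ennreal (weight \<gamma> x * (1 - \<gamma> * (c * (s / bdist x)\<^sup>2) + (\<gamma> * C)\<^sup>2))"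
proof -
  let ?d = "CARD('n)" and ?\<mu> = "uniform_sphere :: (real ^ 'n) measure"
  interpret S: prob_space ?\<mu> by (rule prob_space_uniform_sphere)
  interpret P: pair_sigma_finite lborel ?\<mu> by unfold_locales
  show thesis
  proof (rule sphere_kernel_bounded_minorant[where 'n='n])
    fix g :: "real \<Rightarrow> real \<Rightarrow> real" and c C :: real
    assume g: "c > 0" "C > 0" "(\<lambda>(\<sigma>, \<xi>). g \<sigma> \<xi>) \<in> borel_measurable (borel \<Otimes>\<^sub>M borel)"
      "\<And>\<sigma> \<xi>. 0 \<le> \<sigma> \<Longrightarrow> \<sigma> \<le> 1 \<Longrightarrow> \<bar>\<xi>\<bar> \<le> 1 \<Longrightarrow> 0 < 1 + \<sigma>\<^sup>2 + 2 * \<sigma> * \<xi> \<Longrightarrow> g \<sigma> \<xi> \<le> (1 + \<sigma>\<^sup>2 + 2 * \<sigma> * \<xi>) powr (- (real ?d / 2))"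
      "\<And>\<sigma> \<xi>. 0 \<le> \<sigma> \<Longrightarrow> \<sigma> \<le> 1 \<Longrightarrow> \<bar>g \<sigma> \<xi> - 1\<bar> \<le> C * \<sigma>"
      "\<And>\<sigma> (e :: real ^ 'n). 0 \<le> \<sigma> \<Longrightarrow> \<sigma> \<le> 1 \<Longrightarrow> norm e = 1 \<Longrightarrow> 1 + c * \<sigma>\<^sup>2 \<le> (\<integral>v. g \<sigma> (e \<bullet> v) \<partial>uniform_sphere)"
    have gm [measurable (raw)]: "(\<lambda>x. g (f1 x) (f2 x)) \<in> borel_measurable N"
      if "f1 \<in> borel_measurable N" "f2 \<in> borel_measurable N" for f1 f2 and N :: "'z measure"
      using measurable_compose[OF measurable_Pair[OF that] g(3)] by simp
    define K where "K = 2 * unit_ball_vol (real ?d) * 2 ^ ?d"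
    have K: "K > 0" by (simp add: K_def)
    \<comment> \<open>The gain per unit volume near the closest boundary point, at least
      \<open>c * s^2 / (2 * ?\<delta>)^(d + 2)\<close>, times the volume
      \<open>c0 * (?\<delta> / 2)^d\<close> available there equals
      \<open>c2 * (s / ?\<delta>)^2\<close>. Likewise \<open>C2\<close> bounds \<open>C * s\<close>
      times the shell estimate \<open>K / ?\<delta>\<close>, by
      \<open>s \<le> ?\<delta>\<close>.\<close>
    define c2 where "c2 = c * c0 / (4 * 4 ^ ?d)"
    define C2 where "C2 = C * K"
    show thesis
    proof (rule that[of c2 C2])
      show "c2 > 0" "C2 > 0" using g K c0_pos by (auto simp: c2_def C2_def)
      fix x s \<gamma>
      assume x: "x \<in> D" and s: "0 \<le> s" "s \<le> bdist x" and \<gamma>: "0 < \<gamma>" "\<gamma> * C2 \<le> 1"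
      let ?\<delta> = "bdist x"
      have \<delta>: "0 < ?\<delta>" "?\<delta> < 2" using bdist_pos[OF x] bdist_less_2[OF x] by auto
      \<comment> \<open>The increment of the minorant for a single pole \<open>y\<close>; since
        \<open>s \<le> ?\<delta> \<le> norm (x - y)\<close>, the relative radius is at most
        1.\<close>
      define h where "h y v = indicator outside y * (1 / norm (x - y) ^ ?d) *
        (g (s / norm (x - y)) (((x - y) /\<^sub>R norm (x - y)) \<bullet> v) - 1)" for y v
      define Q where "Q v = (\<integral>y. h y v \<partial>lborel)" for v
      have ratio: "0 \<le> s / norm (x - y)" "s / norm (x - y) \<le> 1" if "y \<in> outside" for y
        using outside_le[OF x that] outside_norm_pos[OF x that] s by (auto simp: divide_simps)
      have h_bound: "\<bar>h y v\<bar> \<le> C * s * (indicator outside y * (1 / norm (x - y) ^ Suc ?d))" for y v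
      proof (cases "y \<in> outside")
        case True
        have "\<bar>h y v\<bar> = 1 / norm (x - y) ^ ?d * \<bar>g (s / norm (x - y)) (((x - y) /\<^sub>R norm (x - y)) \<bullet> v) - 1\<bar>"
          using True by (simp add: h_def abs_mult)
        also have "\<dots> \<le> 1 / norm (x - y) ^ ?d * (C * (s / norm (x - y)))"
          using g(5)[OF ratio[OF True]] by (intro mult_left_mono) auto
        finally show ?thesis using True by (simp add: mult_ac)
      qed (simp add: h_def)
      have int_q: "integrable lborel (\<lambda>y. indicator outside y * (1 / norm (x - y) ^ q))" for q
        by (rule potential_integrable[OF x])
      have h_meas [measurable]: "(\<lambda>(y, v). h y v) \<in> borel_measurable (lborel \<Otimes>\<^sub>M ?\<mu>)"
        unfolding h_def case_prod_beta by measurable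
      have [measurable]: "(\<lambda>y. h y v) \<in> borel_measurable borel" for v
        unfolding h_def by measurable
      have h_int: "integrable lborel (\<lambda>y. h y v)" for v
        by (rule Bochner_Integration.integrable_bound[OF integrable_mult_right[OF int_q[of "Suc ?d"], of "C * s"]])
          (auto simp only: real_norm_def intro!: AE_I2 order.trans[OF h_bound abs_ge_self], measurable)
      have [measurable]: "Q \<in> borel_measurable borel"
      proof -
        have "(\<lambda>v. \<integral>y. h y v \<partial>lborel) \<in> borel_measurable ?\<mu>"
          using h_meas by (intro lborel.borel_measurable_lebesgue_integral) (simp add: measurable_split_conv case_prod_beta measurable_pair_swap_iff[of _ lborel])
        then show ?thesis unfolding Q_def by simp
      qed
      have shell: "(\<integral>y. indicator outside y * (1 / norm (x - y) ^ Suc ?d) \<partial>lborel) \<le> K / ?\<delta>"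
      proof (rule integral_real_bounded)
        have "(\<integral>\<^sup>+y. ennreal (indicator outside y * (1 / norm (x - y) ^ Suc ?d)) \<partial>lborel)
          = (\<integral>\<^sup>+y. indicator outside y * ennreal (1 / norm (x - y) ^ Suc ?d) \<partial>lborel)"
          by (intro nn_integral_cong) (auto simp: indicator_def)
        also have "\<dots> \<le> ennreal (K / ?\<delta>)"
          unfolding K_def by (rule nn_integral_inverse_power_Suc[OF \<delta>(1) sets_outside outside_le[OF x]])
        finally show "(\<integral>\<^sup>+y. ennreal (indicator outside y * (1 / norm (x - y) ^ Suc ?d)) \<partial>lborel) \<le> ennreal (K / ?\<delta>)" .
      qed (use K \<delta> in simp)
      have Q_bound: "\<bar>Q v\<bar> \<le> C2" for v
      proof -
        have "\<bar>Q v\<bar> \<le> (\<integral>y. \<bar>h y v\<bar> \<partial>lborel)" unfolding Q_def by (rule integral_abs_bound)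
        also have "\<dots> \<le> (\<integral>y. C * s * (indicator outside y * (1 / norm (x - y) ^ Suc ?d)) \<partial>lborel)"
          by (intro integral_mono h_bound integrable_abs h_int integrable_mult_right int_q)
        also have "\<dots> = C * s * (\<integral>y. indicator outside y * (1 / norm (x - y) ^ Suc ?d) \<partial>lborel)"
          by (rule integral_mult_right_zero)
        also have "\<dots> \<le> C * ?\<delta> * (K / ?\<delta>)"
          using shell s g(2) \<delta> by (intro mult_mono) (auto intro!: Bochner_Integration.integral_nonneg)
        also have "\<dots> = C2" using \<delta> by (simp add: C2_def)
        finally show ?thesis .
      qed
      have Q_le: "Q v \<le> potential (x + s *\<^sub>R v) - potential x" if v: "norm v = 1" and xD: "x + s *\<^sub>R v \<in> D" for v
      proof -
        have "Q v \<le> (\<integral>y. indicator outside y * (1 / norm (x + s *\<^sub>R v - y) ^ ?d) - indicator outside y * (1 / norm (x - y) ^ ?d) \<partial>lborel)"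
          unfolding Q_def
        proof (rule integral_mono[OF h_int])
          show "integrable lborel (\<lambda>y. indicator outside y * (1 / norm (x + s *\<^sub>R v - y) ^ ?d) - indicator outside y * (1 / norm (x - y) ^ ?d))"
            by (intro Bochner_Integration.integrable_diff int_q potential_integrable[OF xD])
          fix y
          show "h y v \<le> indicator outside y * (1 / norm (x + s *\<^sub>R v - y) ^ ?d) - indicator outside y * (1 / norm (x - y) ^ ?d)"
          proof (cases "y \<in> outside")
            case True
            have nz: "x - y \<noteq> 0" "(x - y) + s *\<^sub>R v \<noteq> 0"
              using outside_norm_pos[OF x True] outside_norm_pos[OF xD True] by (auto simp: algebra_simps)
            define \<sigma> \<xi> where "\<sigma> = s / norm (x - y)" and "\<xi> = ((x - y) /\<^sub>R norm (x - y)) \<bullet> v"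
            have \<xi>: "\<bar>\<xi>\<bar> \<le> 1"
              using Cauchy_Schwarz_ineq2[of "(x - y) /\<^sub>R norm (x - y)" v] v nz by (simp add: \<xi>_def)
            note u = inverse_norm_power_shift[OF nz v, folded \<sigma>_def \<xi>_def]
            have "g \<sigma> \<xi> \<le> (1 + \<sigma>\<^sup>2 + 2 * \<sigma> * \<xi>) powr (- (real ?d / 2))"
              by (rule g(4)) (use ratio[OF True] \<xi> u in \<open>auto simp: \<sigma>_def\<close>)
            then have "1 / norm (x - y) ^ ?d * g \<sigma> \<xi> \<le> 1 / norm ((x - y) + s *\<^sub>R v) ^ ?d"
              unfolding u(2) by (intro mult_left_mono) auto
            moreover have "(x - y) + s *\<^sub>R v = x + s *\<^sub>R v - y" by simp
            ultimately show ?thesis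
              using True unfolding h_def \<sigma>_def[symmetric] \<xi>_def[symmetric]
              by (simp add: algebra_simps diff_divide_distrib)
          qed (simp add: h_def)
        qed
        also have "\<dots> = potential (x + s *\<^sub>R v) - potential x"
          unfolding potential_def by (intro Bochner_Integration.integral_diff int_q potential_integrable[OF xD])
        finally show ?thesis .
      qed
      have Q_int: "integrable ?\<mu> Q"
        by (rule S.integrable_const_bound[where B=C2]) (use Q_bound in auto)
      have Q_mean: "c2 * (s / ?\<delta>)\<^sup>2 \<le> (\<integral>v. Q v \<partial>?\<mu>)"
      proof -
        obtain z where z: "z \<in> frontier D" "dist x z = ?\<delta>" by (rule bdist_attained)
        \<comment> \<open>Every pole contributes a nonnegative mean increment, so it suffices to
          keep the part of the complement near the boundary point \<open>z\<close> closest to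
          \<open>x\<close>, where thickness supplies the volume and the distance from
          \<open>x\<close> is at most \<open>2 * ?\<delta>\<close>.\<close>
        define H where "H = ball z (?\<delta> / 2) - D"
        have [measurable]: "H \<in> sets borel" using open_D by (simp add: H_def)
        have H_out: "H \<subseteq> outside"
        proof
          fix y assume y: "y \<in> H"
          have "norm z \<le> 1" using z(1) closure_D by (auto simp: frontier_def)
          moreover have "norm (y - z) \<le> ?\<delta> / 2" using y by (auto simp: H_def dist_norm norm_minus_commute)
          ultimately have "norm y \<le> 2" using norm_triangle_ineq[of z "y - z"] \<delta> by simp
          then show "y \<in> outside" using y by (auto simp: H_def outside_def)
        qed
        have H_fin: "emeasure lborel H < \<infinity>"
          using emeasure_outside emeasure_mono[OF H_out, of lborel] by (simp add: le_less_trans)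
        have H_near: "norm (x - y) \<le> 2 * ?\<delta>" if "y \<in> H" for y
        proof -
          have "dist x y \<le> dist x z + dist z y" by (rule dist_triangle)
          then show ?thesis using that z(2) \<delta> by (auto simp: H_def dist_norm)
        qed
        have "c0 * (?\<delta> / 2) ^ ?d \<le> measure lborel H"
        proof -
          have "ennreal (c0 * (?\<delta> / 2) ^ ?d) \<le> emeasure lborel H"
            unfolding H_def using thick[OF z(1), of "?\<delta> / 2"] \<delta> by simp
          also have "\<dots> = ennreal (measure lborel H)"
            using H_fin by (intro emeasure_eq_ennreal_measure) (simp add: less_top)
          finally show ?thesis by (simp add: ennreal_le_iff)
        qed
        then have "c * s\<^sup>2 / (2 * ?\<delta>) ^ (?d + 2) * (c0 * (?\<delta> / 2) ^ ?d) \<le> c * s\<^sup>2 / (2 * ?\<delta>) ^ (?d + 2) * measure lborel H"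
          using g \<delta> by (intro mult_left_mono) auto
        moreover have "c * s\<^sup>2 / (2 * ?\<delta>) ^ (?d + 2) * (c0 * (?\<delta> / 2) ^ ?d) = c2 * (s / ?\<delta>)\<^sup>2"
        proof -
          have "(4::real) ^ ?d = 2 ^ ?d * 2 ^ ?d" by (simp add: power_mult_distrib[symmetric])
          then show ?thesis using \<delta> unfolding c2_def power_add power_divide power_mult_distrib
            by (simp add: field_simps power2_eq_square)
        qed
        ultimately have "c2 * (s / ?\<delta>)\<^sup>2 \<le> c * s\<^sup>2 / (2 * ?\<delta>) ^ (?d + 2) * measure lborel H" by simp
        also have "\<dots> = (\<integral>y. c * s\<^sup>2 / (2 * ?\<delta>) ^ (?d + 2) * indicator H y \<partial>lborel)" by simp
        also have "\<dots> \<le> (\<integral>y. (\<integral>v. h y v \<partial>?\<mu>) \<partial>lborel)"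
        proof (rule integral_mono)
          show "integrable lborel (\<lambda>y. c * s\<^sup>2 / (2 * ?\<delta>) ^ (?d + 2) * indicator H y)"
            using H_fin by (intro integrable_mult_right integrable_real_indicator) auto
          show "integrable lborel (\<lambda>y. \<integral>v. h y v \<partial>?\<mu>)"
          proof (rule Bochner_Integration.integrable_bound[OF integrable_mult_right[OF int_q[of "Suc ?d"], of "C * s"]])
            show "(\<lambda>y. \<integral>v. h y v \<partial>?\<mu>) \<in> borel_measurable lborel"
              using h_meas by (rule S.borel_measurable_lebesgue_integral)
            show "AE y in lborel. norm (\<integral>v. h y v \<partial>?\<mu>) \<le> norm (C * s * (indicator outside y * (1 / norm (x - y) ^ Suc ?d)))"
            proof (rule AE_I2)
              fix y
              have "norm (\<integral>v. h y v \<partial>?\<mu>) \<le> (\<integral>v. \<bar>h y v\<bar> \<partial>?\<mu>)" unfolding real_norm_def by (rule integral_abs_bound)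
              also have "\<dots> \<le> (\<integral>v. C * s * (indicator outside y * (1 / norm (x - y) ^ Suc ?d)) \<partial>?\<mu>)"
                by (rule integral_mono')  (use h_bound g(2) s in auto)
              also have "\<dots> = C * s * (indicator outside y * (1 / norm (x - y) ^ Suc ?d))"
                by (simp add: S.prob_space[simplified])
              also have "\<dots> \<le> norm (C * s * (indicator outside y * (1 / norm (x - y) ^ Suc ?d)))"
                by (simp only: real_norm_def abs_ge_self)
              finally show "norm (\<integral>v. h y v \<partial>?\<mu>) \<le> norm (C * s * (indicator outside y * (1 / norm (x - y) ^ Suc ?d)))" .
            qed
          qed
          fix y
          show "c * s\<^sup>2 / (2 * ?\<delta>) ^ (?d + 2) * indicator H y \<le> (\<integral>v. h y v \<partial>?\<mu>)"
          proof (cases "y \<in> outside")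
            case False
            then have "y \<notin> H" using H_out by auto
            with False show ?thesis by (simp add: h_def)
          next
            case True
            define r where "r = norm (x - y)"
            have r: "0 < r" using outside_norm_pos[OF x True] by (simp add: r_def)
            define e where "e = (x - y) /\<^sub>R norm (x - y)"
            have e: "norm e = 1" using r by (simp add: e_def r_def)
            have g_int: "integrable ?\<mu> (\<lambda>v. g (s / r) (e \<bullet> v))"
            proof (rule integrable_uniform_sphere[where B="1 + C"])
              fix v
              have "\<bar>g (s / r) (e \<bullet> v) - 1\<bar> \<le> C * (s / r)" using ratio[OF True] by (intro g(5)) (auto simp: r_def)
              also have "\<dots> \<le> C * 1" using ratio[OF True] g(2) by (intro mult_left_mono) (auto simp: r_def)
              finally show "\<bar>g (s / r) (e \<bullet> v)\<bar> \<le> 1 + C" by linarith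
            qed measurable
            have "c * s\<^sup>2 / (2 * ?\<delta>) ^ (?d + 2) * indicator H y \<le> 1 / r ^ ?d * (c * (s / r)\<^sup>2)"
            proof (cases "y \<in> H")
              case True
              have "c * s\<^sup>2 / (2 * ?\<delta>) ^ (?d + 2) \<le> c * s\<^sup>2 / r ^ (?d + 2)"
                using H_near[OF True] r g(1) by (intro frac_le power_mono zero_less_power) (auto simp: r_def)
              also have "\<dots> = 1 / r ^ ?d * (c * (s / r)\<^sup>2)"
                by (simp add: power_divide power_add power2_eq_square)
              finally show ?thesis using True by simp
            qed (use g(1) r in simp)
            also have "\<dots> \<le> 1 / r ^ ?d * ((\<integral>v. g (s / r) (e \<bullet> v) \<partial>?\<mu>) - 1)"
              using g(6)[of "s / r" e] ratio[OF True] e r by (intro mult_left_mono) (auto simp: r_def)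
            also have "\<dots> = (\<integral>v. 1 / r ^ ?d * (g (s / r) (e \<bullet> v) - 1) \<partial>?\<mu>)"
              using g_int by (simp add: S.prob_space[simplified])
            also have "\<dots> = (\<integral>v. h y v \<partial>?\<mu>)"
              using True by (simp add: h_def r_def e_def)
            finally show ?thesis .
          qed
        qed
        also have "\<dots> = (\<integral>v. Q v \<partial>?\<mu>)" unfolding Q_def
        proof (rule P.Fubini_integral[symmetric])
          show "integrable (lborel \<Otimes>\<^sub>M ?\<mu>) (\<lambda>(y, v). h y v)"
          proof (rule integrableI_bounded_set[where A="outside \<times> UNIV" and B="C * s * (1 / ?\<delta> ^ Suc ?d)"])
            have "emeasure (lborel \<Otimes>\<^sub>M ?\<mu>) (outside \<times> space ?\<mu>) = emeasure lborel outside * emeasure ?\<mu> (space ?\<mu>)"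
              by (rule S.emeasure_pair_measure_Times) auto
            then show "emeasure (lborel \<Otimes>\<^sub>M ?\<mu>) (outside \<times> UNIV) < \<infinity>"
              using emeasure_outside by (simp add: S.emeasure_space_1[simplified])
            show "AE p in lborel \<Otimes>\<^sub>M ?\<mu>. p \<in> outside \<times> UNIV \<longrightarrow> norm (case p of (y, v) \<Rightarrow> h y v) \<le> C * s * (1 / ?\<delta> ^ Suc ?d)"
            proof (intro AE_I2 impI)
              fix p assume p: "p \<in> outside \<times> (UNIV :: (real ^ 'n) set)"
              obtain y v where yv: "p = (y, v)" "y \<in> outside" using p by auto
              have "\<bar>h y v\<bar> \<le> C * s * (indicator outside y * (1 / norm (x - y) ^ Suc ?d))" by (rule h_bound)
              also have "\<dots> \<le> C * s * (1 / ?\<delta> ^ Suc ?d)"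
                using yv(2) outside_le[OF x yv(2)] \<delta> g(2) s
                by (intro mult_left_mono) (auto intro!: frac_le power_mono mult_pos_pos mult_mono)
              finally show "norm (case p of (y, v) \<Rightarrow> h y v) \<le> C * s * (1 / ?\<delta> ^ Suc ?d)" by (simp add: yv)
            qed
            show "AE p in lborel \<Otimes>\<^sub>M ?\<mu>. p \<notin> outside \<times> UNIV \<longrightarrow> (case p of (y, v) \<Rightarrow> h y v) = 0"
              by (rule AE_I2) (auto simp: h_def indicator_def)
            show "outside \<times> UNIV \<in> sets (lborel \<Otimes>\<^sub>M ?\<mu>)"
              by (rule pair_measureI) auto
          qed measurable
        qed
        finally show ?thesis .
      qed
      have point: "weight \<gamma> (x + s *\<^sub>R v) \<le> weight \<gamma> x * (1 - \<gamma> * Q v + (\<gamma> * C2)\<^sup>2)" if v: "norm v = 1" for v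
      proof -
        have small: "\<bar>\<gamma> * Q v\<bar> \<le> \<gamma> * C2" using Q_bound[of v] \<gamma> by (simp add: abs_mult)
        have "exp (- (\<gamma> * Q v)) \<le> 1 + - (\<gamma> * Q v) + (- (\<gamma> * Q v))\<^sup>2"
          using small \<gamma> by (intro exp_le_quadratic) linarith
        also have "(- (\<gamma> * Q v))\<^sup>2 \<le> (\<gamma> * C2)\<^sup>2"
          using small abs_le_square_iff[of "\<gamma> * Q v" "\<gamma> * C2"] by simp
        finally have e: "exp (- (\<gamma> * Q v)) \<le> 1 - \<gamma> * Q v + (\<gamma> * C2)\<^sup>2" by simp
        \<comment> \<open>For a jump that lands off \<open>D\<close> the weight is 0, and
          nonnegativity of the bound is all that is needed.\<close>
        have e0: "0 \<le> 1 - \<gamma> * Q v + (\<gamma> * C2)\<^sup>2" using e exp_ge_zero[of "- (\<gamma> * Q v)"] by linarith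
        show ?thesis
        proof (cases "x + s *\<^sub>R v \<in> D")
          case True
          have "exp (- \<gamma> * potential (x + s *\<^sub>R v)) \<le> exp (- \<gamma> * (potential x + Q v))"
            using Q_le[OF v True] \<gamma> by simp
          also have "\<dots> = exp (- \<gamma> * potential x) * exp (- (\<gamma> * Q v))"
            by (simp add: exp_add[symmetric] algebra_simps)
          also have "\<dots> \<le> exp (- \<gamma> * potential x) * (1 - \<gamma> * Q v + (\<gamma> * C2)\<^sup>2)"
            using e by (intro mult_left_mono) auto
          finally show ?thesis using True x by (simp add: weight_def)
        qed (use e0 in \<open>simp add: weight_def\<close>)
      qed
      have "(\<integral>\<^sup>+v. ennreal (weight \<gamma> (x + s *\<^sub>R v)) \<partial>?\<mu>) \<le> (\<integral>\<^sup>+v. ennreal (weight \<gamma> x * (1 - \<gamma> * Q v + (\<gamma> * C2)\<^sup>2)) \<partial>?\<mu>)"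
        by (rule nn_integral_mono_AE) (use uniform_sphere_norm in eventually_elim, use point in \<open>auto intro!: ennreal_leI\<close>)
      also have "\<dots> = ennreal (\<integral>v. weight \<gamma> x * (1 - \<gamma> * Q v + (\<gamma> * C2)\<^sup>2) \<partial>?\<mu>)"
      proof (rule nn_integral_eq_integral)
        show "integrable ?\<mu> (\<lambda>v. weight \<gamma> x * (1 - \<gamma> * Q v + (\<gamma> * C2)\<^sup>2))" using Q_int by simp
        show "AE v in ?\<mu>. 0 \<le> weight \<gamma> x * (1 - \<gamma> * Q v + (\<gamma> * C2)\<^sup>2)"
          using uniform_sphere_norm
        proof eventually_elim
          case (elim v)
          have "0 \<le> weight \<gamma> (x + s *\<^sub>R v)" by (simp add: weight_def)
          with point[OF elim] show ?case by linarith
        qed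
      qed
      also have "(\<integral>v. weight \<gamma> x * (1 - \<gamma> * Q v + (\<gamma> * C2)\<^sup>2) \<partial>?\<mu>) = weight \<gamma> x * (1 - \<gamma> * (\<integral>v. Q v \<partial>?\<mu>) + (\<gamma> * C2)\<^sup>2)"
        using Q_int by (simp add: S.prob_space[simplified])
      also have "ennreal \<dots> \<le> ennreal (weight \<gamma> x * (1 - \<gamma> * (c2 * (s / ?\<delta>)\<^sup>2) + (\<gamma> * C2)\<^sup>2))"
        using Q_mean \<gamma> by (intro ennreal_leI mult_left_mono) (auto simp: weight_def)
      finally show "(\<integral>\<^sup>+v. ennreal (weight \<gamma> (x + s *\<^sub>R v)) \<partial>?\<mu>) \<le>
          ennreal (weight \<gamma> x * (1 - \<gamma> * (c2 * (s / ?\<delta>)\<^sup>2) + (\<gamma> * C2)\<^sup>2))" .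
    qed
  qed
qed

end

section \<open>One step of the walk\<close>

lemma heat_psi_nonneg: "0 \<le> heat_psi d s"
  by (auto simp: heat_psi_def ln_powr intro!: mult_nonneg_nonpos)

lemma heat_psi_square: "0 < s \<Longrightarrow> s < 1 \<Longrightarrow> (heat_psi d s)\<^sup>2 = real d / 2 * (s * ln (1 / s))"
proof -
  assume s: "0 < s" "s < 1"
  have "s * ln (s powr (- real d / 2)) = real d / 2 * (s * ln (1 / s))"
    using s by (simp add: ln_powr ln_div)
  moreover have "0 \<le> s * ln (1 / s)" using s by simp
  moreover have "heat_psi d s = sqrt (s * ln (s powr (- real d / 2)))"
    using s by (simp only: heat_psi_def simp_thms if_True)
  ultimately show ?thesis by (simp only: real_sqrt_pow2_iff) simp
qed

text \<open>The maximum of \<open>s * ln (1 / s)\<close> is \<open>1 / e\<close>, by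
  \<open>ln y \<le> y - 1\<close> at \<open>y = 1 / (e * s)\<close>. Together with the factor
  \<open>e / (2 * d)\<close> in \<open>heat_alpha\<close> this keeps every jump within the distance
  to the boundary.\<close>

lemma heat_psi_square_le: "(heat_psi d s)\<^sup>2 * (2 * exp 1) \<le> real d"
proof (cases "0 < s \<and> s < 1")
  case True
  then have s: "0 < s" "s < 1" by auto
  have "ln (1 / (exp 1 * s)) \<le> 1 / (exp 1 * s) - 1"
    using s by (intro ln_le_minus_one) simp
  moreover have "ln (1 / (exp 1 * s)) = ln (1 / s) - 1"
    using s by (simp add: ln_div ln_mult)
  ultimately have "ln (1 / s) \<le> 1 / (exp 1 * s)" by simp
  then have "s * ln (1 / s) * exp 1 \<le> s * (1 / (exp 1 * s)) * exp 1"
    using s by (intro mult_right_mono mult_left_mono) auto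
  also have "\<dots> = 1" using s by simp
  finally have "real d * (s * ln (1 / s) * exp 1) \<le> real d * 1" by (rule mult_left_mono) simp
  then show ?thesis unfolding heat_psi_square[OF s] by (simp add: mult_ac)
next
  case False
  then have "heat_psi d s = 0" by (simp only: heat_psi_def if_False)
  then show ?thesis by simp
qed

lemma heat_psi_measurable [measurable]: "heat_psi d \<in> borel_measurable borel"
  unfolding heat_psi_def by measurable

text \<open>The recursion as a deterministic map of the state and the fresh inputs, so that the mean
  of a step is an iterated integral over their laws.\<close>

definition heat_step :: "(real ^ 'n) set \<Rightarrow> real \<times> (real ^ 'n) \<Rightarrow> real \<Rightarrow> real ^ 'n \<Rightarrow> real \<times> (real ^ 'n)" where
  "heat_step D z r v = (let a = heat_alpha D (fst z) (snd z)
     in (fst z - a * r, snd z + (2 * sqrt a * heat_psi CARD('n) r) *\<^sub>R v))"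

context thick_domain
begin

text \<open>The closure, because a jump of maximal length may end on the boundary.\<close>

definition heat_states :: "(real \<times> (real ^ 'n)) set" where
  "heat_states = {0..} \<times> closure D"

text \<open>Equals \<open>e / (2 * d) * 2^2\<close>, a bound for the spatial part of
  \<open>heat_alpha\<close> on \<open>D\<close>, where the distance to the boundary is below
  2.\<close>

definition time_cap :: real where "time_cap = 2 * exp 1 / real CARD('n)"

definition lyapunov :: "real \<Rightarrow> real \<times> (real ^ 'n) \<Rightarrow> ennreal" where
  "lyapunov \<gamma> z = ennreal (weight \<gamma> (snd z) * min (fst z) time_cap)"

lemma time_cap_pos: "time_cap > 0" by (simp add: time_cap_def)

lemma weight_nonneg: "0 \<le> weight \<gamma> x"
  by (simp add: weight_def)

lemma weight_le_1: "0 \<le> \<gamma> \<Longrightarrow> weight \<gamma> x \<le> 1"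
  using potential_nonneg[of x] by (auto simp: weight_def indicator_def)

lemma heat_alpha_measurable [measurable (raw)]:
  assumes [measurable]: "f \<in> borel_measurable N" "h \<in> borel_measurable N"
  shows "(\<lambda>x. heat_alpha D (f x) (h x)) \<in> borel_measurable N"
proof -
  have [measurable]: "bdist \<in> borel_measurable borel"
    by (intro borel_measurable_continuous_onI continuous_on_infdist continuous_on_id)
  show ?thesis unfolding heat_alpha_def by measurable
qed

lemma lyapunov_measurable [measurable]: "lyapunov \<gamma> \<in> borel_measurable (borel \<Otimes>\<^sub>M borel)"
  unfolding lyapunov_def by measurable

lemma heat_states_measurable [measurable]: "heat_states \<in> sets (borel \<Otimes>\<^sub>M borel)"
  unfolding heat_states_def by (intro pair_measureI) auto

lemma heat_step_measurable [measurable (raw)]: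
  assumes [measurable]: "z \<in> N \<rightarrow>\<^sub>M borel \<Otimes>\<^sub>M borel" "r \<in> borel_measurable N" "v \<in> borel_measurable N"
  shows "(\<lambda>x. heat_step D (z x) (r x) (v x)) \<in> N \<rightarrow>\<^sub>M borel \<Otimes>\<^sub>M borel"
  unfolding heat_step_def Let_def by measurable

lemma heat_alpha_nonneg: "0 \<le> t \<Longrightarrow> 0 \<le> heat_alpha D t x"
  by (simp add: heat_alpha_def)

lemma heat_alpha_frozen:
  assumes "z \<in> heat_states" "snd z \<notin> D \<or> fst z = 0"
  shows "heat_alpha D (fst z) (snd z) = 0"
proof (cases "snd z \<in> D")
  case False
  then have "snd z \<in> frontier D" using assms open_D by (auto simp: heat_states_def frontier_def interior_open)
  then have "bdist (snd z) = 0" by simp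
  then show ?thesis using assms(1) by (auto simp: heat_alpha_def heat_states_def)
qed (use assms(2) in \<open>simp add: heat_alpha_def\<close>)

lemma heat_step_frozen:
  assumes "z \<in> heat_states" "snd z \<notin> D \<or> fst z = 0"
  shows "heat_step D z r v = z"
  unfolding heat_step_def heat_alpha_frozen[OF assms] by simp

lemma heat_jump_le:
  assumes "x \<in> D" "0 \<le> t"
  shows "2 * sqrt (heat_alpha D t x) * heat_psi CARD('n) r \<le> bdist x"
proof (rule power2_le_imp_le)
  let ?d = "real CARD('n)"
  have "(2 * sqrt (heat_alpha D t x) * heat_psi CARD('n) r)\<^sup>2 = 4 * heat_alpha D t x * (heat_psi CARD('n) r)\<^sup>2"
    using heat_alpha_nonneg[OF assms(2)] by (simp add: power_mult_distrib)
  also have "\<dots> \<le> 4 * (exp 1 / (2 * ?d) * (bdist x)\<^sup>2) * (heat_psi CARD('n) r)\<^sup>2"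
    by (intro mult_right_mono mult_left_mono) (auto simp: heat_alpha_def)
  also have "\<dots> = (bdist x)\<^sup>2 * ((heat_psi CARD('n) r)\<^sup>2 * (2 * exp 1)) / ?d" by simp
  also have "\<dots> \<le> (bdist x)\<^sup>2 * ?d / ?d"
    by (intro divide_right_mono mult_left_mono heat_psi_square_le) auto
  finally show "(2 * sqrt (heat_alpha D t x) * heat_psi CARD('n) r)\<^sup>2 \<le> (bdist x)\<^sup>2" by simp
qed (rule infdist_nonneg)

lemma cball_bdist: "x \<in> D \<Longrightarrow> cball x (bdist x) \<subseteq> closure D"
proof -
  assume x: "x \<in> D"
  have "ball x (bdist x) \<subseteq> D"
    using bdist_le[OF x] by (force simp: dist_norm)
  then have "closure (ball x (bdist x)) \<subseteq> closure D" by (rule closure_mono)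
  then show ?thesis using bdist_pos[OF x] by simp
qed

lemma heat_step_states:
  assumes z: "z \<in> heat_states" and r: "0 < r" "r < 1" and v: "norm v = 1"
  shows "heat_step D z r v \<in> heat_states"
proof (cases "snd z \<in> D")
  case True
  let ?a = "heat_alpha D (fst z) (snd z)"
  have t: "0 \<le> fst z" using z by (auto simp: heat_states_def)
  have a: "0 \<le> ?a" "?a \<le> fst z" using heat_alpha_nonneg[OF t] by (auto simp: heat_alpha_def)
  have "?a * r \<le> ?a * 1" using a r by (intro mult_left_mono) auto
  then have "0 \<le> fst z - ?a * r" using a by simp
  moreover have "snd z + (2 * sqrt ?a * heat_psi CARD('n) r) *\<^sub>R v \<in> cball (snd z) (bdist (snd z))"
    using heat_jump_le[OF True t, of r] v a heat_psi_nonneg[of "CARD('n)" r] by (simp add: dist_norm)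
  ultimately show ?thesis using cball_bdist[OF True] by (auto simp: heat_step_def Let_def heat_states_def)
next
  case False
  then show ?thesis using heat_step_frozen[OF z] z by simp
qed

text \<open>Any law \<open>L\<close> on the open unit interval will do: the mean \<open>m1\<close>
  of the relative time decrement and the mean \<open>m2\<close> of \<open>h\<close> are both
  positive, and they are the two sources of decay.\<close>

lemma lyapunov_drift:
  assumes L: "prob_space L" "sets L = sets borel" "AE r in L. 0 < r \<and> r < 1"
  obtains \<gamma> q :: real where "0 < \<gamma>" "0 < q" "q < 1"
    and "\<And>z. z \<in> heat_states \<Longrightarrow>
      (\<integral>\<^sup>+r. (\<integral>\<^sup>+v. lyapunov \<gamma> (heat_step D z r v) \<partial>uniform_sphere) \<partial>L) \<le> ennreal q * lyapunov \<gamma> z"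
proof -
  interpret L: prob_space L by fact
  note L(2)[measurable_cong]
  let ?d = "real CARD('n)"
  \<comment> \<open>When space limits the step, \<open>h r\<close> is the squared ratio of the jump
    length to the boundary distance; it does not depend on the position.\<close>
  define h where "h r = 2 * exp 1 / ?d * (heat_psi CARD('n) r)\<^sup>2" for r
  have [measurable]: "h \<in> borel_measurable borel" unfolding h_def by measurable
  have h01: "0 \<le> h r" "h r \<le> 1" for r
    using heat_psi_square_le[of "CARD('n)" r] by (auto simp: h_def field_simps)
  have h_pos: "0 < h r" if "0 < r" "r < 1" for r
    using that by (simp add: h_def heat_psi_square)
  have int_h: "integrable L h" by (rule L.integrable_const_bound[where B=1]) (use h01 in auto)
  have int_r: "integrable L (\<lambda>r. r)"
    by (rule L.integrable_const_bound[where B=1]) (use L(3) in \<open>eventually_elim, auto\<close>)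
  have pos: "0 < (\<integral>r. f r \<partial>L)" if f: "integrable L f" "\<And>r. 0 < r \<Longrightarrow> r < 1 \<Longrightarrow> 0 < f r" for f :: "real \<Rightarrow> real"
  proof -
    have "AE r in L. 0 < f r" using L(3) by eventually_elim (use f(2) in auto)
    then have "(\<integral>r. 0 \<partial>L) < (\<integral>r. f r \<partial>L)"
      by (intro L.integral_less_AE_space f(1)) (auto simp: L.emeasure_space_1)
    then show ?thesis by simp
  qed
  define m1 where "m1 = (\<integral>r. r \<partial>L)"
  define m2 where "m2 = (\<integral>r. h r \<partial>L)"
  have m1: "0 < m1" unfolding m1_def by (rule pos[OF int_r]) 
  have m2: "0 < m2" unfolding m2_def by (rule pos[OF int_h h_pos])
  have m1': "m1 < 1"
    using pos[of "\<lambda>r. 1 - r"] int_r by (simp add: m1_def L.prob_space)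
  show thesis
  proof (rule weight_drift)
    fix c C :: real
    assume cC: "c > 0" "C > 0"
      and drift: "\<And>x s \<gamma>. x \<in> D \<Longrightarrow> 0 \<le> s \<Longrightarrow> s \<le> bdist x \<Longrightarrow> 0 < \<gamma> \<Longrightarrow> \<gamma> * C \<le> 1 \<Longrightarrow>
        (\<integral>\<^sup>+v. ennreal (weight \<gamma> (x + s *\<^sub>R v)) \<partial>uniform_sphere) \<le>
        ennreal (weight \<gamma> x * (1 - \<gamma> * (c * (s / bdist x)\<^sup>2) + (\<gamma> * C)\<^sup>2))"
    \<comment> \<open>The first bound makes the second-order loss \<open>\<epsilon>\<close> at most
      half of \<open>m1\<close>, the second makes it at most half of the mean gain
      \<open>\<gamma> * (c * m2)\<close>, and the third keeps
      \<open>1 - \<gamma> * (c * h r)\<close> nonnegative.\<close>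
    define \<gamma> where "\<gamma> = min (m1 / (2 * C)) (min (c * m2 / (2 * C\<^sup>2)) (1 / c))"
    have \<gamma>: "0 < \<gamma>" "\<gamma> * C \<le> m1 / 2" "\<gamma> * C\<^sup>2 \<le> c * m2 / 2" "\<gamma> * c \<le> 1"
    proof -
      show "0 < \<gamma>" using cC m1 m2 by (simp add: \<gamma>_def)
      have "\<gamma> \<le> m1 / (2 * C)" "\<gamma> \<le> c * m2 / (2 * C\<^sup>2)" "\<gamma> \<le> 1 / c" by (simp_all add: \<gamma>_def)
      then show "\<gamma> * C \<le> m1 / 2" "\<gamma> * C\<^sup>2 \<le> c * m2 / 2" "\<gamma> * c \<le> 1"
        using cC by (simp_all add: field_simps)
    qed
    define \<epsilon> where "\<epsilon> = (\<gamma> * C)\<^sup>2"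
    have \<epsilon>: "0 \<le> \<epsilon>" "\<epsilon> \<le> m1 / 2" "\<epsilon> \<le> \<gamma> * (c * m2) / 2"
    proof -
      show "0 \<le> \<epsilon>" by (simp add: \<epsilon>_def)
      have "\<epsilon> \<le> (\<gamma> * C) * 1" unfolding \<epsilon>_def power2_eq_square
        using \<gamma> m1' cC by (intro mult_left_mono) auto
      then show "\<epsilon> \<le> m1 / 2" using \<gamma> by simp
      have "\<epsilon> = \<gamma> * (\<gamma> * C\<^sup>2)" by (simp add: \<epsilon>_def power2_eq_square)
      also have "\<dots> \<le> \<gamma> * (c * m2 / 2)" using \<gamma> by (intro mult_left_mono) auto
      finally show "\<epsilon> \<le> \<gamma> * (c * m2) / 2" by simp
    qed
    \<comment> \<open>The two rates belong to steps limited by time and by space, in this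
      order.\<close>
    define q where "q = max ((1 + \<epsilon>) * (1 - m1)) (1 - \<gamma> * (c * m2) + \<epsilon>)"
    have q: "0 < q" "q < 1"
    proof -
      have "0 < (1 + \<epsilon>) * (1 - m1)" using \<epsilon> m1' by simp
      then show "0 < q" by (simp add: q_def)
      have "(1 + \<epsilon>) * (1 - m1) = 1 - m1 + \<epsilon> - \<epsilon> * m1" by (simp add: algebra_simps)
      also have "\<dots> \<le> 1 - m1 + \<epsilon>" using \<epsilon> m1 by simp
      also have "\<dots> < 1" using \<epsilon> m1 by simp
      finally have "(1 + \<epsilon>) * (1 - m1) < 1" .
      moreover have "0 < \<gamma> * (c * m2)" using \<gamma> cC m2 by simp
      then have "1 - \<gamma> * (c * m2) + \<epsilon> < 1" using \<epsilon> by linarith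
      ultimately show "q < 1" by (simp add: q_def)
    qed
    show thesis
    proof (rule that[OF \<gamma>(1) q])
      fix z assume z: "z \<in> heat_states"
      obtain t x where tx: "z = (t, x)" by (cases z)
      have t: "0 \<le> t" using z by (simp add: tx heat_states_def)
      show "(\<integral>\<^sup>+r. (\<integral>\<^sup>+v. lyapunov \<gamma> (heat_step D z r v) \<partial>uniform_sphere) \<partial>L) \<le> ennreal q * lyapunov \<gamma> z"
      proof (cases "x \<in> D \<and> t \<noteq> 0")
        case False
        then have "lyapunov \<gamma> z = 0" using time_cap_pos by (auto simp: lyapunov_def tx weight_def)
        moreover have "heat_step D z r v = z" for r v
          using heat_step_frozen[OF z] False by (auto simp: tx)
        ultimately show ?thesis by simp
      next
        case True
        then have x: "x \<in> D" and t0: "0 < t" using t by auto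
        let ?\<delta> = "bdist x"
        have \<delta>: "0 < ?\<delta>" "?\<delta> < 2" using bdist_pos[OF x] bdist_less_2[OF x] by auto
        define a where "a = heat_alpha D t x"
        have a: "0 < a" using t0 \<delta> by (simp add: a_def heat_alpha_def)
        define s where "s r = 2 * sqrt a * heat_psi CARD('n) r" for r
        have s: "0 \<le> s r" "s r \<le> ?\<delta>" for r
          using heat_jump_le[OF x t] a heat_psi_nonneg[of "CARD('n)" r] by (auto simp: s_def a_def)
        have step: "heat_step D z r v = (t - a * r, x + s r *\<^sub>R v)" for r v
          by (simp add: heat_step_def tx a_def s_def Let_def)
        have W: "0 \<le> weight \<gamma> y" for y by (rule weight_nonneg)
        have inner: "(\<integral>\<^sup>+v. lyapunov \<gamma> (heat_step D z r v) \<partial>uniform_sphere) \<le>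
            ennreal (min (t - a * r) time_cap * (weight \<gamma> x * (1 - \<gamma> * (c * (s r / ?\<delta>)\<^sup>2) + \<epsilon>)))"
          if r: "0 < r" "r < 1" for r
        proof -
          have "a * r \<le> a * 1" using a r by (intro mult_left_mono) auto
          then have tr: "0 \<le> min (t - a * r) time_cap"
            using time_cap_pos by (simp add: a_def heat_alpha_def)
          have "(\<integral>\<^sup>+v. lyapunov \<gamma> (heat_step D z r v) \<partial>uniform_sphere) =
             (\<integral>\<^sup>+v. ennreal (min (t - a * r) time_cap) * ennreal (weight \<gamma> (x + s r *\<^sub>R v)) \<partial>uniform_sphere)"
            using tr W by (intro nn_integral_cong) (simp add: lyapunov_def step ennreal_mult[symmetric] mult.commute)
          also have "\<dots> = ennreal (min (t - a * r) time_cap) * (\<integral>\<^sup>+v. ennreal (weight \<gamma> (x + s r *\<^sub>R v)) \<partial>uniform_sphere)"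
            by (rule nn_integral_cmult) measurable
          also have "\<dots> \<le> ennreal (min (t - a * r) time_cap) * ennreal (weight \<gamma> x * (1 - \<gamma> * (c * (s r / ?\<delta>)\<^sup>2) + (\<gamma> * C)\<^sup>2))"
            using \<gamma> m1' by (intro mult_left_mono drift x s) auto
          also have "\<dots> = ennreal (min (t - a * r) time_cap * (weight \<gamma> x * (1 - \<gamma> * (c * (s r / ?\<delta>)\<^sup>2) + \<epsilon>)))"
            using tr by (simp add: ennreal_mult' \<epsilon>_def)
          finally show ?thesis .
        qed
        \<comment> \<open>Hence the cap is inactive whenever time limits the step.\<close>
        have cap: "exp 1 / (2 * ?d) * ?\<delta>\<^sup>2 \<le> time_cap"
        proof -
          have "?\<delta>\<^sup>2 \<le> 2\<^sup>2" using \<delta> by (intro power_mono) auto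
          then have "exp 1 / (2 * ?d) * ?\<delta>\<^sup>2 \<le> exp 1 / (2 * ?d) * 2\<^sup>2" by (intro mult_left_mono) auto
          then show ?thesis by (simp add: time_cap_def)
        qed
        show ?thesis
        proof (cases "t \<le> exp 1 / (2 * ?d) * ?\<delta>\<^sup>2")
          case True
          then have at: "a = t" by (simp add: a_def heat_alpha_def)
          have tcap: "t \<le> time_cap" using True cap by simp
          \<comment> \<open>The time left shrinks by \<open>1 - r\<close>, while the mean weight
            grows by at most the factor \<open>1 + \<epsilon>\<close>.\<close>
          let ?w = "t * (weight \<gamma> x * (1 + \<epsilon>))"
          have w: "0 \<le> ?w" using t W \<epsilon> by simp
          have "(\<integral>\<^sup>+r. (\<integral>\<^sup>+v. lyapunov \<gamma> (heat_step D z r v) \<partial>uniform_sphere) \<partial>L) \<le> (\<integral>\<^sup>+r. ennreal (?w * (1 - r)) \<partial>L)"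
          proof (rule nn_integral_mono_AE)
            show "AE r in L. (\<integral>\<^sup>+v. lyapunov \<gamma> (heat_step D z r v) \<partial>uniform_sphere) \<le> ennreal (?w * (1 - r))"
              using L(3)
            proof eventually_elim
              case (elim r)
              then have r: "0 < r" "r < 1" by auto
              have "t * r \<le> t" using t r by (simp add: mult_left_le)
              then have "min (t - a * r) time_cap = t * (1 - r)"
                using tcap mult_nonneg_nonneg[OF t less_imp_le[OF r(1)]] by (simp add: at algebra_simps)
              moreover have "weight \<gamma> x * (1 - \<gamma> * (c * (s r / ?\<delta>)\<^sup>2) + \<epsilon>) \<le> weight \<gamma> x * (1 + \<epsilon>)"
                using W \<gamma> cC by (intro mult_left_mono) auto
              then have "t * (1 - r) * (weight \<gamma> x * (1 - \<gamma> * (c * (s r / ?\<delta>)\<^sup>2) + \<epsilon>)) \<le> t * (1 - r) * (weight \<gamma> x * (1 + \<epsilon>))"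
                by (rule mult_left_mono) (use t r in auto)
              ultimately have "min (t - a * r) time_cap * (weight \<gamma> x * (1 - \<gamma> * (c * (s r / ?\<delta>)\<^sup>2) + \<epsilon>)) \<le> t * (1 - r) * (weight \<gamma> x * (1 + \<epsilon>))"
                by (simp only:)
              also have "\<dots> = ?w * (1 - r)" by simp
              finally show ?case using inner[OF r] by (meson ennreal_leI order_trans)
            qed
          qed
          also have "\<dots> = ennreal (\<integral>r. ?w * (1 - r) \<partial>L)"
          proof (rule nn_integral_eq_integral)
            show "integrable L (\<lambda>r. ?w * (1 - r))" using int_r by (intro integrable_mult_right) auto
            show "AE r in L. 0 \<le> ?w * (1 - r)" using L(3)
              by eventually_elim (rule mult_nonneg_nonneg[OF w], simp)
          qed
          also have "(\<integral>r. ?w * (1 - r) \<partial>L) = ?w * (1 - m1)"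
            using int_r by (simp add: m1_def L.prob_space)
          also have "\<dots> = (1 + \<epsilon>) * (1 - m1) * (weight \<gamma> x * t)" by simp
          also have "\<dots> \<le> q * (weight \<gamma> x * t)"
            using t W by (intro mult_right_mono) (auto simp: q_def)
          also have "ennreal (q * (weight \<gamma> x * t)) = ennreal q * lyapunov \<gamma> z"
            using q tcap by (simp add: lyapunov_def tx ennreal_mult' min_absorb1)
          finally show ?thesis by (simp add: ennreal_leI)
        next
          case False
          then have at: "a = exp 1 / (2 * ?d) * ?\<delta>\<^sup>2" by (simp add: a_def heat_alpha_def)
          have sh: "(s r / ?\<delta>)\<^sup>2 = h r" for r
            using \<delta> a by (simp add: s_def h_def at power_mult_distrib power_divide)
          let ?w = "min t time_cap * weight \<gamma> x"
          have w: "0 \<le> ?w" using t W time_cap_pos by simp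
          have nn: "0 \<le> 1 - \<gamma> * (c * h r) + \<epsilon>" for r
          proof -
            have "\<gamma> * (c * h r) = (\<gamma> * c) * h r" by simp
            also have "\<dots> \<le> 1 * 1" using \<gamma> h01[of r] cC by (intro mult_mono) auto
            finally show ?thesis using \<epsilon> by simp
          qed
          have "(\<integral>\<^sup>+r. (\<integral>\<^sup>+v. lyapunov \<gamma> (heat_step D z r v) \<partial>uniform_sphere) \<partial>L) \<le> (\<integral>\<^sup>+r. ennreal (?w * (1 - \<gamma> * (c * h r) + \<epsilon>)) \<partial>L)"
          proof (rule nn_integral_mono_AE)
            show "AE r in L. (\<integral>\<^sup>+v. lyapunov \<gamma> (heat_step D z r v) \<partial>uniform_sphere) \<le> ennreal (?w * (1 - \<gamma> * (c * h r) + \<epsilon>))"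
              using L(3)
            proof eventually_elim
              case (elim r)
              then have r: "0 < r" "r < 1" by auto
              \<comment> \<open>Here the time factor merely does not increase; the decay comes from
                the weight.\<close>
              have "min (t - a * r) time_cap \<le> min t time_cap" using a r by (intro min.mono) auto
              then have "min (t - a * r) time_cap * (weight \<gamma> x * (1 - \<gamma> * (c * h r) + \<epsilon>)) \<le> min t time_cap * (weight \<gamma> x * (1 - \<gamma> * (c * h r) + \<epsilon>))"
                using nn W by (intro mult_right_mono) auto
              also have "\<dots> = ?w * (1 - \<gamma> * (c * h r) + \<epsilon>)" by simp
              finally show ?case using inner[OF r] unfolding sh by (meson ennreal_leI order_trans)
            qed
          qed
          also have "\<dots> = ennreal (\<integral>r. ?w * (1 - \<gamma> * (c * h r) + \<epsilon>) \<partial>L)"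
          proof (rule nn_integral_eq_integral)
            show "integrable L (\<lambda>r. ?w * (1 - \<gamma> * (c * h r) + \<epsilon>))" using int_h by (intro integrable_mult_right) auto
            show "AE r in L. 0 \<le> ?w * (1 - \<gamma> * (c * h r) + \<epsilon>)" 
              by (intro AE_I2 mult_nonneg_nonneg[OF w nn])
          qed
          also have "(\<integral>r. ?w * (1 - \<gamma> * (c * h r) + \<epsilon>) \<partial>L) = ?w * (1 - \<gamma> * (c * m2) + \<epsilon>)"
            using int_h by (simp add: m2_def L.prob_space)
          also have "\<dots> \<le> ?w * q"
            using w by (intro mult_left_mono) (auto simp: q_def)
          also have "ennreal (?w * q) = ennreal q * lyapunov \<gamma> z"
            using q by (simp add: lyapunov_def tx ennreal_mult'[symmetric] mult_ac)
          finally show ?thesis by (simp add: ennreal_leI)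
        qed
      qed
    qed
  qed
qed

end

section \<open>Independence of the inputs\<close>

lemma AE_coord_space_neq:
  assumes i: "i < k"
  shows "AE x in coord_space k. x i \<noteq> c"
proof -
  interpret product_sigma_finite "\<lambda>_. lborel :: real measure" by unfold_locales
  let ?A = "\<lambda>j. if j = i then {c} else UNIV :: real set"
  have "emeasure (coord_space k) (Pi\<^sub>E {..<k} ?A) = (\<Prod>j<k. emeasure lborel (?A j))"
    by (rule emeasure_PiM) auto
  also have "\<dots> = 0" using i by (intro prod_zero) auto
  finally have "Pi\<^sub>E {..<k} ?A \<in> null_sets (coord_space k)"
    by (auto simp: null_sets_def intro!: sets_PiM_I_finite)
  moreover have "{x \<in> space (coord_space k). \<not> x i \<noteq> c} \<subseteq> Pi\<^sub>E {..<k} ?A"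
    using i by (auto simp: space_PiM PiE_def Pi_def)
  ultimately show ?thesis by (rule AE_I')
qed

lemma AE_uniform_cube: "AE x in uniform_cube k. \<forall>i<k. 0 < x i \<and> x i < 1"
proof -
  have "AE x in coord_space k. \<forall>i\<in>{..<k}. x i \<noteq> 0 \<and> x i \<noteq> 1"
    by (rule AE_finite_allI) (auto simp: AE_conj_iff AE_coord_space_neq)
  then have "AE x in coord_space k. x \<in> Pi\<^sub>E {..<k} (\<lambda>_. {0..1}) \<longrightarrow> (\<forall>i<k. 0 < x i \<and> x i < 1)"
    by eventually_elim (force simp: PiE_def Pi_def less_le)
  then show ?thesis unfolding uniform_cube_def
    by (intro AE_uniform_measureI) (auto intro!: sets_PiM_I_finite)
qed

lemma Int_stable_preimages: "Int_stable {X -` A \<inter> S |A. A \<in> sets N}"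
  unfolding Int_stable_def
proof safe
  fix A B assume "A \<in> sets N" "B \<in> sets N"
  then show "\<exists>C. X -` A \<inter> S \<inter> (X -` B \<inter> S) = X -` C \<inter> S \<and> C \<in> sets N"
    by (intro exI[of _ "A \<inter> B"]) auto
qed

lemma space_in_preimages:
  assumes "X \<in> M \<rightarrow>\<^sub>M N"
  shows "space M \<in> {X -` A \<inter> space M |A. A \<in> sets N}"
  using measurable_space[OF assms] by (auto intro!: exI[of _ "space N"])

lemma seq_sigma_component:
  assumes Y: "\<And>n. 1 \<le> n \<Longrightarrow> Y n \<in> M \<rightarrow>\<^sub>M N" and n: "1 \<le> (n :: nat)" and A: "A \<in> sets N"
  shows "Y n -` A \<inter> space M \<in> seq_sigma M N Y"
proof -
  let ?P = "Pi\<^sub>M {1..} (\<lambda>_. N) :: (nat \<Rightarrow> _) measure"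
  have "(\<lambda>f. f n) \<in> ?P \<rightarrow>\<^sub>M N" using n by (intro measurable_component_singleton) auto
  then have "(\<lambda>f. f n) -` A \<inter> space ?P \<in> sets ?P" using A by (rule measurable_sets)
  then have "(\<lambda>\<omega>. \<lambda>n\<in>{1..}. Y n \<omega>) -` ((\<lambda>f. f n) -` A \<inter> space ?P) \<inter> space M \<in> seq_sigma M N Y"
    unfolding seq_sigma_def by (rule in_vimage_algebra)
  moreover have "(\<lambda>\<omega>. \<lambda>n\<in>{1..}. Y n \<omega>) -` ((\<lambda>f. f n) -` A \<inter> space ?P) \<inter> space M = Y n -` A \<inter> space M"
    using n measurable_space[OF Y] by (auto simp: space_PiM)
  ultimately show ?thesis by simp
qed

abbreviation cube_space :: "'n itself \<Rightarrow> (nat \<Rightarrow> real) measure" where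
  "cube_space T \<equiv> coord_space (cube_dim T)"

text \<open>\<open>heat_R\<close> as a fixed function of a pair of inputs, which makes its law the
  same for every \<open>n\<close>.\<close>

definition ratio_map :: "'n::finite itself \<Rightarrow> (nat \<Rightarrow> real) \<times> real \<Rightarrow> real" where
  "ratio_map T p = (\<Prod>i<cube_dim T. fst p i) powr (2 / real CARD('n)) *
     exp (- (1 - 2 / real CARD('n) * real (CARD('n) div 2)) * (snd p)\<^sup>2)"

lemma less_3_cases:
  fixes j :: nat
  assumes "j < 3"
  obtains "j = 0" | "j = 1" | "j = 2"
  using assms by linarith

context rwhb_inputs
begin

text \<open>The index \<open>(n, j)\<close> stands for \<open>U n\<close>, \<open>G n\<close> or \<open>V n\<close> according to \<open>j = 0, 1, 2\<close>.\<close>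

definition input_events :: "nat \<times> nat \<Rightarrow> 'w set set" where
  "input_events i = [{U (fst i) -` A \<inter> space M |A. A \<in> sets (cube_space TYPE('n))},
     {G (fst i) -` A \<inter> space M |A. A \<in> sets borel},
     {V (fst i) -` A \<inter> space M |A. A \<in> sets borel}] ! snd i"

text \<open>For \<open>I = {1..n} \<times> {..<3}\<close> this is the natural filtration of the
  inputs at time \<open>n\<close>.\<close>

definition input_sigma :: "(nat \<times> nat) set \<Rightarrow> 'w measure" where
  "input_sigma I = sigma (space M) (\<Union>i\<in>I. input_events i)"

lemma measurable_inputs [measurable]:
  assumes "1 \<le> n"
  shows "U n \<in> M \<rightarrow>\<^sub>M cube_space TYPE('n)" and "G n \<in> borel_measurable M" and "V n \<in> borel_measurable M"
  using indep_U indep_G indep_V assms by (auto simp: indep_vars_def)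

lemma input_events_subset:
  assumes "i \<in> {1..} \<times> {..<3}"
  shows "input_events i \<subseteq> events"
  using assms by (auto simp: input_events_def elim!: less_3_cases 
    intro!: measurable_sets[OF measurable_inputs(1)] measurable_sets[OF measurable_inputs(2)]
      measurable_sets[OF measurable_inputs(3)])

lemma input_events_pow: "snd i < 3 \<Longrightarrow> input_events i \<subseteq> Pow (space M)"
  by (auto simp: input_events_def elim!: less_3_cases)

lemma space_in_input_events:
  assumes "i \<in> {1..} \<times> {..<3}"
  shows "space M \<in> input_events i"
proof -
  have "1 \<le> fst i" "snd i < 3" using assms by auto
  then show ?thesis
    using space_in_preimages[OF measurable_inputs(1)] space_in_preimages[OF measurable_inputs(2)]
      space_in_preimages[OF measurable_inputs(3)]
    by (auto simp: input_events_def elim!: less_3_cases)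
qed

lemma Int_stable_input_events: "snd i < 3 \<Longrightarrow> Int_stable (input_events i)"
  by (auto simp: input_events_def elim!: less_3_cases intro!: Int_stable_preimages)

text \<open>\<open>indep_UGV\<close> factors an intersection over the three sequences, and
  independence inside each sequence factors what remains over \<open>n\<close>.\<close>

lemma input_events_indep: "indep_sets input_events ({1..} \<times> {..<3})"
proof (rule indep_setsI)
  fix A J
  assume J: "J \<noteq> {}" "J \<subseteq> {1..} \<times> {..<3}" "finite J" and A: "\<forall>i\<in>J. A i \<in> input_events i"
  define N where "N = fst ` J"
  have N: "finite N" "N \<noteq> {}" "\<And>n. n \<in> N \<Longrightarrow> 1 \<le> n" using J by (auto simp: N_def)
  \<comment> \<open>Indices missing from \<open>J\<close> get the whole space, which turns
    \<open>J\<close> into a rectangle without changing the intersection.\<close>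
  define A' where "A' i = (if i \<in> J then A i else space M)" for i
  have A': "A' (n, j) \<in> input_events (n, j)" if "n \<in> N" "j < 3" for n j
    using that A N space_in_input_events[of "(n, j)"] by (auto simp: A'_def)
  define B where "B j = (\<Inter>n\<in>N. A' (n, j))" for j
  have J_sub: "J \<subseteq> N \<times> {..<3}" using J by (force simp: N_def)
  have A_space: "A i \<subseteq> space M" if "i \<in> J" for i
    using A that J input_events_pow[of i] by fastforce
  have INT_eq: "(\<Inter>i\<in>J. A i) = (\<Inter>j\<in>{..<3}. B j)"
  proof
    show "(\<Inter>i\<in>J. A i) \<subseteq> (\<Inter>j\<in>{..<3}. B j)"
      using J(1) A_space by (fastforce simp: B_def A'_def)
    show "(\<Inter>j\<in>{..<3}. B j) \<subseteq> (\<Inter>i\<in>J. A i)"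
    proof
      fix \<omega> assume \<omega>: "\<omega> \<in> (\<Inter>j\<in>{..<3}. B j)"
      show "\<omega> \<in> (\<Inter>i\<in>J. A i)"
      proof
        fix i assume i: "i \<in> J"
        obtain n j where ij: "i = (n, j)" by (cases i)
        then have "n \<in> N" "j < 3" using J_sub i by auto
        with \<omega> ij have "\<omega> \<in> A' i" by (auto simp: B_def)
        with i show "\<omega> \<in> A i" by (simp add: A'_def)
      qed
    qed
  qed
  let ?S = "\<lambda>j. [seq_sigma M (cube_space TYPE('n)) U, seq_sigma M borel G, seq_sigma M borel V] ! j"
  have B_in: "B j \<in> ?S j" if j: "j < 3" for j
  proof -
    have "A' (n, j) \<in> ?S j" if n: "n \<in> N" for n
      using A'[OF n j] N(3)[OF n] measurable_inputs
      by (cases rule: less_3_cases[OF j]) (auto simp: input_events_def intro!: seq_sigma_component)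
    then show ?thesis
      using N(1,2) by (cases rule: less_3_cases[OF j]) (auto simp: B_def seq_sigma_def intro!: sets.finite_INT)
  qed
  have B_prob: "prob (B j) = (\<Prod>n\<in>N. prob (A' (n, j)))" if j: "j < 3" for j
    unfolding B_def
  proof (rule indep_setsD[where I="{1..}" and F="\<lambda>n. input_events (n, j)"])
    show "indep_sets (\<lambda>n. input_events (n, j)) {1..}"
      using indep_U indep_G indep_V
      by (cases rule: less_3_cases[OF j]) (auto simp: input_events_def indep_vars_def2)
  qed (use N A' j in auto)
  have "prob (\<Inter>i\<in>J. A i) = (\<Prod>j\<in>{..<3}. prob (B j))"
  proof -
    have "{..<3::nat} \<noteq> {}" by (metis lessThan_iff empty_iff zero_less_numeral)
    then show ?thesis
      unfolding INT_eq by (intro indep_setsD[OF indep_UGV]) (use B_in in auto)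
  qed
  also have "\<dots> = (\<Prod>j\<in>{..<3}. \<Prod>n\<in>N. prob (A' (n, j)))"
    using B_prob by (intro prod.cong) auto
  also have "\<dots> = (\<Prod>n\<in>N. \<Prod>j\<in>{..<3}. prob (A' (n, j)))" by (rule prod.swap)
  also have "\<dots> = (\<Prod>i\<in>N \<times> {..<3}. prob (A' i))"
    by (simp add: prod.cartesian_product)
  also have "\<dots> = (\<Prod>i\<in>J. prob (A' i))"
    using N J_sub by (intro prod.mono_neutral_right) (auto simp: A'_def prob_space)
  also have "\<dots> = (\<Prod>i\<in>J. prob (A i))"
    by (intro prod.cong) (auto simp: A'_def)
  finally show "prob (\<Inter>i\<in>J. A i) = (\<Prod>i\<in>J. prob (A i))" .
qed (rule input_events_subset)

lemma space_input_sigma [simp]: "space (input_sigma I) = space M"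
  by (simp add: input_sigma_def space_measure_of_conv)

lemma sets_input_sigma:
  assumes "I \<subseteq> {1..} \<times> {..<3}"
  shows "sets (input_sigma I) = sigma_sets (space M) (\<Union>i\<in>I. input_events i)"
  unfolding input_sigma_def using assms input_events_pow by (intro sets_measure_of) fastforce

lemma measurable_input_sigma_mono:
  assumes "I \<subseteq> J" "J \<subseteq> {1..} \<times> {..<3}" "X \<in> input_sigma I \<rightarrow>\<^sub>M N"
  shows "X \<in> input_sigma J \<rightarrow>\<^sub>M N"
proof -
  have "sets (input_sigma I) \<subseteq> sets (input_sigma J)"
    using assms(1,2) by (simp add: sets_input_sigma subset_trans[OF assms(1,2)] sigma_sets_mono' UN_mono)
  then show ?thesis using assms(3) by (auto simp: measurable_def)
qed

lemma measurable_input_sigma_events: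
  assumes "I \<subseteq> {1..} \<times> {..<3}" "X \<in> input_sigma I \<rightarrow>\<^sub>M N"
  shows "X \<in> M \<rightarrow>\<^sub>M N"
proof -
  have "sets (input_sigma I) \<subseteq> events"
    using assms(1) input_events_subset by (auto simp: sets_input_sigma intro!: sets.sigma_sets_subset) 
  then show ?thesis using assms(2) by (auto simp: measurable_def)
qed

lemma measurable_input_sigma_component:
  assumes I: "I \<subseteq> {1..} \<times> {..<3}" "i \<in> I" and X: "X \<in> M \<rightarrow>\<^sub>M N"
    and ev: "input_events i = {X -` A \<inter> space M |A. A \<in> sets N}"
  shows "X \<in> input_sigma I \<rightarrow>\<^sub>M N"
proof (rule measurableI)
  fix A assume "A \<in> sets N"
  then have "X -` A \<inter> space M \<in> (\<Union>i\<in>I. input_events i)" using I(2) ev by auto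
  then show "X -` A \<inter> space (input_sigma I) \<in> sets (input_sigma I)"
    by (simp add: sets_input_sigma[OF I(1)] sigma_sets.Basic)
qed (use measurable_space[OF X] in simp)

lemma measurable_input_sigma:
  assumes I: "I \<subseteq> {1..} \<times> {..<3}"
  shows "(n, 0) \<in> I \<Longrightarrow> U n \<in> input_sigma I \<rightarrow>\<^sub>M cube_space TYPE('n)"
    and "(n, 1) \<in> I \<Longrightarrow> G n \<in> borel_measurable (input_sigma I)"
    and "(n, 2) \<in> I \<Longrightarrow> V n \<in> borel_measurable (input_sigma I)"
proof -
  show "(n, 0) \<in> I \<Longrightarrow> U n \<in> input_sigma I \<rightarrow>\<^sub>M cube_space TYPE('n)"
    by (rule measurable_input_sigma_component[OF I _ measurable_inputs(1)])
      ((simp add: input_events_def; fail) | use I in force)+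
  show "(n, 1) \<in> I \<Longrightarrow> G n \<in> borel_measurable (input_sigma I)"
    by (rule measurable_input_sigma_component[OF I _ measurable_inputs(2)])
      ((simp add: input_events_def; fail) | use I in force)+
  show "(n, 2) \<in> I \<Longrightarrow> V n \<in> borel_measurable (input_sigma I)"
    by (rule measurable_input_sigma_component[OF I _ measurable_inputs(3)])
      ((simp add: input_events_def; fail) | use I in force)+
qed

text \<open>Disjoint index sets give independent \<sigma>-algebras, since the generators are stable
  under intersection. The conclusion is a product law, so that \<open>X\<close> and \<open>Y\<close>
  may have values in different types.\<close>

lemma distr_Pair_input_sigma:
  assumes I: "I \<subseteq> {1..} \<times> {..<3}" and J: "J \<subseteq> {1..} \<times> {..<3}" and disj: "I \<inter> J = {}"
    and X: "X \<in> input_sigma I \<rightarrow>\<^sub>M S" and Y: "Y \<in> input_sigma J \<rightarrow>\<^sub>M T"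
  shows "distr M (S \<Otimes>\<^sub>M T) (\<lambda>\<omega>. (X \<omega>, Y \<omega>)) = distr M S X \<Otimes>\<^sub>M distr M T Y"
proof (rule pair_measure_eqI[symmetric])
  have [measurable]: "X \<in> M \<rightarrow>\<^sub>M S" "Y \<in> M \<rightarrow>\<^sub>M T"
    using measurable_input_sigma_events[OF I X] measurable_input_sigma_events[OF J Y] by auto
  interpret X: prob_space "distr M S X" by (rule prob_space_distr) simp
  interpret Y: prob_space "distr M T Y" by (rule prob_space_distr) simp
  show "sigma_finite_measure (distr M S X)" "sigma_finite_measure (distr M T Y)" by unfold_locales
  have "indep_sets (\<lambda>b. sigma_sets (space M) (\<Union>i\<in>case_bool I J b. input_events i)) UNIV"
  proof (rule indep_sets_collect_sigma)
    show "indep_sets input_events (\<Union>b\<in>UNIV. case_bool I J b)"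
      using I J by (intro indep_sets_mono_index[OF _ input_events_indep]) (auto simp: UNIV_bool)
    show "Int_stable (input_events i)" if "i \<in> case_bool I J b" for b i
      using that I J by (intro Int_stable_input_events) (auto split: bool.splits)
    show "disjoint_family_on (case_bool I J) UNIV"
      using disj by (auto simp: disjoint_family_on_def split: bool.splits)
  qed
  then have "indep_sets (case_bool (sets (input_sigma I)) (sets (input_sigma J))) UNIV"
    by (rule indep_sets_mono_sets) (auto simp: sets_input_sigma[OF I] sets_input_sigma[OF J] split: bool.splits)
  then have indep: "indep_set (sets (input_sigma I)) (sets (input_sigma J))"
    by (simp add: indep_set_def)
  fix A B assume "A \<in> sets (distr M S X)" "B \<in> sets (distr M T Y)"
  then have [measurable]: "A \<in> sets S" "B \<in> sets T" by auto
  have "X -` A \<inter> space M \<in> sets (input_sigma I)" "Y -` B \<inter> space M \<in> sets (input_sigma J)"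
    using measurable_sets[OF X \<open>A \<in> sets S\<close>] measurable_sets[OF Y \<open>B \<in> sets T\<close>] by auto
  then have "prob ((X -` A \<inter> space M) \<inter> (Y -` B \<inter> space M)) = prob (X -` A \<inter> space M) * prob (Y -` B \<inter> space M)"
    by (rule indep_setD[OF indep])
  moreover have "(\<lambda>\<omega>. (X \<omega>, Y \<omega>)) -` (A \<times> B) \<inter> space M = (X -` A \<inter> space M) \<inter> (Y -` B \<inter> space M)" by auto
  ultimately show "emeasure (distr M S X) A * emeasure (distr M T Y) B = emeasure (distr M (S \<Otimes>\<^sub>M T) (\<lambda>\<omega>. (X \<omega>, Y \<omega>))) (A \<times> B)"
    by (simp add: emeasure_distr emeasure_eq_measure ennreal_mult[symmetric])
qed simp

lemma ratio_eq: "heat_R TYPE('n) U G n = (\<lambda>\<omega>. ratio_map TYPE('n) (U n \<omega>, G n \<omega>))"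
  by (simp add: heat_R_def ratio_map_def fun_eq_iff)

lemma ratio_map_measurable [measurable]: "ratio_map TYPE('n) \<in> borel_measurable (cube_space TYPE('n) \<Otimes>\<^sub>M borel)"
proof -
  have [measurable]: "(\<lambda>p. fst p i) \<in> borel_measurable (cube_space TYPE('n) \<Otimes>\<^sub>M (borel :: real measure))" if "i < cube_dim TYPE('n)" for i
    using measurable_compose[OF measurable_fst measurable_component_singleton[of i "{..<cube_dim TYPE('n)}" "\<lambda>_. lborel"]] that
    by simp
  have [measurable]: "(\<lambda>p. \<Prod>i<cube_dim TYPE('n). fst p i) \<in> borel_measurable (cube_space TYPE('n) \<Otimes>\<^sub>M (borel :: real measure))"
    by (rule borel_measurable_prod) simp
  show ?thesis unfolding ratio_map_def by measurable
qed

lemma ratio_input_sigma: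
  assumes "I \<subseteq> {1..} \<times> {..<3}" "(n, 0) \<in> I" "(n, 1) \<in> I"
  shows "heat_R TYPE('n) U G n \<in> borel_measurable (input_sigma I)"
  unfolding ratio_eq using measurable_input_sigma[OF assms(1)] assms(2,3)
  by (intro measurable_compose[OF measurable_Pair ratio_map_measurable]) auto

lemma ratio_measurable [measurable]:
  assumes "1 \<le> n"
  shows "heat_R TYPE('n) U G n \<in> borel_measurable M"
  using assms by (intro measurable_input_sigma_events[OF _ ratio_input_sigma[of "{n} \<times> {..<3}"]]) auto

lemma distr_ratio:
  assumes n: "1 \<le> n"
  shows "distr M borel (heat_R TYPE('n) U G n) = distr M borel (heat_R TYPE('n) U G 1)"
proof -
  have *: "distr M borel (heat_R TYPE('n) U G m) = distr (uniform_cube (cube_dim TYPE('n)) \<Otimes>\<^sub>M density lborel std_normal_density) borel (ratio_map TYPE('n))"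
    if m: "1 \<le> m" for m
  proof -
    have "distr M (cube_space TYPE('n) \<Otimes>\<^sub>M borel) (\<lambda>x. (U m x, G m x)) = distr M (cube_space TYPE('n)) (U m) \<Otimes>\<^sub>M distr M borel (G m)"
      using m by (intro distr_Pair_input_sigma[of "{(m, 0)}" "{(m, 1)}"] measurable_input_sigma) auto
    then have "distr M (cube_space TYPE('n) \<Otimes>\<^sub>M borel) (\<lambda>x. (U m x, G m x)) = uniform_cube (cube_dim TYPE('n)) \<Otimes>\<^sub>M density lborel std_normal_density"
      by (simp add: law_U[OF m] law_G[OF m])
    moreover have "distr M borel (heat_R TYPE('n) U G m) = distr (distr M (cube_space TYPE('n) \<Otimes>\<^sub>M borel) (\<lambda>x. (U m x, G m x))) borel (ratio_map TYPE('n))"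
      using measurable_inputs[OF m] by (subst distr_distr) (auto simp: ratio_eq comp_def)
    ultimately show ?thesis by simp
  qed
  show ?thesis using *[OF n] *[of 1] by simp
qed

text \<open>Strictness below 1 comes from the coordinates of \<open>U n\<close>, of which there is
  at least one; the Gaussian factor is constantly 1 for even \<open>d\<close>.\<close>

lemma AE_ratio:
  assumes n: "1 \<le> n"
  shows "AE \<omega> in M. 0 < heat_R TYPE('n) U G n \<omega> \<and> heat_R TYPE('n) U G n \<omega> < 1"
proof -
  let ?k = "cube_dim TYPE('n)" and ?d = "real CARD('n)"
  have "AE x in distr M (cube_space TYPE('n)) (U n). \<forall>i<?k. 0 < x i \<and> x i < 1"
    unfolding law_U[OF n] by (rule AE_uniform_cube)
  then have "AE \<omega> in M. \<forall>i<?k. 0 < U n \<omega> i \<and> U n \<omega> i < 1"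
    by (rule AE_distrD[OF measurable_inputs(1)[OF n]])
  then show ?thesis
  proof eventually_elim
    case (elim \<omega>)
    define P where "P = (\<Prod>i<?k. U n \<omega> i)"
    have k: "0 < ?k" by (simp add: cube_dim_def)
    have P0: "0 < P" unfolding P_def using elim by (intro prod_pos) auto
    have "P = U n \<omega> 0 * (\<Prod>i\<in>{..<?k} - {0}. U n \<omega> i)"
      unfolding P_def using k by (intro prod.remove) auto
    also have "\<dots> \<le> U n \<omega> 0 * 1"
      using elim k by (intro mult_left_mono prod_le_1) (auto intro: less_imp_le)
    finally have "P \<le> U n \<omega> 0" by simp
    moreover have "U n \<omega> 0 < 1" using elim k by blast
    ultimately have P1: "P < 1" by linarith
    have pw: "0 < P powr (2 / ?d)" "P powr (2 / ?d) < 1"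
      using P0 P1 powr_less_mono2[of "2 / ?d" P 1] by auto
    have "2 * real (CARD('n) div 2) \<le> ?d"
      by (metis of_nat_le_iff of_nat_mult of_nat_numeral times_div_less_eq_dividend)
    then have "0 \<le> 1 - 2 / ?d * real (CARD('n) div 2)" by (simp add: field_simps)
    then have ex: "exp (- (1 - 2 / ?d * real (CARD('n) div 2)) * (G n \<omega>)\<^sup>2) \<le> 1"
      by (simp add: mult_nonneg_nonneg del: minus_diff_eq)
    have "heat_R TYPE('n) U G n \<omega> \<le> P powr (2 / ?d) * 1"
      unfolding heat_R_def P_def[symmetric] using ex pw by (intro mult_left_mono) auto
    then have "heat_R TYPE('n) U G n \<omega> < 1" using pw by linarith
    moreover have "0 < heat_R TYPE('n) U G n \<omega>" unfolding heat_R_def P_def[symmetric] using pw by (intro mult_pos_pos) auto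
    ultimately show ?case by simp
  qed
qed

lemma AE_V_norm:
  assumes n: "1 \<le> n"
  shows "AE \<omega> in M. norm (V n \<omega>) = 1"
proof -
  have "AE v in distr M borel (V n). norm v = 1"
    unfolding law_V[OF n] by (rule uniform_sphere_norm)
  then show ?thesis by (rule AE_distrD[OF measurable_inputs(3)[OF n]])
qed

end

section \<open>Number of steps\<close>

locale heat_walk_thick = rwhb_inputs M U G V + thick_domain D c0
  for M :: "'w measure" and U :: "nat \<Rightarrow> 'w \<Rightarrow> nat \<Rightarrow> real" and G :: "nat \<Rightarrow> 'w \<Rightarrow> real"
    and V :: "nat \<Rightarrow> 'w \<Rightarrow> real ^ 'n" and D :: "(real ^ 'n) set" and c0 :: real
begin

abbreviation walk :: "real \<Rightarrow> real ^ 'n \<Rightarrow> nat \<Rightarrow> 'w \<Rightarrow> real \<times> (real ^ 'n)" where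
  "walk \<equiv> heat_walk D U G V"

definition walk_alpha :: "real \<Rightarrow> real ^ 'n \<Rightarrow> nat \<Rightarrow> 'w \<Rightarrow> real" where
  "walk_alpha t x n \<omega> = heat_alpha D (fst (walk t x n \<omega>)) (snd (walk t x n \<omega>))"

text \<open>Counts every index with \<open>walk_alpha\<close> above \<open>\<epsilon>\<close>,
  including those after the first stop. It dominates the number of steps, and as a sum of measurable
  indicators its mean is a sum of probabilities at fixed times, with no stopping-time
  argument.\<close>

definition active_count :: "real \<Rightarrow> real ^ 'n \<Rightarrow> real \<Rightarrow> 'w \<Rightarrow> ennreal" where
  "active_count t x \<epsilon> \<omega> = (\<Sum>n. indicator {\<omega>. \<epsilon> < walk_alpha t x n \<omega>} \<omega>)"

lemma walk_Suc:
  "walk t x (Suc n) \<omega> = heat_step D (walk t x n \<omega>) (heat_R TYPE('n) U G (Suc n) \<omega>) (V (Suc n) \<omega>)"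
  by (simp add: heat_step_def case_prod_beta Let_def)

text \<open>Adaptedness: the first \<open>n\<close> inputs determine the state, which makes it
  independent of the inputs of the next step.\<close>

lemma walk_input_sigma: "walk t x n \<in> input_sigma ({1..n} \<times> {..<3}) \<rightarrow>\<^sub>M borel \<Otimes>\<^sub>M borel"
proof (induction n)
  case 0
  show ?case by simp
next
  case (Suc n)
  let ?I = "{1..Suc n} \<times> {..<3::nat}"
  have I: "?I \<subseteq> {1..} \<times> {..<3}" by auto
  have "walk t x n \<in> input_sigma ?I \<rightarrow>\<^sub>M borel \<Otimes>\<^sub>M borel"
    by (rule measurable_input_sigma_mono[OF _ I Suc]) auto
  moreover have "heat_R TYPE('n) U G (Suc n) \<in> borel_measurable (input_sigma ?I)"
    by (rule ratio_input_sigma[OF I]) auto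
  moreover have "V (Suc n) \<in> borel_measurable (input_sigma ?I)"
    by (rule measurable_input_sigma(3)[OF I]) auto
  ultimately show ?case unfolding walk_Suc by (rule heat_step_measurable)
qed

lemma walk_measurable [measurable]: "walk t x n \<in> M \<rightarrow>\<^sub>M borel \<Otimes>\<^sub>M borel"
  by (rule measurable_input_sigma_events[OF _ walk_input_sigma]) auto

lemma walk_alpha_measurable [measurable]: "walk_alpha t x n \<in> borel_measurable M"
  unfolding walk_alpha_def by measurable

lemma AE_walk_states:
  assumes "0 \<le> t" "x \<in> D"
  shows "AE \<omega> in M. \<forall>n. walk t x n \<omega> \<in> heat_states"
proof -
  have "AE \<omega> in M. \<forall>n. 0 < heat_R TYPE('n) U G (Suc n) \<omega> \<and> heat_R TYPE('n) U G (Suc n) \<omega> < 1 \<and> norm (V (Suc n) \<omega>) = 1"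
    unfolding AE_all_countable
  proof
    fix n
    show "AE \<omega> in M. 0 < heat_R TYPE('n) U G (Suc n) \<omega> \<and> heat_R TYPE('n) U G (Suc n) \<omega> < 1 \<and> norm (V (Suc n) \<omega>) = 1"
      using AE_ratio[of "Suc n"] AE_V_norm[of "Suc n"] by (simp add: AE_conj_iff)
  qed
  then show ?thesis
  proof eventually_elim
    case (elim \<omega>)
    show ?case
    proof
      fix n
      show "walk t x n \<omega> \<in> heat_states"
      proof (induction n)
        case 0
        show ?case using assms closure_subset[of D] by (auto simp: heat_states_def)
      next
        case (Suc n)
        show ?case unfolding walk_Suc using elim by (intro heat_step_states Suc) auto
      qed
    qed
  qed
qed

text \<open>The Markov property in integrated form: the state, the new ratio and the new direction
  have a product law, to which Fubini applies.\<close>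

lemma nn_integral_lyapunov_Suc:
  "(\<integral>\<^sup>+\<omega>. lyapunov \<gamma> (walk t x (Suc n) \<omega>) \<partial>M) =
    (\<integral>\<^sup>+\<omega>. (\<integral>\<^sup>+r. (\<integral>\<^sup>+v. lyapunov \<gamma> (heat_step D (walk t x n \<omega>) r v) \<partial>uniform_sphere)
      \<partial>distr M borel (heat_R TYPE('n) U G 1)) \<partial>M)"
proof -
  let ?S = "borel \<Otimes>\<^sub>M borel :: (real \<times> (real ^ 'n)) measure"
  let ?L = "distr M borel (heat_R TYPE('n) U G 1)" and ?\<mu> = "uniform_sphere :: (real ^ 'n) measure"
  let ?R = "heat_R TYPE('n) U G (Suc n)" and ?V = "V (Suc n)" and ?W = "walk t x n"
  let ?I = "{1..n} \<times> {..<3::nat}" and ?J = "{Suc n} \<times> {..<3::nat}"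
  have R [measurable]: "?R \<in> borel_measurable M" "heat_R TYPE('n) U G 1 \<in> borel_measurable M"
    by (rule ratio_measurable; simp)+
  have V [measurable]: "?V \<in> borel_measurable M" by (rule measurable_inputs) simp
  interpret L: prob_space ?L by (rule prob_space_distr) measurable
  interpret \<mu>: prob_space ?\<mu> by (rule prob_space_uniform_sphere)
  interpret L\<mu>: pair_prob_space ?L ?\<mu> by unfold_locales
  have "distr M (borel \<Otimes>\<^sub>M borel) (\<lambda>\<omega>. (?R \<omega>, ?V \<omega>)) = distr M borel ?R \<Otimes>\<^sub>M distr M borel ?V"
    by (rule distr_Pair_input_sigma[of "{(Suc n, 0), (Suc n, 1)}" "{(Suc n, 2)}"])
      (auto intro!: ratio_input_sigma measurable_input_sigma)
  also have "\<dots> = ?L \<Otimes>\<^sub>M ?\<mu>"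
    using distr_ratio[of "Suc n"] law_V[of "Suc n"] by simp
  finally have RV: "distr M (borel \<Otimes>\<^sub>M borel) (\<lambda>\<omega>. (?R \<omega>, ?V \<omega>)) = ?L \<Otimes>\<^sub>M ?\<mu>" .
  have "distr M (?S \<Otimes>\<^sub>M (borel \<Otimes>\<^sub>M borel)) (\<lambda>\<omega>. (?W \<omega>, (?R \<omega>, ?V \<omega>))) =
      distr M ?S ?W \<Otimes>\<^sub>M distr M (borel \<Otimes>\<^sub>M borel) (\<lambda>\<omega>. (?R \<omega>, ?V \<omega>))"
  proof (rule distr_Pair_input_sigma[of ?I ?J])
    show "(\<lambda>\<omega>. (?R \<omega>, ?V \<omega>)) \<in> input_sigma ?J \<rightarrow>\<^sub>M borel \<Otimes>\<^sub>M borel"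
      by (rule measurable_Pair[OF ratio_input_sigma measurable_input_sigma(3)]) auto
    show "?W \<in> input_sigma ?I \<rightarrow>\<^sub>M ?S" by (rule walk_input_sigma)
  qed auto
  then have joint: "distr M (?S \<Otimes>\<^sub>M (borel \<Otimes>\<^sub>M borel)) (\<lambda>\<omega>. (?W \<omega>, (?R \<omega>, ?V \<omega>))) = distr M ?S ?W \<Otimes>\<^sub>M (?L \<Otimes>\<^sub>M ?\<mu>)"
    by (simp only: RV)
  define F where "F p = lyapunov \<gamma> (heat_step D (fst p) (fst (snd p)) (snd (snd p)))" for p
  have F [measurable]: "F \<in> borel_measurable (?S \<Otimes>\<^sub>M (borel \<Otimes>\<^sub>M borel))"
    unfolding F_def by measurable
  have sets_eq: "sets (?L \<Otimes>\<^sub>M ?\<mu>) = sets (borel \<Otimes>\<^sub>M borel)"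
    by (rule sets_pair_measure_cong) simp_all
  have F1: "F \<in> borel_measurable (distr M ?S ?W \<Otimes>\<^sub>M (?L \<Otimes>\<^sub>M ?\<mu>))"
    using F by (simp cong: measurable_cong_sets sets_pair_measure_cong add: sets_eq)
  have F2: "(\<lambda>p. F (z, p)) \<in> borel_measurable (?L \<Otimes>\<^sub>M ?\<mu>)" for z
    using measurable_compose[OF measurable_Pair1' F, of z] by (simp add: measurable_cong_sets[OF sets_eq refl] space_pair_measure)
  have "(\<integral>\<^sup>+\<omega>. lyapunov \<gamma> (walk t x (Suc n) \<omega>) \<partial>M) = (\<integral>\<^sup>+\<omega>. F (?W \<omega>, (?R \<omega>, ?V \<omega>)) \<partial>M)"
    unfolding walk_Suc F_def by simp
  also have "\<dots> = (\<integral>\<^sup>+p. F p \<partial>distr M (?S \<Otimes>\<^sub>M (borel \<Otimes>\<^sub>M borel)) (\<lambda>\<omega>. (?W \<omega>, (?R \<omega>, ?V \<omega>))))"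
    by (rule nn_integral_distr[symmetric]) measurable
  also have "\<dots> = (\<integral>\<^sup>+z. (\<integral>\<^sup>+p. F (z, p) \<partial>(?L \<Otimes>\<^sub>M ?\<mu>)) \<partial>distr M ?S ?W)"
    unfolding joint by (rule L\<mu>.nn_integral_fst[symmetric, OF F1])
  also have "\<dots> = (\<integral>\<^sup>+z. (\<integral>\<^sup>+r. (\<integral>\<^sup>+v. F (z, (r, v)) \<partial>?\<mu>) \<partial>?L) \<partial>distr M ?S ?W)"
    using \<mu>.nn_integral_fst[OF F2] by simp
  also have "\<dots> = (\<integral>\<^sup>+\<omega>. (\<integral>\<^sup>+r. (\<integral>\<^sup>+v. F (?W \<omega>, (r, v)) \<partial>?\<mu>) \<partial>?L) \<partial>M)"
  proof (rule nn_integral_distr)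
    have "(\<lambda>p. \<integral>\<^sup>+v. F (fst p, (snd p, v)) \<partial>?\<mu>) \<in> borel_measurable (?S \<Otimes>\<^sub>M borel)"
      by (rule \<mu>.borel_measurable_nn_integral) (simp add: case_prod_beta F_def, measurable)
    then have "(\<lambda>z. \<integral>\<^sup>+r. (\<integral>\<^sup>+v. F (z, (r, v)) \<partial>?\<mu>) \<partial>?L) \<in> borel_measurable ?S"
      by (intro L.borel_measurable_nn_integral) (simp add: case_prod_beta)
    then show "(\<lambda>z. \<integral>\<^sup>+r. (\<integral>\<^sup>+v. F (z, (r, v)) \<partial>?\<mu>) \<partial>?L) \<in> borel_measurable (distr M ?S ?W)"
      by simp
  qed measurable
  finally show ?thesis by (simp add: F_def)
qed

section \<open>From geometric decay to the logarithmic bound\<close>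

text \<open>A value of \<open>heat_alpha\<close> above \<open>\<epsilon>\<close> bounds both the
  time left and the boundary distance from below. The logarithmic bound on the potential then makes
  the weight at least a power of \<open>\<epsilon> = exp (- \<bar>ln \<epsilon>\<bar>)\<close>; the
  summand 1 in the exponent stems from the time factor.\<close>

lemma lyapunov_lower:
  assumes \<gamma>: "0 < \<gamma>" and z: "z \<in> heat_states" and \<epsilon>: "0 < \<epsilon>" "\<epsilon> \<le> exp (- 1)"
    and active: "\<epsilon> < heat_alpha D (fst z) (snd z)"
  shows "ennreal (min 1 time_cap * exp (- (6 * \<gamma> * (unit_ball_vol (real CARD('n)) * 2 ^ CARD('n)) + 1) * \<bar>ln \<epsilon>\<bar>)) \<le> lyapunov \<gamma> z"
proof -
  obtain t x where tx: "z = (t, x)" by (cases z)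
  let ?\<delta> = "bdist x" and ?d = "real CARD('n)"
  define B where "B = unit_ball_vol (real CARD('n)) * 2 ^ CARD('n)"
  have B: "0 \<le> B" by (simp add: B_def)
  define l where "l = \<bar>ln \<epsilon>\<bar>"
  have "ln \<epsilon> \<le> - 1" using \<epsilon> ln_le_cancel_iff[of \<epsilon> "exp (-1)"] by simp
  then have l: "1 \<le> l" "l = - ln \<epsilon>" by (auto simp: l_def)
  have exp_l: "exp (- l) = \<epsilon>" using \<epsilon> by (simp add: l)
  have \<epsilon>1: "\<epsilon> \<le> 1" using exp_l l(1) by (metis exp_le_one_iff neg_le_0_iff_le order_trans zero_le_one)
  have t: "\<epsilon> < t" and ed: "\<epsilon> < exp 1 / (2 * ?d) * ?\<delta>\<^sup>2" using active by (auto simp: heat_alpha_def tx)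
  have d: "1 \<le> ?d" by (simp add: Suc_le_eq)
  have "exp 1 / (2 * ?d) \<le> 3 / (2 * 1)" using d exp_le by (intro frac_le) auto
  then have "exp 1 / (2 * ?d) * ?\<delta>\<^sup>2 \<le> 3 / 2 * ?\<delta>\<^sup>2" by (intro mult_right_mono) auto
  with ed have e\<delta>: "\<epsilon> < 3 / 2 * ?\<delta>\<^sup>2" by simp
  \<comment> \<open>The true order is the square root of \<open>\<epsilon>\<close>; the cruder bound
    is enough because it enters only through a logarithm.\<close>
  have \<delta>: "\<epsilon> / 2 < ?\<delta>"
  proof (rule power2_less_imp_less)
    have "(\<epsilon> / 2)\<^sup>2 = \<epsilon> * \<epsilon> / 4" by (simp add: power2_eq_square)
    moreover have "\<epsilon> * \<epsilon> \<le> \<epsilon>" using \<epsilon> \<epsilon>1 by (intro mult_left_le) auto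
    ultimately show "(\<epsilon> / 2)\<^sup>2 < ?\<delta>\<^sup>2" using e\<delta> \<epsilon> by linarith
  qed (rule infdist_nonneg)
  then have \<delta>0: "0 < ?\<delta>" using \<epsilon> by simp
  have "x \<notin> frontier D" using \<delta>0 by auto
  then have x: "x \<in> D" using z open_D by (auto simp: tx heat_states_def frontier_def interior_open)
  \<comment> \<open>The constant 6:
    \<open>log 2 (8 / \<epsilon>) + 1 \<le> 4 + 2 * l \<le> 6 * l\<close>, because
    \<open>l \<ge> 1\<close>.\<close>
  have "log 2 (4 / ?\<delta>) \<le> log 2 (8 / \<epsilon>)"
    using \<delta> \<delta>0 \<epsilon> by (intro log_mono) (auto simp: field_simps)
  also have "\<dots> = 3 + l / ln 2"
  proof -
    have "ln (8 :: real) = 3 * ln 2" using ln_realpow[of 2 3] by simp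
    then show ?thesis using \<epsilon> by (simp add: log_def ln_div l field_simps)
  qed
  also have "l / ln 2 \<le> l / (1 / 2)"
    using l ln2_ge_two_thirds by (intro divide_left_mono) auto
  finally have "log 2 (4 / ?\<delta>) + 1 \<le> 6 * l" using l(1) by simp
  then have "B * (log 2 (4 / ?\<delta>) + 1) \<le> B * (6 * l)" using B by (rule mult_left_mono)
  moreover have "potential x \<le> B * (log 2 (4 / ?\<delta>) + 1)"
    unfolding B_def by (rule potential_le[OF x])
  ultimately have "potential x \<le> 6 * B * l" by simp
  then have "\<gamma> * potential x \<le> \<gamma> * (6 * B * l)" using \<gamma> by simp
  then have w: "exp (- (6 * \<gamma> * B) * l) \<le> weight \<gamma> x" using x by (simp add: weight_def mult_ac)
  have m: "min 1 time_cap * \<epsilon> \<le> min t time_cap"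
  proof -
    have "min 1 time_cap * \<epsilon> \<le> 1 * \<epsilon>" using \<epsilon> by (intro mult_right_mono) auto
    moreover have "min 1 time_cap * \<epsilon> \<le> time_cap * 1"
      using \<epsilon> \<epsilon>1 time_cap_pos by (intro mult_mono) auto
    ultimately show ?thesis using t by simp
  qed
  have "min 1 time_cap * exp (- (6 * \<gamma> * B + 1) * l) = exp (- (6 * \<gamma> * B) * l) * (min 1 time_cap * \<epsilon>)"
    unfolding exp_l[symmetric] by (simp add: exp_add[symmetric] algebra_simps)
  also have "\<dots> \<le> weight \<gamma> x * min t time_cap"
    using w m \<epsilon> time_cap_pos weight_nonneg by (intro mult_mono) auto
  finally show ?thesis unfolding lyapunov_def tx B_def l_def by (simp add: ennreal_leI)
qed

lemma active_count_bound:
  obtains C :: real where "C > 0"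
    and "\<And>t x \<epsilon>. 0 \<le> t \<Longrightarrow> x \<in> D \<Longrightarrow> 0 < \<epsilon> \<Longrightarrow> \<epsilon> \<le> exp (- 1) \<Longrightarrow>
      (\<integral>\<^sup>+\<omega>. active_count t x \<epsilon> \<omega> \<partial>M) \<le> ennreal (C * \<bar>ln \<epsilon>\<bar>)"
proof -
  let ?L = "distr M borel (heat_R TYPE('n) U G 1)"
  have R [measurable]: "heat_R TYPE('n) U G 1 \<in> borel_measurable M" by (rule ratio_measurable) simp
  have L: "prob_space ?L" by (rule prob_space_distr) measurable
  have AE_L: "AE r in ?L. 0 < r \<and> r < 1"
    using AE_ratio[of 1] by (subst AE_distr_iff) auto
  show thesis
  proof (rule lyapunov_drift[OF L _ AE_L])
    show "sets ?L = sets borel" by simp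
    fix \<gamma> q :: real
    assume \<gamma>: "0 < \<gamma>" and q: "0 < q" "q < 1"
      and drift: "\<And>z. z \<in> heat_states \<Longrightarrow>
        (\<integral>\<^sup>+r. (\<integral>\<^sup>+v. lyapunov \<gamma> (heat_step D z r v) \<partial>uniform_sphere) \<partial>?L) \<le> ennreal q * lyapunov \<gamma> z"
    define b where "b = 6 * \<gamma> * (unit_ball_vol (real CARD('n)) * 2 ^ CARD('n)) + 1"
    define m where "m = min 1 time_cap"
    define K where "K = time_cap / m"
    have b: "0 < b" using \<gamma> by (simp add: b_def add_nonneg_pos)
    have m: "0 < m" using time_cap_pos by (simp add: m_def)
    have K: "0 < K" using m time_cap_pos by (simp add: K_def)
    have lq: "0 < - ln q" using q by simp
    \<comment> \<open>\<open>b / (- ln q)\<close> and the 1 for rounding come from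
      \<open>n0\<close>, and \<open>K / (1 - q)\<close> from the geometric tail;
      \<open>l \<ge> 1\<close> absorbs the two constants that carry no factor
      \<open>l\<close>.\<close>
    define C where "C = b / (- ln q) + 1 + K / (1 - q)"
    have C: "C > 0"
    proof -
      have "0 < b / (- ln q)" using b lq by (rule divide_pos_pos)
      moreover have "0 < K / (1 - q)" using K q by (intro divide_pos_pos) auto
      ultimately show ?thesis unfolding C_def by linarith
    qed
    show thesis
    proof (rule that[OF C])
      fix t \<epsilon> :: real and x
      assume t: "0 \<le> t" and x: "x \<in> D" and \<epsilon>: "0 < \<epsilon>" "\<epsilon> \<le> exp (- 1)"
      define l where "l = \<bar>ln \<epsilon>\<bar>"
      have "ln \<epsilon> \<le> - 1" using \<epsilon> ln_le_cancel_iff[of \<epsilon> "exp (-1)"] by simp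
      then have l: "1 \<le> l" by (simp add: l_def)
      have decay: "(\<integral>\<^sup>+\<omega>. lyapunov \<gamma> (walk t x n \<omega>) \<partial>M) \<le> ennreal (q ^ n * time_cap)" for n
      proof (induction n)
        case 0
        have "lyapunov \<gamma> (t, x) \<le> ennreal (1 * time_cap)"
          unfolding lyapunov_def using weight_le_1[of \<gamma> x] \<gamma> weight_nonneg[of \<gamma> x] t time_cap_pos
          by (intro ennreal_leI mult_mono) auto
        then show ?case by (simp add: emeasure_space_1)
      next
        case (Suc n)
        have "(\<integral>\<^sup>+\<omega>. lyapunov \<gamma> (walk t x (Suc n) \<omega>) \<partial>M) \<le> (\<integral>\<^sup>+\<omega>. ennreal q * lyapunov \<gamma> (walk t x n \<omega>) \<partial>M)"
          unfolding nn_integral_lyapunov_Suc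
          by (rule nn_integral_mono_AE) (use AE_walk_states[OF t x] in eventually_elim, use drift in auto)
        also have "\<dots> = ennreal q * (\<integral>\<^sup>+\<omega>. lyapunov \<gamma> (walk t x n \<omega>) \<partial>M)"
          by (rule nn_integral_cmult) measurable
        also have "\<dots> \<le> ennreal q * ennreal (q ^ n * time_cap)" by (intro mult_left_mono Suc) simp
        also have "\<dots> = ennreal (q ^ Suc n * time_cap)"
          using q time_cap_pos by (simp add: ennreal_mult[symmetric] mult_ac)
        finally show ?case .
      qed
      define p where "p n = emeasure M {\<omega> \<in> space M. \<epsilon> < walk_alpha t x n \<omega>}" for n
      have tail: "p n \<le> ennreal (K * exp (b * l) * q ^ n)" for n
      proof -
        \<comment> \<open>Markov's inequality, with the threshold from
          \<open>lyapunov_lower\<close>.\<close>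
        have "ennreal (m * exp (- b * l)) * p n = (\<integral>\<^sup>+\<omega>. ennreal (m * exp (- b * l)) * indicator {\<omega> \<in> space M. \<epsilon> < walk_alpha t x n \<omega>} \<omega> \<partial>M)"
          unfolding p_def by (rule nn_integral_cmult_indicator[symmetric]) measurable
        also have "\<dots> \<le> (\<integral>\<^sup>+\<omega>. lyapunov \<gamma> (walk t x n \<omega>) \<partial>M)"
        proof (rule nn_integral_mono_AE)
          show "AE \<omega> in M. ennreal (m * exp (- b * l)) * indicator {\<omega> \<in> space M. \<epsilon> < walk_alpha t x n \<omega>} \<omega> \<le> lyapunov \<gamma> (walk t x n \<omega>)"
            using AE_walk_states[OF t x]
          proof eventually_elim
            case (elim \<omega>)
            then have "ennreal (m * exp (- b * l)) \<le> lyapunov \<gamma> (walk t x n \<omega>)" if "\<epsilon> < walk_alpha t x n \<omega>"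
              using lyapunov_lower[OF \<gamma> _ \<epsilon>, of "walk t x n \<omega>"] that
              by (simp add: m_def b_def l_def walk_alpha_def)
            then show ?case by (auto simp: indicator_def)
          qed
        qed
        also have "\<dots> \<le> ennreal (q ^ n * time_cap)" by (rule decay)
        finally have "ennreal (exp (b * l) / m) * (ennreal (m * exp (- b * l)) * p n) \<le> ennreal (exp (b * l) / m) * ennreal (q ^ n * time_cap)"
          by (rule mult_left_mono) simp
        moreover have "ennreal (exp (b * l) / m) * (ennreal (m * exp (- b * l)) * p n) = p n"
        proof -
          have "exp (b * l) / m * (m * exp (- b * l)) = 1" using m by (simp add: exp_minus)
          then have "ennreal (exp (b * l) / m) * ennreal (m * exp (- b * l)) = 1"
            using m by (subst ennreal_mult[symmetric]) auto
          then show ?thesis by (simp add: mult.assoc[symmetric])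
        qed
        moreover have "ennreal (exp (b * l) / m) * ennreal (q ^ n * time_cap) = ennreal (K * exp (b * l) * q ^ n)"
          using m q time_cap_pos by (subst ennreal_mult[symmetric]) (auto simp: K_def mult_ac)
        ultimately show ?thesis by simp
      qed
      \<comment> \<open>From step \<open>n0\<close> on, \<open>q ^ n\<close> has used up the factor
        \<open>exp (b * l)\<close>, a power of \<open>1 / \<epsilon>\<close>; before that each
        probability is bounded by 1. So \<open>n0\<close>, of order \<open>l\<close>, carries the
        logarithm.\<close>
      define n0 where "n0 = nat \<lceil>b * l / (- ln q)\<rceil>"
      have pos: "0 \<le> b * l / (- ln q)" using b l lq by (intro divide_nonneg_pos mult_nonneg_nonneg) auto
      have n0: "b * l / (- ln q) \<le> real n0" "real n0 \<le> b * l / (- ln q) + 1"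
        using pos unfolding n0_def by linarith+
      have qn0: "exp (b * l) * q ^ n0 \<le> 1"
      proof -
        have "b * l \<le> real n0 * (- ln q)" using n0(1) lq by (simp only: pos_divide_le_eq)
        then have "exp (b * l) \<le> exp (- (real n0 * ln q))" by simp
        also have "exp (- (real n0 * ln q)) * q ^ n0 = 1"
          using q by (simp add: exp_minus ln_realpow[symmetric] exp_of_nat_mult)
        then have "exp (- (real n0 * ln q)) = 1 / q ^ n0" using q by (simp add: field_simps)
        finally show ?thesis using q by (simp add: field_simps)
      qed
      define f where "f n = (if n < n0 then 1 else K * q ^ (n - n0))" for n
      have f_nn: "0 \<le> f n" for n using K q by (simp add: f_def)
      have pf: "p n \<le> ennreal (f n)" for n
      proof (cases "n < n0")
        case True
        then show ?thesis using prob_le_1 by (simp add: p_def f_def emeasure_eq_measure)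
      next
        case False
        then have "q ^ n = q ^ n0 * q ^ (n - n0)" by (simp add: power_add[symmetric])
        then have "K * exp (b * l) * q ^ n = (exp (b * l) * q ^ n0) * (K * q ^ (n - n0))" by simp
        also have "\<dots> \<le> 1 * (K * q ^ (n - n0))"
          using qn0 K q by (intro mult_right_mono) auto
        finally show ?thesis using tail[of n] False by (simp add: f_def) (meson ennreal_leI order_trans)
      qed
      have "(\<lambda>n. K * q ^ n) sums (K * (1 / (1 - q)))" using q by (intro sums_mult geometric_sums) simp
      then have "(\<lambda>n. f (n + n0)) sums (K / (1 - q) + real n0 - (\<Sum>i<n0. f i))" by (simp add: f_def)
      then have f_sums: "f sums (K / (1 - q) + real n0)" by (simp add: sums_iff_shift)
      have "(\<integral>\<^sup>+\<omega>. active_count t x \<epsilon> \<omega> \<partial>M) = (\<Sum>n. \<integral>\<^sup>+\<omega>. indicator {\<omega>. \<epsilon> < walk_alpha t x n \<omega>} \<omega> \<partial>M)"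
        unfolding active_count_def by (rule nn_integral_suminf) measurable
      also have "\<dots> = (\<Sum>n. p n)"
      proof (rule suminf_cong)
        fix n
        have "(\<integral>\<^sup>+\<omega>. indicator {\<omega>. \<epsilon> < walk_alpha t x n \<omega>} \<omega> \<partial>M) = (\<integral>\<^sup>+\<omega>. indicator {\<omega> \<in> space M. \<epsilon> < walk_alpha t x n \<omega>} \<omega> \<partial>M)"
          by (intro nn_integral_cong) (auto simp: indicator_def)
        also have "\<dots> = p n" unfolding p_def by (rule nn_integral_indicator) measurable
        finally show "(\<integral>\<^sup>+\<omega>. indicator {\<omega>. \<epsilon> < walk_alpha t x n \<omega>} \<omega> \<partial>M) = p n" .
      qed
      also have "\<dots> \<le> (\<Sum>n. ennreal (f n))" by (intro suminf_le pf) auto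
      also have "\<dots> = ennreal (K / (1 - q) + real n0)"
        by (rule suminf_ennreal_eq[OF f_nn f_sums])
      also have "\<dots> \<le> ennreal (C * l)"
      proof (rule ennreal_leI)
        have "K / (1 - q) * 1 \<le> K / (1 - q) * l" using K q l by (intro mult_left_mono) auto
        then have "K / (1 - q) + real n0 \<le> K / (1 - q) * l + (b * l / (- ln q) + l)"
          using n0(2) l by linarith
        also have "\<dots> = C * l" by (simp add: C_def algebra_simps)
        finally show "K / (1 - q) + real n0 \<le> C * l" .
      qed
      finally show "(\<integral>\<^sup>+\<omega>. active_count t x \<epsilon> \<omega> \<partial>M) \<le> ennreal (C * \<bar>ln \<epsilon>\<bar>)" by (simp add: l_def)
    qed
  qed
qed

text \<open>All indices below the infimum are active. Comparing with every finite \<open>m\<close>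
  up to it also covers an infinite infimum.\<close>

lemma heat_steps_le_active_count:
  "ennreal_of_enat (heat_steps D U G V t x \<epsilon> \<omega>) \<le> active_count t x \<epsilon> \<omega>"
proof -
  let ?N = "heat_steps D U G V t x \<epsilon> \<omega>"
  have active: "\<epsilon> < walk_alpha t x n \<omega>" if "enat n < ?N" for n
  proof (rule ccontr)
    assume "\<not> ?thesis"
    then have "?N \<le> enat n"
      unfolding heat_steps_def by (intro Inf_lower) (auto simp: walk_alpha_def case_prod_beta)
    with that show False by simp
  qed
  have le: "of_nat m \<le> active_count t x \<epsilon> \<omega>" if "enat m \<le> ?N" for m
  proof -
    have "(of_nat m :: ennreal) = (\<Sum>n<m. indicator {\<omega>. \<epsilon> < walk_alpha t x n \<omega>} \<omega>)"
      using active that by (simp add: order_less_le_trans[of "enat _" "enat m"])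
    also have "\<dots> \<le> active_count t x \<epsilon> \<omega>"
      unfolding active_count_def by (rule sum_le_suminf) auto
    finally show ?thesis .
  qed
  show ?thesis
  proof (cases ?N)
    case (enat m)
    with le[of m] show ?thesis by simp
  next
    case infinity
    then have "(SUP m. of_nat m) \<le> active_count t x \<epsilon> \<omega>" using le by (intro SUP_least) simp
    then show ?thesis by (simp add: ennreal_SUP_of_nat_eq_top infinity top_unique)
  qed
qed

lemma active_count_antimono:
  "\<epsilon>' \<le> \<epsilon> \<Longrightarrow> active_count t x \<epsilon> \<omega> \<le> active_count t x \<epsilon>' \<omega>"
  unfolding active_count_def by (intro suminf_le) (auto simp: indicator_def)

lemma active_count_measurable [measurable]: "active_count t x \<epsilon> \<in> borel_measurable M"
  unfolding active_count_def by measurable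

end

theorem theorem4p2:
  fixes D :: "(real ^ 'n) set"
    and M :: "'w measure"
    and U :: "nat \<Rightarrow> 'w \<Rightarrow> nat \<Rightarrow> real"
    and G :: "nat \<Rightarrow> 'w \<Rightarrow> real"
    and V :: "nat \<Rightarrow> 'w \<Rightarrow> real ^ 'n"
  assumes "is_domain D" and "finitely_connected D" and "D \<subseteq> ball 0 1" and "zero_thick D"
    and "rwhb_inputs M U G V"
  shows "(\<forall>t\<ge>0. \<forall>x\<in>D. \<forall>\<epsilon>>0. AE \<omega> in M. heat_steps D U G V t x \<epsilon> \<omega> < \<infinity>) \<and>
    (\<exists>C>0. \<exists>\<epsilon>\<^sub>0>0. \<forall>t\<ge>0. \<forall>x\<in>D. \<forall>\<epsilon>. 0 < \<epsilon> \<and> \<epsilon> \<le> \<epsilon>\<^sub>0 \<longrightarrow>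
       (\<integral>\<^sup>+ \<omega>. ennreal_of_enat (heat_steps D U G V t x \<epsilon> \<omega>) \<partial>M) \<le> ennreal (C * \<bar>ln \<epsilon>\<bar>))"
proof -
  have D: "open D" "D \<noteq> {}" using assms(1) by (auto simp: is_domain_def)
  show ?thesis
  proof (rule zero_thick_emeasure[OF assms(4) D(1)])
    fix c0 :: real
    assume c0: "c0 > 0" "\<And>x (r :: real). x \<in> frontier D \<Longrightarrow> 0 < r \<Longrightarrow> r < 1 \<Longrightarrow> ennreal (c0 * r ^ CARD('n)) \<le> emeasure lborel (ball x r - D)"
    interpret thick_domain D c0 by unfold_locales (use D assms(3) c0 in auto)
    interpret rwhb_inputs M U G V by fact
    interpret heat_walk_thick M U G V D c0 by unfold_locales
    show ?thesis
    proof (rule active_count_bound)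
      fix C :: real
      assume C: "C > 0" "\<And>t x \<epsilon>. 0 \<le> t \<Longrightarrow> x \<in> D \<Longrightarrow> 0 < \<epsilon> \<Longrightarrow> \<epsilon> \<le> exp (- 1) \<Longrightarrow>
        (\<integral>\<^sup>+\<omega>. active_count t x \<epsilon> \<omega> \<partial>M) \<le> ennreal (C * \<bar>ln \<epsilon>\<bar>)"
      show ?thesis
      proof (intro conjI allI ballI impI)
        fix t \<epsilon> :: real and x assume t: "0 \<le> t" and x: "x \<in> D" and \<epsilon>: "0 < \<epsilon>"
        \<comment> \<open>The bound on the mean is available only up to \<open>exp (- 1)\<close>. As
          \<open>active_count\<close> decreases in \<open>\<epsilon>\<close>, finiteness at the
          smaller level \<open>e\<close> suffices.\<close>
        define e where "e = min \<epsilon> (exp (- 1))"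
        have e: "0 < e" "e \<le> exp (- 1)" "e \<le> \<epsilon>" using \<epsilon> by (auto simp: e_def)
        have "(\<integral>\<^sup>+\<omega>. active_count t x e \<omega> \<partial>M) \<noteq> \<infinity>"
          using C(2)[OF t x e(1,2)] by (auto simp: top_unique)
        then have "AE \<omega> in M. active_count t x e \<omega> \<noteq> \<infinity>"
          by (intro nn_integral_PInf_AE) measurable
        then show "AE \<omega> in M. heat_steps D U G V t x \<epsilon> \<omega> < \<infinity>"
        proof eventually_elim
          case (elim \<omega>)
          have "ennreal_of_enat (heat_steps D U G V t x \<epsilon> \<omega>) \<le> active_count t x e \<omega>"
            using heat_steps_le_active_count active_count_antimono[OF e(3)] by (rule order_trans)
          with elim show ?case by (cases "heat_steps D U G V t x \<epsilon> \<omega>") (auto simp: top_unique)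
        qed
      next
        show "\<exists>C>0. \<exists>\<epsilon>\<^sub>0>0. \<forall>t\<ge>0. \<forall>x\<in>D. \<forall>\<epsilon>. 0 < \<epsilon> \<and> \<epsilon> \<le> \<epsilon>\<^sub>0 \<longrightarrow>
          (\<integral>\<^sup>+ \<omega>. ennreal_of_enat (heat_steps D U G V t x \<epsilon> \<omega>) \<partial>M) \<le> ennreal (C * \<bar>ln \<epsilon>\<bar>)"
        proof (rule exI[of _ C], rule conjI[OF C(1)], rule exI[of _ "exp (- 1)"], intro conjI allI ballI impI)
          fix t \<epsilon> :: real and x
          assume t: "0 \<le> t" and x: "x \<in> D" and \<epsilon>: "0 < \<epsilon> \<and> \<epsilon> \<le> exp (- 1)"
          have "(\<integral>\<^sup>+ \<omega>. ennreal_of_enat (heat_steps D U G V t x \<epsilon> \<omega>) \<partial>M) \<le> (\<integral>\<^sup>+\<omega>. active_count t x \<epsilon> \<omega> \<partial>M)"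
            by (intro nn_integral_mono heat_steps_le_active_count)
          also have "\<dots> \<le> ennreal (C * \<bar>ln \<epsilon>\<bar>)" using C(2)[OF t x] \<epsilon> by simp
          finally show "(\<integral>\<^sup>+ \<omega>. ennreal_of_enat (heat_steps D U G V t x \<epsilon> \<omega>) \<partial>M) \<le> ennreal (C * \<bar>ln \<epsilon>\<bar>)" .
        qed simp
      qed
    qed
  qed
qed

end
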